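(* Let $\mathbb L_\sigma(\lambda)=\lambda\mathbb M^{\mathcal S}_{-m}-\mathbb M^{\mathcal S}_\sigma$ be the Fiedler pencil of $G(\lambda)$ associated with a permutation $\sigma$ of $\{0,\dots,m-1\}$. Then $\mathbb L_\sigma(\lambda)$ is a Rosenbrock strong linearization of $G(\lambda)$. More precisely: (a) There exist $mn\times mn$ unimodular matrix polynomials $U(\lambda)$ and $V(\lambda)$, and $r\times r$ nonsingular matrices $U_0$ and $V_0$, such that $$\left[\begin{array}{c|c}U(\lambda)&0\\ \hline 0&U_0\end{array}\right]\mathbb L_\sigma(\lambda)\left[\begin{array}{c|c}V(\lambda)&0\\ \hline 0&V_0\end{array}\right]=\left[\begin{array}{c|c}I_{(m-1)n}&0\\ \hline 0&\mathcal S(\lambda)\end{array}\right]\quad\text{for all }\lambda\in\mathbb C.$$ (b) There exist biproper rational matrices $\mathcal O_\ell(\lambda)$ and $\mathcal O_r(\lambda)$ such that $$\mathcal O_\ell(\lambda)\,\lambda^{-1}\mathbb G(\lambda)\,\mathcal O_r(\lambda)=\left[\begin{array}{c|c}I_{(m-1)n}&0\\ \hline 0&\lambda^{-m}G(\lambda)\end{array}\right],$$ where $\mathbb G(\lambda)=L_\sigma(\lambda)+(e_{m-i_0(\sigma)}\otimes C)(\lambda E-A)^{-1}(e^T_{m-c_0(\sigma)}\otimes B)$ is the transfer function of $\mathbb L_\sigma(\lambda)$ and $L_\sigma(\lambda)=\lambda M^P_{-m}-M^P_\sigma$ is the Fiedler pencil of $P(\lambda)$ associated with $\sigma$.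
   Context: Setting: $P(\lambda)=\sum_{i=0}^m\lambda^iA_i$ with $A_i\in\mathbb C^{n\times n}$, $A_m\neq0$, $m\ge1$; $G(\lambda)=P(\lambda)+C(\lambda E-A)^{-1}B$ is a minimal realization ($r$ smallest possible) with $A,E\in\mathbb C^{r\times r}$, $E$ nonsingular, $C\in\mathbb C^{n\times r}$, $B\in\mathbb C^{r\times n}$; system matrix $\mathcal S(\lambda)=\left[\begin{array}{c|c}P(\lambda)&C\\ \hline B&A-\lambda E\end{array}\right]$. $e_j$ is the $j$-th column of $I_m$. Fiedler matrices: $M_0^P=\mathrm{diag}(I_{(m-1)n},-A_0)$, $M_{-m}^P=\mathrm{diag}(A_m,I_{(m-1)n})$, $M_i^P=\mathrm{diag}\big(I_{(m-i-1)n},\begin{bmatrix}-A_i&I_n\\ I_n&0\end{bmatrix},I_{(i-1)n}\big)$ for $1\le i\le m-1$. $\mathbb M_0^{\mathcal S}=\left[\begin{array}{c|c}M_0^P&-e_m\otimes C\\ \hline -e_m^T\otimes B&-A\end{array}\right]$, $\mathbb M_{-m}^{\mathcal S}=\mathrm{diag}(M_{-m}^P,-E)$, $\mathbb M_i^{\mathcal S}=\mathrm{diag}(M_i^P,I_r)$ for $1\le i\le m-1$. For $\sigma=(\sigma_1,\dots,\sigma_m)$ a permutation of $\{0,\dots,m-1\}$ written as a tuple, $M^P_\sigma=M^P_{\sigma_1}\cdots M^P_{\sigma_m}$ and $\mathbb M^{\mathcal S}_\sigma=\mathbb M^{\mathcal S}_{\sigma_1}\cdots\mathbb M^{\mathcal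 S}_{\sigma_m}$. $c_0(\sigma)$ is the integer $p\ge0$ such that $(0,1,\dots,p)$ is a subtuple of $\sigma$ (obtained by deleting entries) but $(0,1,\dots,p+1)$ is not; $i_0(\sigma)$ is the integer $s\ge0$ such that $(s,\dots,1,0)$ is a subtuple of $\sigma$ but $(s+1,s,\dots,0)$ is not. A matrix polynomial is unimodular if its determinant is a nonzero constant. A square rational matrix $F(\lambda)$ is biproper if $\lim_{\lambda\to\infty}F(\lambda)=F(\infty)$ exists and is nonsingular. Rosenbrock strong linearization: an $(mn+r)\times(mn+r)$ pencil $\mathbb L(\lambda)=\left[\begin{array}{c|c}\mathcal X-\lambda\mathcal Y&\mathcal C\\ \hline\mathcal B&H-\lambda K\end{array}\right]$, with $H-\lambda K$ of size $r\times r$, $K$ nonsingular, and irreducible (i.e. $[\mathcal B\ \ H-\lambda K]$ and $\begin{bmatrix}\mathcal C\\ H-\lambda K\end{bmatrix}$ have rank $r$ for all $\lambda\in\mathbb C$), is a Rosenbrock strong linearization of $G(\lambda)$ if (i) $\mathrm{diag}(U(\lambda),U_0)\,\mathbb L(\lambda)\,\mathrm{diag}(V(\lambda),V_0)=\mathrm{diag}(I_{(m-1)n},\mathcal S(\lambda))$ for some $mn\times mn$ unimodular $U,V$ and nonsingular $U_0,V_0\in\mathbb C^{r\times r}$; and (ii) $\mathcal O_\ell(\lambda)\,\lambda^{-1}\mathbb G(\lambda)\,\mathcal O_r(\lambda)=\mathrm{diag}(I_{(m-1)n},\lambda^{-m}G(\lambda))$ for some $mn\times mn$ biproper $\mathcal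 O_\ell,\mathcal O_r$, where $\mathbb G(\lambda)=\mathcal X-\lambda\mathcal Y+\mathcal C(\lambda K-H)^{-1}\mathcal B$ is the transfer function of $\mathbb L(\lambda)$. *)

theory Defs
  imports
    "Jordan_Normal_Form.Gauss_Jordan_Elimination"
    "Jordan_Normal_Form.Determinant"
    "Jordan_Normal_Form.DL_Rank"
    "HOL-Computational_Algebra.Polynomial_Factorial"
    "HOL-Library.Sublist"
begin

text \<open>Matrix polynomials are matrices over \<open>complex poly\<close>, rational matrices are matrices over
  its fraction field \<open>complex poly fract\<close>; \<open>lam\<close> is the indeterminate.\<close>

type_synonym poly_mat = "complex poly mat"
type_synonym rat_mat = "complex poly fract mat"

abbreviation lam :: "complex poly" where
  "lam \<equiv> [:0, 1:]"

definition const_mat :: "complex mat \<Rightarrow> poly_mat" where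
  "const_mat M = map_mat (\<lambda>a. [:a:]) M"

definition poly_mat_at :: "poly_mat \<Rightarrow> complex \<Rightarrow> complex mat" where
  "poly_mat_at M z = map_mat (\<lambda>p. poly p z) M"

definition to_rat_mat :: "poly_mat \<Rightarrow> rat_mat" where
  "to_rat_mat M = map_mat to_fract M"

definition unimodular :: "nat \<Rightarrow> poly_mat \<Rightarrow> bool" where
  "unimodular k U \<longleftrightarrow> U \<in> carrier_mat k k \<and> (\<exists>c. c \<noteq> 0 \<and> det U = [:c:])"

text \<open>The limit of a rational function at infinity does not depend on the representing fraction,
  since two representations agree outside a finite set.\<close>

definition has_limit_at_infinity :: "complex poly fract \<Rightarrow> complex \<Rightarrow> bool" where
  "has_limit_at_infinity f l \<longleftrightarrow>
    (\<exists>p q. q \<noteq> 0 \<and> f = Fract p q \<and> ((\<lambda>z. poly p z / poly q z) \<longlongrightarrow> l) at_infinity)"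

definition biproper :: "nat \<Rightarrow> rat_mat \<Rightarrow> bool" where
  "biproper k F \<longleftrightarrow> F \<in> carrier_mat k k \<and>
    (\<exists>F0 \<in> carrier_mat k k. invertible_mat F0 \<and>
      (\<forall>i<k. \<forall>j<k. has_limit_at_infinity (F $$ (i, j)) (F0 $$ (i, j))))"

text \<open>\<open>As i\<close> is the coefficient of the \<open>i\<close>-th power of the indeterminate in \<open>P\<close>.\<close>

definition matrix_polynomial :: "nat \<Rightarrow> nat \<Rightarrow> (nat \<Rightarrow> complex mat) \<Rightarrow> poly_mat" where
  "matrix_polynomial n m As = mat n n (\<lambda>(i, j). \<Sum>k\<le>m. monom (As k $$ (i, j)) k)"

text \<open>\<open>P(\<lambda>) + C (\<lambda> E - A)\<^sup>-\<^sup>1 B\<close>; when \<open>E\<close> is nonsingular,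
  \<open>\<lambda> E - A\<close> is invertible over the field of rational functions, so that \<open>mat_inverse\<close>
  (which returns an option) yields its inverse.\<close>

definition transfer ::
  "poly_mat \<Rightarrow> complex mat \<Rightarrow> complex mat \<Rightarrow> complex mat \<Rightarrow> complex mat \<Rightarrow> rat_mat" where
  "transfer P C E A B = to_rat_mat P
     + to_rat_mat (const_mat C)
       * the (mat_inverse (to_rat_mat (lam \<cdot>\<^sub>m const_mat E - const_mat A)))
       * to_rat_mat (const_mat B)"

definition realization ::
  "nat \<Rightarrow> nat \<Rightarrow> poly_mat \<Rightarrow> complex mat \<Rightarrow> complex mat \<Rightarrow> complex mat \<Rightarrow> complex mat
    \<Rightarrow> rat_mat \<Rightarrow> bool" where
  "realization n r P C E A B G \<longleftrightarrow>
     P \<in> carrier_mat n n \<and> C \<in> carrier_mat n r \<and> E \<in> carrier_mat r r \<and>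
     A \<in> carrier_mat r r \<and> B \<in> carrier_mat r n \<and> invertible_mat E \<and>
     G = transfer P C E A B"

text \<open>The state dimension may be zero: this is the minimal value when \<open>G\<close> is a matrix polynomial.\<close>

definition minimal_realization ::
  "nat \<Rightarrow> nat \<Rightarrow> poly_mat \<Rightarrow> complex mat \<Rightarrow> complex mat \<Rightarrow> complex mat \<Rightarrow> complex mat
    \<Rightarrow> rat_mat \<Rightarrow> bool" where
  "minimal_realization n r P C E A B G \<longleftrightarrow>
     realization n r P C E A B G \<and>
     (\<forall>r' P' C' E' A' B'. realization n r' P' C' E' A' B' G \<longrightarrow> r \<le> r')"

definition system_matrix ::
  "poly_mat \<Rightarrow> complex mat \<Rightarrow> complex mat \<Rightarrow> complex mat \<Rightarrow> complex mat \<Rightarrow> poly_mat" where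
  "system_matrix P C E A B =
     four_block_mat P (const_mat C) (const_mat B) (const_mat A - lam \<cdot>\<^sub>m const_mat E)"

text \<open>Transfer function of a polynomial matrix partitioned with a leading \<open>p \<times> p\<close> block;
  for \<open>L\<^sub>2\<^sub>2 = H - \<lambda> K\<close> one has \<open>- L\<^sub>2\<^sub>2 = \<lambda> K - H\<close>.\<close>

definition pencil_transfer :: "nat \<Rightarrow> poly_mat \<Rightarrow> rat_mat" where
  "pencil_transfer p L = (case split_block L p p of (L\<^sub>1\<^sub>1, L\<^sub>1\<^sub>2, L\<^sub>2\<^sub>1, L\<^sub>2\<^sub>2) \<Rightarrow>
     to_rat_mat L\<^sub>1\<^sub>1
       + to_rat_mat L\<^sub>1\<^sub>2 * the (mat_inverse (to_rat_mat (- L\<^sub>2\<^sub>2))) * to_rat_mat L\<^sub>2\<^sub>1)"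

text \<open>\<open>[B H - \<lambda> K]\<close> is written as a block matrix with an empty second block row.
  The first argument of \<open>vec_space.rank\<close> is the number of rows.\<close>

definition irreducible_pencil ::
  "nat \<Rightarrow> nat \<Rightarrow> complex mat \<Rightarrow> complex mat \<Rightarrow> complex mat \<Rightarrow> complex mat \<Rightarrow> bool" where
  "irreducible_pencil p r C B H K \<longleftrightarrow>
     (\<forall>z. vec_space.rank r (four_block_mat B (H - z \<cdot>\<^sub>m K) (0\<^sub>m 0 p) (0\<^sub>m 0 r)) = r \<and>
          vec_space.rank (p + r) (C @\<^sub>r (H - z \<cdot>\<^sub>m K)) = r)"

definition rosenbrock_strong_linearization ::
  "nat \<Rightarrow> nat \<Rightarrow> nat \<Rightarrow> (nat \<Rightarrow> complex mat) \<Rightarrow> complex mat \<Rightarrow> complex mat \<Rightarrow> complex mat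
    \<Rightarrow> complex mat \<Rightarrow> poly_mat \<Rightarrow> bool" where
  "rosenbrock_strong_linearization n m r As C E A B L \<longleftrightarrow>
     (\<exists>X Y CC BB H K.
        X \<in> carrier_mat (m * n) (m * n) \<and> Y \<in> carrier_mat (m * n) (m * n) \<and>
        CC \<in> carrier_mat (m * n) r \<and> BB \<in> carrier_mat r (m * n) \<and>
        H \<in> carrier_mat r r \<and> K \<in> carrier_mat r r \<and>
        L = four_block_mat (const_mat X - lam \<cdot>\<^sub>m const_mat Y) (const_mat CC)
              (const_mat BB) (const_mat H - lam \<cdot>\<^sub>m const_mat K) \<and>
        invertible_mat K \<and> irreducible_pencil (m * n) r CC BB H K) \<and>
     (\<exists>U V U\<^sub>0 V\<^sub>0.
        unimodular (m * n) U \<and> unimodular (m * n) V \<and>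
        U\<^sub>0 \<in> carrier_mat r r \<and> invertible_mat U\<^sub>0 \<and>
        V\<^sub>0 \<in> carrier_mat r r \<and> invertible_mat V\<^sub>0 \<and>
        diag_block_mat [U, const_mat U\<^sub>0] * L * diag_block_mat [V, const_mat V\<^sub>0]
          = diag_block_mat [1\<^sub>m ((m - 1) * n), system_matrix (matrix_polynomial n m As) C E A B]) \<and>
     (\<exists>Ol Or.
        biproper (m * n) Ol \<and> biproper (m * n) Or \<and>
        Ol * (inverse (to_fract lam) \<cdot>\<^sub>m pencil_transfer (m * n) L) * Or
          = diag_block_mat [1\<^sub>m ((m - 1) * n),
              inverse (to_fract lam ^ m) \<cdot>\<^sub>m transfer (matrix_polynomial n m As) C E A B])"

definition kronecker :: "'a::semiring_0 mat \<Rightarrow> 'a mat \<Rightarrow> 'a mat" (infixl \<open>\<otimes>\<^sub>k\<close> 70) where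
  "M \<otimes>\<^sub>k N = mat (dim_row M * dim_row N) (dim_col M * dim_col N)
     (\<lambda>(i, j). M $$ (i div dim_row N, j div dim_col N) * N $$ (i mod dim_row N, j mod dim_col N))"

text \<open>The \<open>j\<close>-th column of the identity matrix, counted from 1, as an \<open>m \<times> 1\<close> matrix.\<close>

definition e_col :: "nat \<Rightarrow> nat \<Rightarrow> complex mat" where
  "e_col m j = mat_of_cols m [unit_vec m (j - 1)]"

text \<open>Fiedler matrices. The index \<open>- m\<close> is treated separately, so that the remaining
  indices are natural numbers.\<close>

definition fiedler :: "nat \<Rightarrow> nat \<Rightarrow> (nat \<Rightarrow> complex mat) \<Rightarrow> nat \<Rightarrow> complex mat" where
  "fiedler n m As i =
     (if i = 0 then diag_block_mat [1\<^sub>m ((m - 1) * n), - As 0]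
      else diag_block_mat
        [1\<^sub>m ((m - i - 1) * n), four_block_mat (- As i) (1\<^sub>m n) (1\<^sub>m n) (0\<^sub>m n n), 1\<^sub>m ((i - 1) * n)])"

definition fiedler_neg :: "nat \<Rightarrow> nat \<Rightarrow> (nat \<Rightarrow> complex mat) \<Rightarrow> complex mat" where
  "fiedler_neg n m As = diag_block_mat [As m, 1\<^sub>m ((m - 1) * n)]"

definition sys_fiedler ::
  "nat \<Rightarrow> nat \<Rightarrow> nat \<Rightarrow> (nat \<Rightarrow> complex mat) \<Rightarrow> complex mat \<Rightarrow> complex mat \<Rightarrow> complex mat
    \<Rightarrow> nat \<Rightarrow> complex mat" where
  "sys_fiedler n m r As C A B i =
     (if i = 0
      then four_block_mat (fiedler n m As 0) (- (e_col m m \<otimes>\<^sub>k C))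
             (- (transpose_mat (e_col m m) \<otimes>\<^sub>k B)) (- A)
      else diag_block_mat [fiedler n m As i, 1\<^sub>m r])"

definition sys_fiedler_neg ::
  "nat \<Rightarrow> nat \<Rightarrow> (nat \<Rightarrow> complex mat) \<Rightarrow> complex mat \<Rightarrow> complex mat" where
  "sys_fiedler_neg n m As E = diag_block_mat [fiedler_neg n m As, - E]"

text \<open>\<open>mat_list_prod k F [i\<^sub>1, \<dots>, i\<^sub>s]\<close> is the product \<open>F i\<^sub>1 \<cdots> F i\<^sub>s\<close> of \<open>k \<times> k\<close> matrices.\<close>

definition mat_list_prod :: "nat \<Rightarrow> (nat \<Rightarrow> complex mat) \<Rightarrow> nat list \<Rightarrow> complex mat" where
  "mat_list_prod k F \<sigma> = foldr (\<lambda>i M. F i * M) \<sigma> (1\<^sub>m k)"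

definition fiedler_pencil :: "nat \<Rightarrow> nat \<Rightarrow> (nat \<Rightarrow> complex mat) \<Rightarrow> nat list \<Rightarrow> poly_mat" where
  "fiedler_pencil n m As \<sigma> =
     lam \<cdot>\<^sub>m const_mat (fiedler_neg n m As)
       - const_mat (mat_list_prod (m * n) (fiedler n m As) \<sigma>)"

definition sys_fiedler_pencil ::
  "nat \<Rightarrow> nat \<Rightarrow> nat \<Rightarrow> (nat \<Rightarrow> complex mat) \<Rightarrow> complex mat \<Rightarrow> complex mat \<Rightarrow> complex mat
    \<Rightarrow> complex mat \<Rightarrow> nat list \<Rightarrow> poly_mat" where
  "sys_fiedler_pencil n m r As C E A B \<sigma> =
     lam \<cdot>\<^sub>m const_mat (sys_fiedler_neg n m As E)
       - const_mat (mat_list_prod (m * n + r) (sys_fiedler n m r As C A B) \<sigma>)"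

text \<open>For a permutation \<open>\<sigma>\<close> of \<open>{0, \<dots>, m - 1}\<close> with \<open>m \<ge> 1\<close> the numbers below exist and
  are unique; subtuples are \<open>subseq\<close> (entries need not be adjacent).\<close>

definition c0 :: "nat list \<Rightarrow> nat" where
  "c0 \<sigma> = (THE p. subseq [0..<p + 1] \<sigma> \<and> \<not> subseq [0..<p + 2] \<sigma>)"

definition i0 :: "nat list \<Rightarrow> nat" where
  "i0 \<sigma> = (THE s. subseq (rev [0..<s + 1]) \<sigma> \<and> \<not> subseq (rev [0..<s + 2]) \<sigma>)"

end

theory Submission
  imports Defs "Jordan_Normal_Form.Schur_Decomposition"
begin

text \<open>A Fiedler pencil is a product of matrices each of which differs from an identity matrix in one
  diagonal block or in two adjacent ones. Hence it can be reduced one index at a time,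
  and removing an index is an explicit equivalence. This works over any
  commutative ring; the last diagonal block of the factor with index 0 is an arbitrary matrix \<open>S\<close>.

  Part (a). The system pencil is \<open>\<lambda> (A\<^sub>m \<oplus> I \<oplus> 0)\<close> minus the product of the factors, where
  \<open>S\<close> has the blocks \<open>-A\<^sub>0\<close>, \<open>-C\<close>, \<open>-B\<close> and \<open>\<lambda> E - A\<close>, so that \<open>S\<close> absorbs the state pencil.
  The largest index \<open>m - 1\<close> can be removed (\<open>peel_top\<close>): the
  pencil is equivalent to the sum of an identity block and the pencil without that index, in which the
  leading coefficient is \<open>\<lambda> A\<^sub>m + A\<close> with \<open>A\<close> the coefficient of index \<open>m - 1\<close>. This is Horner's scheme, and what remains at
  the end (\<open>pencil_equivalent\<close>) is the system matrix. The transformations do not touch the last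
  \<open>r\<close> coordinates, so the two state transformations can be taken to be identities.

  Part (b). The factors on the left of index 0 carry the last block column to block \<open>m - i\<^sub>0\<close>, those on
  its right carry the last block row to block \<open>m - c\<^sub>0\<close>. This gives the off-diagonal blocks of the
  system pencil (\<open>fiedler_product_system\<close>), and it shows that adding a matrix to \<open>S\<close>
  changes the product in the block \<open>(m - i\<^sub>0, m - c\<^sub>0)\<close> only (\<open>fiedler_product_update\<close>). Therefore the
  transfer function of the system pencil is itself a Fiedler pencil, over the field of rational
  functions, with \<open>A\<^sub>0\<close> replaced by \<open>A\<^sub>0 + R\<close> for \<open>R = C (\<lambda> E - A)\<^sup>-\<^sup>1 B\<close>. After division by
  \<open>\<lambda>\<close> all its entries are proper. Now index 0 can be removed (\<open>peel_bottom\<close>): the last diagonal block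
  is an identity, and its Schur complement is the pencil without index 0, in which \<open>A\<^sub>1\<close> has absorbed
  \<open>\<lambda>\<^sup>-\<^sup>1\<close> times the coefficient of index 0. What remains at the end (\<open>rev_pencil_equivalent\<close>) is \<open>\<lambda>\<^sup>-\<^sup>m G(\<lambda>)\<close>. The transformations
  are invertible over the ring of proper rational functions, which makes them biproper.

  Irreducibility. A left null vector of \<open>[B  A - z E]\<close> is an uncontrollable mode, and removing it yields a
  realization of dimension \<open>r - 1\<close> (\<open>left_null_reduces\<close>). Minimality excludes this, and by
  transposition it excludes right null vectors of the pencil bordered by \<open>C\<close> as well.\<close>

section \<open>Matrix identities and direct sums\<close>

text \<open>Carrier premises mention dimensions that do not occur in the conclusion and that rewriting
  cannot guess. With equations between dimensions as premises, the ring laws become rewrite rules.\<close>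

lemma mat_assoc_dim: "dim_col A = dim_row B \<Longrightarrow> dim_col B = dim_row C \<Longrightarrow> (A * B) * C = A * (B * C)"
  for A B C :: "'a::semiring_0 mat"
  by (rule assoc_mult_mat[of A "dim_row A" "dim_row B" B "dim_col B" C "dim_col C"]) auto

lemma mat_add_left_dim: "dim_row A = dim_row B \<Longrightarrow> dim_col A = dim_col B \<Longrightarrow> dim_col B = dim_row C \<Longrightarrow>
    (A + B) * C = A * C + B * C" for A B C :: "'a::semiring_0 mat"
  by (rule add_mult_distrib_mat[of A "dim_row A" "dim_row C" B C "dim_col C"]) auto

lemma mat_add_right_dim: "dim_row B = dim_row C \<Longrightarrow> dim_col B = dim_col C \<Longrightarrow> dim_col A = dim_row B \<Longrightarrow>
    A * (B + C) = A * B + A * C" for A B C :: "'a::semiring_0 mat"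
  by (rule mult_add_distrib_mat[of A "dim_row A" "dim_row B" B "dim_col B" C]) auto

lemma mat_minus_left_dim: "dim_row A = dim_row B \<Longrightarrow> dim_col A = dim_col B \<Longrightarrow> dim_col B = dim_row C \<Longrightarrow>
    (A - B) * C = A * C - B * C" for A B C :: "'a::ring mat"
  by (rule minus_mult_distrib_mat[of A "dim_row A" "dim_row C" B C "dim_col C"]) auto

lemma mat_minus_right_dim: "dim_row B = dim_row C \<Longrightarrow> dim_col B = dim_col C \<Longrightarrow> dim_col A = dim_row B \<Longrightarrow>
    A * (B - C) = A * B - A * C" for A B C :: "'a::ring mat"
  by (rule mult_minus_distrib_mat[of A "dim_row A" "dim_row B" B "dim_col B" C]) auto

lemma mat_smult_left_dim: "dim_col A = dim_row B \<Longrightarrow> (c \<cdot>\<^sub>m A) * B = c \<cdot>\<^sub>m (A * B)"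
  for A B :: "'a::comm_ring_1 mat"
  by (rule mult_smult_assoc_mat[of A "dim_row A" "dim_row B" B "dim_col B"]) auto

lemma mat_smult_right_dim: "dim_col A = dim_row B \<Longrightarrow> A * (c \<cdot>\<^sub>m B) = c \<cdot>\<^sub>m (A * B)"
  for A B :: "'a::comm_ring_1 mat"
  by (rule mult_smult_distrib[of A "dim_row A" "dim_row B" B "dim_col B"]) auto

lemma mat_uminus_left_dim: "dim_col A = dim_row B \<Longrightarrow> (- A) * B = - (A * B)"
  for A B :: "'a::comm_ring_1 mat"
  by (rule uminus_mult_left_mat) auto

lemma mat_uminus_right_dim: "dim_col A = dim_row B \<Longrightarrow> A * (- B) = - (A * B)"
  for A B :: "'a::comm_ring_1 mat"
  by (rule uminus_mult_right_mat) auto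

lemma mat_one_left_dim: "dim_row A = n \<Longrightarrow> 1\<^sub>m n * A = A" for A :: "'a::semiring_1 mat"
  by (rule left_mult_one_mat[of A n "dim_col A"]) auto
lemma mat_one_right_dim: "dim_col A = n \<Longrightarrow> A * 1\<^sub>m n = A" for A :: "'a::semiring_1 mat"
  by (rule right_mult_one_mat[of A "dim_row A" n]) auto
lemma mat_zero_left_dim: "dim_row A = n \<Longrightarrow> 0\<^sub>m k n * A = 0\<^sub>m k (dim_col A)" for A :: "'a::semiring_0 mat"
  by (rule left_mult_zero_mat[of A n "dim_col A"]) auto
lemma mat_zero_right_dim: "dim_col A = n \<Longrightarrow> A * 0\<^sub>m n k = 0\<^sub>m (dim_row A) k" for A :: "'a::semiring_0 mat"
  by (rule right_mult_zero_mat[of A "dim_row A" n]) auto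

lemma mat_add_zero_dim: "dim_row A = n \<Longrightarrow> dim_col A = k \<Longrightarrow> A + 0\<^sub>m n k = A"
  "dim_row A = n \<Longrightarrow> dim_col A = k \<Longrightarrow> 0\<^sub>m n k + A = A" for A :: "'a::monoid_add mat"
  by (auto intro!: eq_matI)

lemmas mat_ring_simps = mat_assoc_dim mat_add_left_dim mat_add_right_dim mat_minus_left_dim
  mat_minus_right_dim mat_smult_left_dim mat_smult_right_dim mat_uminus_left_dim mat_uminus_right_dim
  mat_one_left_dim mat_one_right_dim mat_zero_left_dim mat_zero_right_dim mat_add_zero_dim

lemma four_block_mult_dim:
  "dim_row B1 = dim_row A1 \<Longrightarrow> dim_col C1 = dim_col A1 \<Longrightarrow> dim_row C1 = dim_row D1 \<Longrightarrow> dim_col B1 = dim_col D1 \<Longrightarrow>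
   dim_row A2 = dim_col A1 \<Longrightarrow> dim_row D2 = dim_col D1 \<Longrightarrow>
   dim_row B2 = dim_row A2 \<Longrightarrow> dim_col C2 = dim_col A2 \<Longrightarrow> dim_row C2 = dim_row D2 \<Longrightarrow> dim_col B2 = dim_col D2 \<Longrightarrow>
   four_block_mat A1 B1 C1 D1 * four_block_mat A2 B2 C2 D2
  = four_block_mat (A1 * A2 + B1 * C2) (A1 * B2 + B1 * D2)
    (C1 * A2 + D1 * C2) (C1 * B2 + D1 * D2 :: 'a::semiring_0 mat)"
  by (rule mult_four_block_mat[of _ "dim_row A1" "dim_col A1" _ "dim_col D1" _ "dim_row D1" _ _ "dim_col A2" _ "dim_col D2"])
     auto

text \<open>As a binary operation the direct sum can be regrouped by rewriting with associativity, which is how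
  blocks are split off at either end below.\<close>

definition dsum :: "'a::zero mat \<Rightarrow> 'a mat \<Rightarrow> 'a mat" (infixr "\<oplus>\<^sub>m" 66) where
  "A \<oplus>\<^sub>m B = four_block_mat A (0\<^sub>m (dim_row A) (dim_col B)) (0\<^sub>m (dim_row B) (dim_col A)) B"

lemma dsum_dim[simp]: "dim_row (A \<oplus>\<^sub>m B) = dim_row A + dim_row B" "dim_col (A \<oplus>\<^sub>m B) = dim_col A + dim_col B"
  by (simp_all add: dsum_def)

lemma dsum_carrier[simp]: "A \<in> carrier_mat a b \<Longrightarrow> B \<in> carrier_mat c d \<Longrightarrow> A \<oplus>\<^sub>m B \<in> carrier_mat (a + c) (b + d)"
  by (auto simp: dsum_def)

lemma dsum_assoc: "(A \<oplus>\<^sub>m B) \<oplus>\<^sub>m C = A \<oplus>\<^sub>m (B \<oplus>\<^sub>m C)"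
  using assoc_four_block_mat[of A B C] by (simp add: dsum_def)

lemma dsum_one: "1\<^sub>m a \<oplus>\<^sub>m 1\<^sub>m b = 1\<^sub>m (a + b)"
  by (simp add: dsum_def)

lemma dsum_mult: "dim_col A = dim_row A' \<Longrightarrow> dim_col B = dim_row B' \<Longrightarrow>
   (A \<oplus>\<^sub>m B) * (A' \<oplus>\<^sub>m B') = (A * A') \<oplus>\<^sub>m (B * B' :: 'a::semiring_0 mat)"
  by (simp add: dsum_def four_block_mult_dim mat_zero_left_dim mat_zero_right_dim mat_add_zero_dim)

lemma dsum_empty_left[simp]: "dim_row A = 0 \<Longrightarrow> dim_col A = 0 \<Longrightarrow> A \<oplus>\<^sub>m B = B"
  by (rule eq_matI) (auto simp: dsum_def)
lemma dsum_empty_right[simp]: "dim_row B = 0 \<Longrightarrow> dim_col B = 0 \<Longrightarrow> A \<oplus>\<^sub>m B = A"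
  by (rule eq_matI) (auto simp: dsum_def)

lemma dsum_index: "i < dim_row A + dim_row B \<Longrightarrow> j < dim_col A + dim_col B \<Longrightarrow>
  (A \<oplus>\<^sub>m B) $$ (i, j) = (if i < dim_row A then if j < dim_col A then A $$ (i,j) else 0
     else if j < dim_col A then 0 else B $$ (i - dim_row A, j - dim_col A))"
  by (auto simp: dsum_def)

lemma dsum_transpose: "(A \<oplus>\<^sub>m B)\<^sup>T = A\<^sup>T \<oplus>\<^sub>m B\<^sup>T"
  by (rule eq_matI) (auto simp: dsum_def)

lemma dsum_map: "h 0 = 0 \<Longrightarrow> map_mat h (A \<oplus>\<^sub>m B) = map_mat h A \<oplus>\<^sub>m map_mat h B"
  by (rule eq_matI) (auto simp: dsum_def)

lemma diag_block_mat_dsum: "diag_block_mat [A] = A" "diag_block_mat (A # B # Bs) = A \<oplus>\<^sub>m diag_block_mat (B # Bs)"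
proof -
  show "diag_block_mat [A] = A" by (rule eq_matI) (auto simp: Let_def)
qed (simp add: dsum_def Let_def)

section \<open>Fiedler matrices over a ring\<close>

text \<open>The product is needed over the complex numbers, over polynomials and over rational functions,
  hence this polymorphic copy of \<^const>\<open>mat_list_prod\<close>.\<close>

definition mprod :: "nat \<Rightarrow> (nat \<Rightarrow> 'a::semiring_1 mat) \<Rightarrow> nat list \<Rightarrow> 'a mat" where
  "mprod k F \<sigma> = foldr (\<lambda>i M. F i * M) \<sigma> (1\<^sub>m k)"

lemma mprod_simps[simp]: "mprod k F [] = 1\<^sub>m k" "mprod k F (i # \<sigma>) = F i * mprod k F \<sigma>"
  by (simp_all add: mprod_def)

lemma mat_list_prod_mprod: "mat_list_prod k F \<sigma> = mprod k F \<sigma>"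
  by (simp add: mat_list_prod_def mprod_def)

lemma mprod_carrier: "(\<And>i. i \<in> set \<sigma> \<Longrightarrow> F i \<in> carrier_mat k k) \<Longrightarrow> mprod k F \<sigma> \<in> carrier_mat k k"
  by (induction \<sigma>) (auto intro: mult_carrier_mat)

lemma mprod_append: "(\<And>i. i \<in> set (\<sigma> @ \<tau>) \<Longrightarrow> F i \<in> carrier_mat k k) \<Longrightarrow>
   mprod k F (\<sigma> @ \<tau>) = mprod k F \<sigma> * mprod k F \<tau>"
proof (induction \<sigma>)
  case Nil
  then show ?case using mprod_carrier[of \<tau> F k] by simp
next
  case (Cons i \<sigma>)
  have c: "F i \<in> carrier_mat k k" "mprod k F \<sigma> \<in> carrier_mat k k" "mprod k F \<tau> \<in> carrier_mat k k"
    using Cons.prems by (auto intro!: mprod_carrier)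
  have "mprod k F (\<sigma> @ \<tau>) = mprod k F \<sigma> * mprod k F \<tau>" using Cons by auto
  then show ?case using c by (simp add: assoc_mult_mat[of _ k k])
qed

lemma mprod_cong: "(\<And>i. i \<in> set \<sigma> \<Longrightarrow> F i = F' i) \<Longrightarrow> mprod k F \<sigma> = mprod k F' \<sigma>"
  by (induction \<sigma>) auto

lemma mprod_dsum_left: "(\<And>i. i \<in> set \<sigma> \<Longrightarrow> F i \<in> carrier_mat k k) \<Longrightarrow>
  mprod (a + k) (\<lambda>i. 1\<^sub>m a \<oplus>\<^sub>m F i) \<sigma> = 1\<^sub>m a \<oplus>\<^sub>m mprod k F \<sigma>"
proof (induction \<sigma>)
  case (Cons i \<sigma>)
  have c: "F i \<in> carrier_mat k k" "mprod k F \<sigma> \<in> carrier_mat k k"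
    using Cons.prems by (auto intro!: mprod_carrier)
  show ?case using Cons by (simp add: dsum_mult c[THEN carrier_matD(1)] c[THEN carrier_matD(2)] mat_one_left_dim)
qed (simp add: dsum_one)

lemma mprod_dsum_right: "(\<And>i. i \<in> set \<sigma> \<Longrightarrow> F i \<in> carrier_mat k k) \<Longrightarrow>
  mprod (k + a) (\<lambda>i. F i \<oplus>\<^sub>m 1\<^sub>m a) \<sigma> = mprod k F \<sigma> \<oplus>\<^sub>m 1\<^sub>m a"
proof (induction \<sigma>)
  case (Cons i \<sigma>)
  have c: "F i \<in> carrier_mat k k" "mprod k F \<sigma> \<in> carrier_mat k k"
    using Cons.prems by (auto intro!: mprod_carrier)
  show ?case using Cons by (simp add: dsum_mult c[THEN carrier_matD(1)] c[THEN carrier_matD(2)] mat_one_left_dim)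
qed (simp add: dsum_one)

lemma mprod_transpose:
  fixes F :: "nat \<Rightarrow> 'a::comm_semiring_1 mat"
  shows "(\<And>i. i \<in> set \<sigma> \<Longrightarrow> F i \<in> carrier_mat k k) \<Longrightarrow>
  (mprod k F \<sigma>)\<^sup>T = mprod k (\<lambda>i. (F i)\<^sup>T) (rev \<sigma>)"
proof (induction \<sigma>)
  case (Cons i \<sigma>)
  have "F i \<in> carrier_mat k k" "mprod k F \<sigma> \<in> carrier_mat k k"
    using Cons.prems by (auto intro!: mprod_carrier)
  then have "(F i * mprod k F \<sigma>)\<^sup>T = (mprod k F \<sigma>)\<^sup>T * (F i)\<^sup>T" by (rule transpose_mult)
  also have "\<dots> = mprod k (\<lambda>i. (F i)\<^sup>T) (rev \<sigma>) * mprod k (\<lambda>i. (F i)\<^sup>T) [i]"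
    using Cons \<open>F i \<in> carrier_mat k k\<close> by (simp add: right_mult_one_mat[of "(F i)\<^sup>T" k k])
  also have "\<dots> = mprod k (\<lambda>i. (F i)\<^sup>T) (rev \<sigma> @ [i])"
    using Cons.prems by (intro mprod_append[symmetric]) auto
  finally show ?case by simp
qed (simp)

lemma (in semiring_hom) mprod_hom:
  "(\<And>i. i \<in> set \<sigma> \<Longrightarrow> F i \<in> carrier_mat k k) \<Longrightarrow>
  map_mat hom (mprod k F \<sigma>) = mprod k (\<lambda>i. map_mat hom (F i)) \<sigma>"
proof (induction \<sigma>)
  case (Cons i \<sigma>)
  have "F i \<in> carrier_mat k k" "mprod k F \<sigma> \<in> carrier_mat k k"
    using Cons.prems by (auto intro!: mprod_carrier)
  then show ?case using Cons by (simp add: mat_hom_mult[of _ k k])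
qed (simp add: mat_hom_one)

definition companion_block :: "'a::ring_1 mat \<Rightarrow> 'a mat" where
  "companion_block A = four_block_mat (- A) (1\<^sub>m (dim_row A)) (1\<^sub>m (dim_row A)) (0\<^sub>m (dim_row A) (dim_row A))"

text \<open>The Fiedler matrices over any ring, generalized in one respect: the last diagonal
  block of the matrix with index 0 is an arbitrary \<open>S\<close> of size \<open>n + r\<close>. For \<open>r = 0\<close> and \<open>S = -A\<^sub>0\<close>
  these are the matrices of the polynomial, and for \<open>S\<close> with the blocks \<open>-A\<^sub>0\<close>, \<open>-C\<close>, \<open>-B\<close>, \<open>-A\<close> those of the
  realization.\<close>

definition fiedler_mat :: "nat \<Rightarrow> nat \<Rightarrow> nat \<Rightarrow> 'a::ring_1 mat \<Rightarrow> (nat \<Rightarrow> 'a mat) \<Rightarrow> nat \<Rightarrow> 'a mat" where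
  "fiedler_mat n r m S As i = (if i = 0 then 1\<^sub>m ((m - 1) * n) \<oplus>\<^sub>m S
     else 1\<^sub>m ((m - i - 1) * n) \<oplus>\<^sub>m companion_block (As i) \<oplus>\<^sub>m 1\<^sub>m ((i - 1) * n + r))"

lemma companion_block_carrier[simp]: "A \<in> carrier_mat n n \<Longrightarrow> companion_block A \<in> carrier_mat (n + n) (n + n)"
  by (auto simp: companion_block_def)

lemma mult_block_split:
  fixes i m n :: nat assumes "0 < i" "i < m" shows "m * n = (m - i - 1) * n + (n + n) + (i - 1) * n"
proof -
  obtain a b where "i = Suc b" "m = a + 2 + b" using assms by (metis add_2_eq_Suc' add_Suc add_Suc_right gr0_implies_Suc less_iff_Suc_add add.commute)
  then show ?thesis by (simp add: algebra_simps)
qed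

lemma fiedler_mat_carrier:
  assumes "S \<in> carrier_mat (n + r) (n + r)" "i < m" "0 < i \<Longrightarrow> As i \<in> carrier_mat n n"
  shows "fiedler_mat n r m S As i \<in> carrier_mat (m * n + r) (m * n + r)"
proof (cases "i = 0")
  case True
  have "m * n = (m - 1) * n + n" using assms(2) by (cases m) auto
  then show ?thesis using True assms by (auto simp: fiedler_mat_def)
next
  case False
  then have d: "m * n + r = (m - i - 1) * n + ((n + n) + ((i - 1) * n + r))"
    using mult_block_split[of i m n] assms by simp
  show ?thesis unfolding d using False assms by (auto simp: fiedler_mat_def simp del: One_nat_def intro!: dsum_carrier)
qed

text \<open>Only the largest index touches the first block, so below it the matrices are those of the next
  smaller size.\<close>

lemma fiedler_mat_peel_top:
  assumes "i < m"
  shows "fiedler_mat n r (Suc m) S As i = 1\<^sub>m n \<oplus>\<^sub>m fiedler_mat n r m S As i"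
proof -
  have "(Suc m - i - 1) * n = n + (m - i - 1) * n" "(Suc m - 1) * n = n + (m - 1) * n"
    using assms by (cases "m - i"; cases m; simp add: Suc_diff_le)+
  then show ?thesis unfolding fiedler_mat_def by (auto simp: dsum_assoc dsum_one[symmetric])
qed

text \<open>Only the indices 0 and 1 touch the last block. The other ones are, after lowering index and
  coefficients by one, of the next smaller size; the matrix \<open>S'\<close> is free because it enters at index 0 only.\<close>

lemma fiedler_mat_peel_bottom:
  assumes "0 < i" "i < m" "S' \<in> carrier_mat n n"
  shows "fiedler_mat n 0 (Suc m) S As (Suc i) = fiedler_mat n 0 m S' (\<lambda>j. As (Suc j)) i \<oplus>\<^sub>m 1\<^sub>m n"
proof -
  have "(Suc i - 1) * n = (i - 1) * n + n"
    using assms by (cases i) auto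
  then show ?thesis using assms unfolding fiedler_mat_def by (auto simp: dsum_assoc dsum_one)
qed

lemma fiedler_mat_system: "0 < i \<Longrightarrow> fiedler_mat n r m S As i = fiedler_mat n 0 m S' As i \<oplus>\<^sub>m 1\<^sub>m r"
  by (simp add: fiedler_mat_def dsum_assoc dsum_one)

lemma fiedler_mat_transpose:
  assumes "0 < i \<Longrightarrow> As i \<in> carrier_mat n n"
  shows "(fiedler_mat n r m S As i)\<^sup>T = fiedler_mat n r m S\<^sup>T (\<lambda>i. (As i)\<^sup>T) i"
proof -
  have "(companion_block (As i))\<^sup>T = companion_block (As i)\<^sup>T" if "i > 0"
    using assms[OF that] by (intro eq_matI) (auto simp: companion_block_def)
  then show ?thesis by (auto simp: fiedler_mat_def dsum_transpose)
qed

lemma (in ring_hom) fiedler_mat_hom: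
  assumes "0 < i \<Longrightarrow> As i \<in> carrier_mat n n"
  shows "map_mat hom (fiedler_mat n r m S As i) = fiedler_mat n r m (map_mat hom S) (\<lambda>i. map_mat hom (As i)) i"
proof -
  have "map_mat hom (companion_block (As i)) = companion_block (map_mat hom (As i))" if "i > 0"
    using assms[OF that] by (intro eq_matI) (auto simp: companion_block_def hom_distribs)
  then show ?thesis by (auto simp: fiedler_mat_def dsum_map mat_hom_one)
qed

section \<open>Equivalence over a subring\<close>

definition entries_in :: "'a set \<Rightarrow> 'a mat \<Rightarrow> bool" where
  "entries_in R M \<longleftrightarrow> (\<forall>i<dim_row M. \<forall>j<dim_col M. M $$ (i,j) \<in> R)"

text \<open>A subring of the ground ring, over which transformations have to be invertible:
  everything for part (a), the proper rational functions for part (b).\<close>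

locale coeff_ring =
  fixes R :: "'a::comm_ring_1 set"
  assumes zero_in: "0 \<in> R" and one_in: "1 \<in> R"
    and add_in: "a \<in> R \<Longrightarrow> b \<in> R \<Longrightarrow> a + b \<in> R"
    and mult_in: "a \<in> R \<Longrightarrow> b \<in> R \<Longrightarrow> a * b \<in> R"
    and uminus_in: "a \<in> R \<Longrightarrow> - a \<in> R"
begin

lemma minus_in: "a \<in> R \<Longrightarrow> b \<in> R \<Longrightarrow> a - b \<in> R"
  using add_in[of a "- b"] uminus_in[of b] by simp

lemma sum_in: "(\<And>i. i \<in> I \<Longrightarrow> f i \<in> R) \<Longrightarrow> sum f I \<in> R"
  by (induction I rule: infinite_finite_induct) (auto intro: zero_in add_in)

lemma prod_in: "(\<And>i. i \<in> I \<Longrightarrow> f i \<in> R) \<Longrightarrow> prod f I \<in> R"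
  by (induction I rule: infinite_finite_induct) (auto intro: one_in mult_in)

lemma entries_four_block:
  "entries_in R A \<Longrightarrow> entries_in R B \<Longrightarrow> entries_in R C \<Longrightarrow> entries_in R D \<Longrightarrow>
   dim_row B = dim_row A \<Longrightarrow> dim_col B = dim_col D \<Longrightarrow> dim_row C = dim_row D \<Longrightarrow> dim_col C = dim_col A \<Longrightarrow>
   entries_in R (four_block_mat A B C D)"
  by (auto simp: entries_in_def)

lemma entries_simps:
  "entries_in R (0\<^sub>m a b)" "entries_in R (1\<^sub>m a)"
  "entries_in R A \<Longrightarrow> entries_in R (- A)"
  "c \<in> R \<Longrightarrow> entries_in R A \<Longrightarrow> entries_in R (c \<cdot>\<^sub>m A)"
  "entries_in R A \<Longrightarrow> entries_in R B \<Longrightarrow> dim_row A = dim_row B \<Longrightarrow> dim_col A = dim_col B \<Longrightarrow> entries_in R (A + B)"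
  "entries_in R A \<Longrightarrow> entries_in R B \<Longrightarrow> dim_row A = dim_row B \<Longrightarrow> dim_col A = dim_col B \<Longrightarrow> entries_in R (A - B)"
  "entries_in R A \<Longrightarrow> entries_in R A\<^sup>T"
  "entries_in R A \<Longrightarrow> entries_in R B \<Longrightarrow> entries_in R (A \<oplus>\<^sub>m B)"
  by (auto simp: entries_in_def dsum_index zero_in one_in uminus_in mult_in add_in minus_in)

lemma entries_mult: "entries_in R A \<Longrightarrow> entries_in R B \<Longrightarrow> dim_col A = dim_row B \<Longrightarrow> entries_in R (A * B)"
  by (auto simp: entries_in_def scalar_prod_def intro!: sum_in mult_in)

lemma entries_mprod: "(\<And>i. i \<in> set \<sigma> \<Longrightarrow> F i \<in> carrier_mat k k \<and> entries_in R (F i)) \<Longrightarrow> entries_in R (mprod k F \<sigma>)"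
proof (induction \<sigma>)
  case (Cons i \<sigma>)
  have c: "F i \<in> carrier_mat k k" "mprod k F \<sigma> \<in> carrier_mat k k"
    using Cons.prems by (auto intro: mprod_carrier)
  show ?case using Cons c[THEN carrier_matD(1)] c[THEN carrier_matD(2)] by (auto intro!: entries_mult)
qed (auto simp: entries_simps)

text \<open>For polynomials and \<open>R = UNIV\<close> these are the unimodular matrices; for the proper rational
  functions they are the biproper ones.\<close>

definition GL :: "nat \<Rightarrow> 'a mat set" where
  "GL k = {U \<in> carrier_mat k k. entries_in R U \<and>
     (\<exists>U'\<in>carrier_mat k k. entries_in R U' \<and> U * U' = 1\<^sub>m k \<and> U' * U = 1\<^sub>m k)}"

lemma GL_I: "U \<in> carrier_mat k k \<Longrightarrow> U' \<in> carrier_mat k k \<Longrightarrow> entries_in R U \<Longrightarrow> entries_in R U' \<Longrightarrow>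
   U * U' = 1\<^sub>m k \<Longrightarrow> U' * U = 1\<^sub>m k \<Longrightarrow> U \<in> GL k"
  by (auto simp: GL_def)

lemma GL_E: assumes "U \<in> GL k"
  obtains U' where "U' \<in> GL k" "U \<in> carrier_mat k k" "U' \<in> carrier_mat k k" "entries_in R U" "entries_in R U'"
   "U * U' = 1\<^sub>m k" "U' * U = 1\<^sub>m k"
  using assms by (auto simp: GL_def)

lemma GL_one: "1\<^sub>m k \<in> GL k"
  by (rule GL_I[of _ _ "1\<^sub>m k"]) (auto simp: entries_simps)

lemma GL_mult: assumes "U \<in> GL k" "V \<in> GL k" shows "U * V \<in> GL k"
proof -
  obtain U' where U: "U \<in> carrier_mat k k" "U' \<in> carrier_mat k k" "entries_in R U" "entries_in R U'"
   "U * U' = 1\<^sub>m k" "U' * U = 1\<^sub>m k" using GL_E[OF assms(1)] .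
  obtain V' where V: "V \<in> carrier_mat k k" "V' \<in> carrier_mat k k" "entries_in R V" "entries_in R V'"
   "V * V' = 1\<^sub>m k" "V' * V = 1\<^sub>m k" using GL_E[OF assms(2)] .
  have d: "dim_row U = k" "dim_col U = k" "dim_row U' = k" "dim_col U' = k"
    "dim_row V = k" "dim_col V = k" "dim_row V' = k" "dim_col V' = k" using U V by auto
  have "U * V * (V' * U') = U * ((V * V') * U')" by (simp add: d mat_assoc_dim)
  then have 1: "U * V * (V' * U') = 1\<^sub>m k" using U V by (simp add: mat_one_left_dim)
  have "V' * U' * (U * V) = V' * ((U' * U) * V)" by (simp add: d mat_assoc_dim)
  then have 2: "V' * U' * (U * V) = 1\<^sub>m k" using U V by (simp add: mat_one_left_dim)
  show ?thesis
    by (rule GL_I[of _ _ "V' * U'"]) (use U V 1 2 in \<open>auto intro!: entries_mult mult_carrier_mat\<close>)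
qed

lemma GL_transpose: assumes "U \<in> GL k" shows "U\<^sup>T \<in> GL k"
proof -
  obtain U' where U: "U \<in> carrier_mat k k" "U' \<in> carrier_mat k k" "entries_in R U" "entries_in R U'"
   "U * U' = 1\<^sub>m k" "U' * U = 1\<^sub>m k" using GL_E[OF assms] .
  then show ?thesis
    by (intro GL_I[of _ _ "U'\<^sup>T"]) (simp_all add: entries_simps flip: transpose_mult[of U k k U' k] transpose_mult[of U' k k U k])
qed

lemma GL_dsum: assumes "U \<in> GL k" "V \<in> GL l" shows "U \<oplus>\<^sub>m V \<in> GL (k + l)"
proof -
  obtain U' where U: "U \<in> carrier_mat k k" "U' \<in> carrier_mat k k" "entries_in R U" "entries_in R U'"
   "U * U' = 1\<^sub>m k" "U' * U = 1\<^sub>m k" using GL_E[OF assms(1)] .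
  obtain V' where V: "V \<in> carrier_mat l l" "V' \<in> carrier_mat l l" "entries_in R V" "entries_in R V'"
   "V * V' = 1\<^sub>m l" "V' * V = 1\<^sub>m l" using GL_E[OF assms(2)] .
  have d: "dim_row U = k" "dim_col U = k" "dim_row U' = k" "dim_col U' = k"
    "dim_row V = l" "dim_col V = l" "dim_row V' = l" "dim_col V' = l" using U V by auto
  show ?thesis
    by (rule GL_I[of _ _ "U' \<oplus>\<^sub>m V'"])
      (use U V in \<open>auto intro!: entries_simps simp: dsum_mult d dsum_one\<close>)
qed

lemma GL_upper: assumes "B \<in> carrier_mat a b" "entries_in R B"
  shows "four_block_mat (1\<^sub>m a) B (0\<^sub>m b a) (1\<^sub>m b) \<in> GL (a + b)"
  by (rule GL_I[of _ _ "four_block_mat (1\<^sub>m a) (- B) (0\<^sub>m b a) (1\<^sub>m b)"])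
     (use assms in \<open>auto simp: four_block_mult_dim mat_ring_simps intro!: entries_four_block entries_simps eq_matI\<close>)

lemma GL_lower: assumes "C \<in> carrier_mat b a" "entries_in R C"
  shows "four_block_mat (1\<^sub>m a) (0\<^sub>m a b) C (1\<^sub>m b) \<in> GL (a + b)"
  by (rule GL_I[of _ _ "four_block_mat (1\<^sub>m a) (0\<^sub>m a b) (- C) (1\<^sub>m b)"])
     (use assms in \<open>auto simp: four_block_mult_dim mat_ring_simps intro!: entries_four_block entries_simps eq_matI\<close>)

lemma GL_swap: "four_block_mat (0\<^sub>m q n) (1\<^sub>m q) (1\<^sub>m n) (0\<^sub>m n q) \<in> GL (q + n)"
  by (rule GL_I[of _ _ "four_block_mat (0\<^sub>m n q) (1\<^sub>m n) (1\<^sub>m q) (0\<^sub>m q n)"])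
     (auto simp: four_block_mult_dim mat_ring_simps add.commute intro!: entries_four_block entries_simps eq_matI)

lemma GL_companion: assumes "a \<in> carrier_mat n n" "entries_in R a"
  shows "four_block_mat a (- 1\<^sub>m n) (1\<^sub>m n) (0\<^sub>m n n) \<in> GL (n + n)"
  by (rule GL_I[of _ _ "four_block_mat (0\<^sub>m n n) (1\<^sub>m n) (- 1\<^sub>m n) a"])
     (use assms in \<open>auto simp: four_block_mult_dim mat_ring_simps intro!: entries_four_block entries_simps eq_matI\<close>)

text \<open>The transformations act as the identity on the last \<open>r\<close> coordinates, which are those of the
  state.\<close>

definition gl_equiv :: "nat \<Rightarrow> nat \<Rightarrow> 'a mat \<Rightarrow> 'a mat \<Rightarrow> bool" where
  "gl_equiv k r X Y \<longleftrightarrow> (\<exists>U\<in>GL k. \<exists>V\<in>GL k. X = (U \<oplus>\<^sub>m 1\<^sub>m r) * Y * (V \<oplus>\<^sub>m 1\<^sub>m r))"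

lemma GL_carrier: "U \<in> GL k \<Longrightarrow> U \<in> carrier_mat k k" by (auto simp: GL_def)
lemma GL_dim: "U \<in> GL k \<Longrightarrow> dim_row U = k" "U \<in> GL k \<Longrightarrow> dim_col U = k" by (auto simp: GL_def)

lemma gl_equiv_refl: "X \<in> carrier_mat (k + r) (k + r) \<Longrightarrow> gl_equiv k r X X"
  unfolding gl_equiv_def by (intro bexI[of _ "1\<^sub>m k"]) (auto simp: GL_one dsum_one)

lemma gl_equiv_trans:
  assumes "gl_equiv k r X Y" "gl_equiv k r Y Z" "Z \<in> carrier_mat (k + r) (k + r)"
  shows "gl_equiv k r X Z"
proof -
  obtain U V U2 V2 where *: "U \<in> GL k" "V \<in> GL k" "U2 \<in> GL k" "V2 \<in> GL k"
    "X = (U \<oplus>\<^sub>m 1\<^sub>m r) * Y * (V \<oplus>\<^sub>m 1\<^sub>m r)" "Y = (U2 \<oplus>\<^sub>m 1\<^sub>m r) * Z * (V2 \<oplus>\<^sub>m 1\<^sub>m r)"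
    using assms(1,2) unfolding gl_equiv_def by blast
  have d: "dim_row Z = k + r" "dim_col Z = k + r" using assms(3) by auto
  have "X = (U \<oplus>\<^sub>m 1\<^sub>m r) * (U2 \<oplus>\<^sub>m 1\<^sub>m r) * Z * ((V2 \<oplus>\<^sub>m 1\<^sub>m r) * (V \<oplus>\<^sub>m 1\<^sub>m r))"
    unfolding * by (simp add: mat_assoc_dim GL_dim[OF *(1)] GL_dim[OF *(2)] GL_dim[OF *(3)] GL_dim[OF *(4)] d)
  also have "\<dots> = (U * U2 \<oplus>\<^sub>m 1\<^sub>m r) * Z * (V2 * V \<oplus>\<^sub>m 1\<^sub>m r)"
    by (simp add: dsum_mult GL_dim[OF *(1)] GL_dim[OF *(2)] GL_dim[OF *(3)] GL_dim[OF *(4)])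
  finally show ?thesis unfolding gl_equiv_def using GL_mult *(1-4) by blast
qed

lemma gl_equiv_sym:
  assumes "gl_equiv k r X Y" "Y \<in> carrier_mat (k + r) (k + r)"
  shows "gl_equiv k r Y X"
proof -
  obtain U V where *: "U \<in> GL k" "V \<in> GL k" "X = (U \<oplus>\<^sub>m 1\<^sub>m r) * Y * (V \<oplus>\<^sub>m 1\<^sub>m r)"
    using assms(1) unfolding gl_equiv_def by blast
  obtain U' where U: "U' \<in> GL k" "U' * U = 1\<^sub>m k" using GL_E[OF *(1)] .
  obtain V' where V: "V' \<in> GL k" "V * V' = 1\<^sub>m k" using GL_E[OF *(2)] .
  note d = GL_dim[OF *(1)] GL_dim[OF *(2)] GL_dim[OF U(1)] GL_dim[OF V(1)]
  have dY: "dim_row Y = k + r" "dim_col Y = k + r" using assms(2) by auto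
  have "(U' \<oplus>\<^sub>m 1\<^sub>m r) * X * (V' \<oplus>\<^sub>m 1\<^sub>m r)
     = ((U' \<oplus>\<^sub>m 1\<^sub>m r) * (U \<oplus>\<^sub>m 1\<^sub>m r)) * Y * ((V \<oplus>\<^sub>m 1\<^sub>m r) * (V' \<oplus>\<^sub>m 1\<^sub>m r))"
    unfolding * by (simp add: mat_assoc_dim d dY)
  also have "\<dots> = Y"
    by (simp add: dsum_mult d U V dsum_one mat_one_left_dim mat_one_right_dim dY)
  finally show ?thesis unfolding gl_equiv_def using U V by metis
qed

lemma gl_equiv_transpose:
  assumes "gl_equiv k r X Y" "Y \<in> carrier_mat (k + r) (k + r)"
  shows "gl_equiv k r X\<^sup>T Y\<^sup>T"
proof -
  obtain U V where *: "U \<in> GL k" "V \<in> GL k" "X = (U \<oplus>\<^sub>m 1\<^sub>m r) * Y * (V \<oplus>\<^sub>m 1\<^sub>m r)"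
    using assms(1) unfolding gl_equiv_def by blast
  have c: "U \<oplus>\<^sub>m 1\<^sub>m r \<in> carrier_mat (k + r) (k + r)" "V \<oplus>\<^sub>m 1\<^sub>m r \<in> carrier_mat (k + r) (k + r)"
    using GL_carrier[OF *(1)] GL_carrier[OF *(2)] by auto
  have "X\<^sup>T = (V \<oplus>\<^sub>m 1\<^sub>m r)\<^sup>T * ((U \<oplus>\<^sub>m 1\<^sub>m r) * Y)\<^sup>T"
    unfolding * by (rule transpose_mult[OF mult_carrier_mat[OF c(1) assms(2)] c(2)])
  also have "\<dots> = (V\<^sup>T \<oplus>\<^sub>m 1\<^sub>m r) * (Y\<^sup>T * (U\<^sup>T \<oplus>\<^sub>m 1\<^sub>m r))"
    by (subst transpose_mult[OF c(1) assms(2)]) (simp add: dsum_transpose)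
  also have "\<dots> = (V\<^sup>T \<oplus>\<^sub>m 1\<^sub>m r) * Y\<^sup>T * (U\<^sup>T \<oplus>\<^sub>m 1\<^sub>m r)"
    using assms(2) by (simp add: mat_assoc_dim GL_dim[OF *(1)] GL_dim[OF *(2)])
  finally show ?thesis unfolding gl_equiv_def using GL_transpose *(1,2) by blast
qed

lemma gl_equiv_dsum_left:
  assumes "gl_equiv k r X Y" "Y \<in> carrier_mat (k + r) (k + r)"
  shows "gl_equiv (a + k) r (1\<^sub>m a \<oplus>\<^sub>m X) (1\<^sub>m a \<oplus>\<^sub>m Y)"
proof -
  obtain U V where *: "U \<in> GL k" "V \<in> GL k" "X = (U \<oplus>\<^sub>m 1\<^sub>m r) * Y * (V \<oplus>\<^sub>m 1\<^sub>m r)"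
    using assms(1) unfolding gl_equiv_def by blast
  have dY: "dim_row Y = k + r" "dim_col Y = k + r" using assms(2) by auto
  have "1\<^sub>m a \<oplus>\<^sub>m X = ((1\<^sub>m a \<oplus>\<^sub>m U) \<oplus>\<^sub>m 1\<^sub>m r) * (1\<^sub>m a \<oplus>\<^sub>m Y) * ((1\<^sub>m a \<oplus>\<^sub>m V) \<oplus>\<^sub>m 1\<^sub>m r)"
    unfolding * by (simp add: dsum_assoc dsum_mult dY GL_dim[OF *(1)] GL_dim[OF *(2)] mat_one_left_dim)
  then show ?thesis unfolding gl_equiv_def using GL_dsum[OF GL_one[of a]] *(1,2) by blast
qed

lemma gl_equiv_dsum_right:
  assumes "gl_equiv k 0 X Y" "Y \<in> carrier_mat k k"
  shows "gl_equiv (k + a) 0 (X \<oplus>\<^sub>m 1\<^sub>m a) (Y \<oplus>\<^sub>m 1\<^sub>m a)"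
proof -
  obtain U V where *: "U \<in> GL k" "V \<in> GL k" "X = U * Y * V"
    using assms(1) unfolding gl_equiv_def by auto
  have dY: "dim_row Y = k" "dim_col Y = k" using assms(2) by auto
  have "X \<oplus>\<^sub>m 1\<^sub>m a = (U \<oplus>\<^sub>m 1\<^sub>m a) * (Y \<oplus>\<^sub>m 1\<^sub>m a) * (V \<oplus>\<^sub>m 1\<^sub>m a)"
    unfolding * by (simp add: dsum_mult dY GL_dim[OF *(1)] GL_dim[OF *(2)] mat_one_left_dim)
  then show ?thesis unfolding gl_equiv_def using GL_dsum[OF _ GL_one[of a]] *(1,2) by auto
qed

lemma gl_equiv_swap:
  assumes "X \<in> carrier_mat n n"
  shows "gl_equiv (n + q) 0 (X \<oplus>\<^sub>m 1\<^sub>m q) (1\<^sub>m q \<oplus>\<^sub>m X)"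
proof -
  have "X \<oplus>\<^sub>m 1\<^sub>m q = four_block_mat (0\<^sub>m n q) (1\<^sub>m n) (1\<^sub>m q) (0\<^sub>m q n) * (1\<^sub>m q \<oplus>\<^sub>m X) *
     four_block_mat (0\<^sub>m q n) (1\<^sub>m q) (1\<^sub>m n) (0\<^sub>m n q)"
    using assms unfolding dsum_def by (simp add: four_block_mult_dim mat_ring_simps carrier_matD[OF assms])
  then show ?thesis unfolding gl_equiv_def using GL_swap[of n q] GL_swap[of q n] by (auto simp: add.commute)
qed

end

interpretation UNIV_ring: coeff_ring UNIV by unfold_locales auto

section \<open>Removing the largest index\<close>

text \<open>The columns \<open>q, \<dots>, q + n - 1\<close> of the identity matrix of size \<open>k\<close>. Multiplication by such a matrix
  embeds or extracts a block.\<close>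

definition incl :: "nat \<Rightarrow> nat \<Rightarrow> nat \<Rightarrow> 'a::semiring_1 mat" where
  "incl k q n = mat k n (\<lambda>(i, j). if i = q + j then 1 else 0)"

lemma incl_dim[simp]: "dim_row (incl k q n) = k" "dim_col (incl k q n) = n"
  by (simp_all add: incl_def)

lemma incl_mult:
  fixes M :: "'a::semiring_1 mat"
  assumes "dim_row M = n"
  shows "incl k q n * M = mat k (dim_col M) (\<lambda>(i, j). if q \<le> i \<and> i < q + n then M $$ (i - q, j) else 0)" (is "_ = ?R")
proof (rule eq_matI)
  fix i j assume "i < dim_row ?R" "j < dim_col ?R"
  then have ij: "i < k" "j < dim_col M" by auto
  have "(incl k q n * M) $$ (i, j) = (\<Sum>t<n. (if i = q + t then 1 else 0) * M $$ (t, j))"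
    using ij assms by (auto simp: scalar_prod_def incl_def lessThan_atLeast0 intro!: sum.cong)
  also have "\<dots> = (\<Sum>t<n. if t = i - q then (if q \<le> i then M $$ (t, j) else 0) else 0)" by (intro sum.cong) auto
  finally show "(incl k q n * M) $$ (i, j) = ?R $$ (i, j)" using ij by (auto simp: sum.delta)
qed (use assms in auto)

lemma mult_incl:
  fixes A :: "'a::semiring_1 mat"
  assumes "dim_col A = k" "q + n \<le> k"
  shows "A * incl k q n = mat (dim_row A) n (\<lambda>(i, j). A $$ (i, q + j))" (is "_ = ?R")
proof (rule eq_matI)
  fix i j assume "i < dim_row ?R" "j < dim_col ?R"
  then have ij: "i < dim_row A" "j < n" by auto
  have "(A * incl k q n) $$ (i, j) = (\<Sum>t<k. A $$ (i, t) * (if t = q + j then 1 else 0))"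
    using ij assms by (auto simp: scalar_prod_def incl_def lessThan_atLeast0 intro!: sum.cong)
  also have "\<dots> = (\<Sum>t<k. if t = q + j then A $$ (i, t) else 0)" by (intro sum.cong) auto
  finally show "(A * incl k q n) $$ (i, j) = ?R $$ (i, j)" using ij assms by simp
qed auto

lemma incl_project:
  fixes a :: "'a::comm_ring_1 mat"
  assumes "a \<in> carrier_mat n n"
  shows "incl (q + n + p) q n * (a * (incl (q + n + p) q n)\<^sup>T) = 0\<^sub>m q q \<oplus>\<^sub>m a \<oplus>\<^sub>m 0\<^sub>m p p"
proof -
  let ?e = "incl (q + n + p) q n :: 'a mat"
  have E: "?e \<in> carrier_mat (q + n + p) n" by (rule carrier_matI) auto
  have "a * ?e\<^sup>T = (?e * a\<^sup>T)\<^sup>T" using assms by (subst transpose_mult[OF E]) auto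
  also have "?e * a\<^sup>T = mat (q + n + p) n (\<lambda>(i, j). if q \<le> i \<and> i < q + n then a $$ (j, i - q) else 0)"
    using assms by (subst incl_mult) (auto intro!: eq_matI)
  finally show ?thesis
    by (simp only:) (subst incl_mult, use assms in \<open>auto intro!: eq_matI simp: dsum_index\<close>)
qed

abbreviation top_incl :: "nat \<Rightarrow> nat \<Rightarrow> 'a::semiring_1 mat" where
  "top_incl n q \<equiv> incl (n + q) 0 n"

lemma dsum_mult_top_incl:
  fixes a b :: "'a::semiring_1 mat"
  assumes "a \<in> carrier_mat n n" "b \<in> carrier_mat q q"
  shows "(a \<oplus>\<^sub>m b) * top_incl n q = top_incl n q * a"
  using assms by (subst mult_incl, simp, simp, subst incl_mult) (auto intro!: eq_matI simp: dsum_index)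

text \<open>A matrix of \<open>2 \<times> 2\<close> blocks padded by an identity, regrouped so that the first block row faces all
  the others.\<close>

lemma block_extend:
  fixes p :: "'a::comm_ring_1 mat"
  assumes "p \<in> carrier_mat n n"
  shows "four_block_mat p (x \<cdot>\<^sub>m 1\<^sub>m n) (s \<cdot>\<^sub>m 1\<^sub>m n) (t \<cdot>\<^sub>m 1\<^sub>m n) \<oplus>\<^sub>m 1\<^sub>m q
    = four_block_mat p (x \<cdot>\<^sub>m (top_incl n q)\<^sup>T) (s \<cdot>\<^sub>m top_incl n q) (t \<cdot>\<^sub>m 1\<^sub>m n \<oplus>\<^sub>m 1\<^sub>m q)"
  using assms by (intro eq_matI) (auto simp: dsum_index incl_def)

lemma four_block_cong: "A = A' \<Longrightarrow> B = B' \<Longrightarrow> C = C' \<Longrightarrow> D = D' \<Longrightarrow> four_block_mat A B C D = four_block_mat A' B' C' D'"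
  by simp

text \<open>Let \<open>T = l (a \<oplus> J) - N\<close> be the smaller pencil, \<open>E\<close> the inclusion of its first block, \<open>F\<close> the transpose
  of \<open>E\<close>, and \<open>G = I - E F = 0 \<oplus> I\<close>. The left-hand side has the block rows \<open>[a, -F]\<close> and
  \<open>[- N E, l (I \<oplus> J) - N G]\<close>. Since \<open>T E = l E a - N E\<close> and \<open>T G = l (0 \<oplus> J) - N G\<close>, it factors as
  \<open>[I, 0; -l E, I] (I \<oplus> T) [a, -F; E, G]\<close>, and both outer factors are \<open>2 \<times> 2\<close> block matrices
  padded by an identity.\<close>

lemma peel_top_factorization:
  fixes l :: "'a::comm_ring_1"
  assumes c: "Am \<in> carrier_mat n n" "A \<in> carrier_mat n n" "N \<in> carrier_mat (n + q) (n + q)" "J \<in> carrier_mat q q"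
  defines "a \<equiv> l \<cdot>\<^sub>m Am + A"
  shows "l \<cdot>\<^sub>m (Am \<oplus>\<^sub>m 1\<^sub>m n \<oplus>\<^sub>m J) - (1\<^sub>m n \<oplus>\<^sub>m N) * (companion_block A \<oplus>\<^sub>m 1\<^sub>m q)
   = (four_block_mat (1\<^sub>m n) (0\<^sub>m n n) (- l \<cdot>\<^sub>m 1\<^sub>m n) (1\<^sub>m n) \<oplus>\<^sub>m 1\<^sub>m q)
     * (1\<^sub>m n \<oplus>\<^sub>m (l \<cdot>\<^sub>m (a \<oplus>\<^sub>m J) - N))
     * (four_block_mat a (- 1\<^sub>m n) (1\<^sub>m n) (0\<^sub>m n n) \<oplus>\<^sub>m 1\<^sub>m q)" (is "?L = ?R")
proof -
  let ?E = "top_incl n q :: 'a mat" and ?F = "(top_incl n q)\<^sup>T :: 'a mat" and ?G = "0\<^sub>m n n \<oplus>\<^sub>m 1\<^sub>m q :: 'a mat"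
  define T where "T = l \<cdot>\<^sub>m (a \<oplus>\<^sub>m J) - N"
  have ac: "a \<in> carrier_mat n n" using c by (simp add: a_def)
  note d[simp] = c[THEN carrier_matD(1)] c[THEN carrier_matD(2)] carrier_matD[OF ac]
  have dT[simp]: "dim_row T = n + q" "dim_col T = n + q" by (auto simp: T_def)
  have z: "0\<^sub>m n n = (0::'a) \<cdot>\<^sub>m 1\<^sub>m n" "- 1\<^sub>m n = (-1::'a) \<cdot>\<^sub>m 1\<^sub>m n" "1\<^sub>m n = (1::'a) \<cdot>\<^sub>m 1\<^sub>m n"
    by (auto intro!: eq_matI)
  have o: "0 \<cdot>\<^sub>m (1\<^sub>m n) \<oplus>\<^sub>m 1\<^sub>m q = ?G" "(0::'a) \<cdot>\<^sub>m ?F = 0\<^sub>m n (n + q)" "(-1::'a) \<cdot>\<^sub>m ?F = - ?F" "(1::'a) \<cdot>\<^sub>m ?F = ?F"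
     "(1::'a) \<cdot>\<^sub>m ?E = ?E" "(1::'a) \<cdot>\<^sub>m 1\<^sub>m n \<oplus>\<^sub>m 1\<^sub>m q = 1\<^sub>m (n + q)"
     by (auto intro!: eq_matI simp: dsum_index)
  have U: "four_block_mat (1\<^sub>m n) (0\<^sub>m n n) (- l \<cdot>\<^sub>m 1\<^sub>m n) (1\<^sub>m n) \<oplus>\<^sub>m 1\<^sub>m q
     = four_block_mat (1\<^sub>m n) (0\<^sub>m n (n + q)) (- l \<cdot>\<^sub>m ?E) (1\<^sub>m (n + q))"
    using block_extend[of "1\<^sub>m n" n 0 "- l" 1 q] unfolding o z(1)[symmetric] z(3)[symmetric] by (simp add: dsum_one)
  have Z: "four_block_mat b (- 1\<^sub>m n) (1\<^sub>m n) (0\<^sub>m n n) \<oplus>\<^sub>m 1\<^sub>m q = four_block_mat b (- ?F) ?E ?G"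
    if "b \<in> carrier_mat n n" for b :: "'a mat"
    using block_extend[OF that, of "-1" 1 0 q] unfolding o z(1)[symmetric] z(2)[symmetric] z(3)[symmetric] by simp
  have K: "companion_block A \<oplus>\<^sub>m 1\<^sub>m q = four_block_mat (- A) ?F ?E ?G"
    using block_extend[of "- A" n 1 1 0 q] c(2) unfolding o z(1)[symmetric] z(3)[symmetric] companion_block_def by simp
  have R: "?R = four_block_mat a (- ?F) (T * ?E - l \<cdot>\<^sub>m (?E * a)) (l \<cdot>\<^sub>m (?E * ?F) + T * ?G)"
    unfolding U Z[OF ac] T_def[symmetric] unfolding dsum_def[of "1\<^sub>m n" T]
    by (simp add: four_block_mult_dim mat_ring_simps)
       (rule four_block_cong, auto intro!: eq_matI simp del: index_mult_mat(1))
  have L: "?L = four_block_mat (l \<cdot>\<^sub>m Am + A) (- ?F) (- (N * ?E)) (l \<cdot>\<^sub>m (1\<^sub>m n \<oplus>\<^sub>m J) - N * ?G)"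
    unfolding K unfolding dsum_def[of "1\<^sub>m n" N] dsum_def[of Am]
    by (simp add: four_block_mult_dim mat_ring_simps)
       (auto intro!: eq_matI simp del: index_mult_mat(1))
  have TE: "T * ?E = l \<cdot>\<^sub>m (?E * a) - N * ?E"
    unfolding T_def using dsum_mult_top_incl[OF ac c(4)] by (simp add: mat_ring_simps)
  have TG: "T * ?G = l \<cdot>\<^sub>m (0\<^sub>m n n \<oplus>\<^sub>m J) - N * ?G"
    unfolding T_def by (simp add: mat_ring_simps dsum_mult)
  have EF: "?E * ?F = 1\<^sub>m n \<oplus>\<^sub>m 0\<^sub>m q q"
    using incl_project[of "1\<^sub>m n :: 'a mat" n 0 q] by (simp add: mat_ring_simps)
  show ?thesis unfolding L R
  proof (rule four_block_cong)
    show "- (N * ?E) = T * ?E - l \<cdot>\<^sub>m (?E * a)" unfolding TE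
      by (auto intro!: eq_matI simp del: index_mult_mat(1))
    show "l \<cdot>\<^sub>m (1\<^sub>m n \<oplus>\<^sub>m J) - N * ?G = l \<cdot>\<^sub>m (?E * ?F) + T * ?G" unfolding TG EF
      by (auto intro!: eq_matI simp del: index_mult_mat(1) simp: dsum_index)
  qed (simp_all add: a_def)
qed

text \<open>The leading matrix vanishes on the last \<open>r\<close> coordinates; a term \<open>\<lambda> E\<close> of the state pencil
  belongs into \<open>S\<close>.\<close>

definition pencil :: "nat \<Rightarrow> nat \<Rightarrow> nat \<Rightarrow> 'a::comm_ring_1 \<Rightarrow> 'a mat \<Rightarrow> (nat \<Rightarrow> 'a mat) \<Rightarrow> nat list \<Rightarrow> 'a mat" where
  "pencil n r m l S As \<sigma> = l \<cdot>\<^sub>m (As m \<oplus>\<^sub>m 1\<^sub>m ((m - 1) * n) \<oplus>\<^sub>m 0\<^sub>m r r) - mprod (m * n + r) (fiedler_mat n r m S As) \<sigma>"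

text \<open>One step of Horner's scheme.\<close>

definition horner_merge :: "'a::comm_ring_1 \<Rightarrow> nat \<Rightarrow> (nat \<Rightarrow> 'a mat) \<Rightarrow> nat \<Rightarrow> 'a mat" where
  "horner_merge l k As = As(k := l \<cdot>\<^sub>m As (Suc k) + As k)"

text \<open>Without index \<open>k\<close>, all factors in \<open>\<beta>\<close> are the identity on the first two blocks, so they commute
  with the factor of index \<open>k + 1\<close>. This factor can be moved to the right end, where
  \<open>peel_top_factorization\<close> applies.\<close>

lemma peel_top_left:
  fixes l :: "'a::comm_ring_1"
  assumes S: "S \<in> carrier_mat (n + r) (n + r)" and As: "\<And>i. 0 < i \<Longrightarrow> i \<le> Suc (Suc k) \<Longrightarrow> As i \<in> carrier_mat n n"
    and \<sigma>: "set \<alpha> \<subseteq> {..k}" "set \<beta> \<subseteq> {..<k}"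
  shows "UNIV_ring.gl_equiv (Suc (Suc k) * n) r (pencil n r (Suc (Suc k)) l S As (\<alpha> @ Suc k # \<beta>))
    (1\<^sub>m n \<oplus>\<^sub>m pencil n r (Suc k) l S (horner_merge l (Suc k) As) (\<alpha> @ \<beta>))"
proof -
  let ?F = "fiedler_mat n r (Suc (Suc k)) S As" and ?F1 = "fiedler_mat n r (Suc k) S As"
  define q where "q = k * n + r"
  define m1 where "m1 = Suc k * n + r"
  define m2 where "m2 = Suc (Suc k) * n + r"
  define W where "W = mprod m1 ?F1 \<alpha>"
  define Y' where "Y' = mprod q (fiedler_mat n r k S As) \<beta>"
  have m: "m2 = n + m1" "m1 = n + q" by (auto simp: q_def m1_def m2_def)
  have cF: "?F i \<in> carrier_mat m2 m2" if "i \<le> Suc k" for i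
    unfolding m2_def using that by (intro fiedler_mat_carrier S As) auto
  have cF1: "?F1 i \<in> carrier_mat m1 m1" if "i \<le> k" for i
    unfolding m1_def using that by (intro fiedler_mat_carrier S As) auto
  have cF2: "fiedler_mat n r k S As i \<in> carrier_mat q q" if "i < k" for i
    unfolding q_def using that by (intro fiedler_mat_carrier S As) auto
  have W: "W \<in> carrier_mat (n + q) (n + q)" unfolding W_def m(2)[symmetric] using \<sigma> by (intro mprod_carrier cF1) auto
  have Y': "Y' \<in> carrier_mat q q" unfolding Y'_def using \<sigma> by (intro mprod_carrier cF2) auto
  note d[simp] = carrier_matD[OF W] carrier_matD[OF Y']
  have Am: "As (Suc (Suc k)) \<in> carrier_mat n n" "As (Suc k) \<in> carrier_mat n n" using As by auto
  have \<alpha>: "mprod m2 ?F \<alpha> = 1\<^sub>m n \<oplus>\<^sub>m W"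
    unfolding W_def m(1) using \<sigma>
    by (subst mprod_dsum_left[symmetric]) (auto intro!: mprod_cong fiedler_mat_peel_top cF1)
  have \<beta>1: "mprod m1 ?F1 \<beta> = 1\<^sub>m n \<oplus>\<^sub>m Y'"
    unfolding Y'_def m(2) using \<sigma>
    by (subst mprod_dsum_left[symmetric]) (auto intro!: mprod_cong fiedler_mat_peel_top cF2)
  have \<beta>: "mprod m2 ?F \<beta> = 1\<^sub>m n \<oplus>\<^sub>m 1\<^sub>m n \<oplus>\<^sub>m Y'"
    unfolding \<beta>1[symmetric] m(1) using \<sigma>
    by (subst mprod_dsum_left[symmetric]) (auto intro!: mprod_cong fiedler_mat_peel_top cF1 dest: subsetD)
  define N where "N = mprod m1 ?F1 (\<alpha> @ \<beta>)"
  have N: "N = W * (1\<^sub>m n \<oplus>\<^sub>m Y')" unfolding N_def W_def \<beta>1[symmetric]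
    by (rule mprod_append) (use \<sigma> in \<open>auto intro!: cF1\<close>)
  have F: "?F (Suc k) = companion_block (As (Suc k)) \<oplus>\<^sub>m 1\<^sub>m q"
    by (simp add: fiedler_mat_def q_def)
  have dK: "dim_row (companion_block (As (Suc k))) = n + n" "dim_col (companion_block (As (Suc k))) = n + n"
    using companion_block_carrier[OF Am(2)] by auto
  have "mprod m2 ?F (\<alpha> @ Suc k # \<beta>) = mprod m2 ?F \<alpha> * mprod m2 ?F (Suc k # \<beta>)"
    by (rule mprod_append) (use \<sigma> in \<open>auto intro!: cF dest: subsetD\<close>)
  also have "\<dots> = (1\<^sub>m n \<oplus>\<^sub>m W) * ((companion_block (As (Suc k)) \<oplus>\<^sub>m 1\<^sub>m q) * (1\<^sub>m (n + n) \<oplus>\<^sub>m Y'))"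
    by (simp add: \<alpha> \<beta> F dsum_assoc[symmetric] dsum_one)
  also have "(companion_block (As (Suc k)) \<oplus>\<^sub>m 1\<^sub>m q) * (1\<^sub>m (n + n) \<oplus>\<^sub>m Y') =
      (1\<^sub>m (n + n) \<oplus>\<^sub>m Y') * (companion_block (As (Suc k)) \<oplus>\<^sub>m 1\<^sub>m q)"
    by (simp add: dsum_mult dK mat_ring_simps)
  also have "(1\<^sub>m n \<oplus>\<^sub>m W) * \<dots> = ((1\<^sub>m n \<oplus>\<^sub>m W) * (1\<^sub>m n \<oplus>\<^sub>m 1\<^sub>m n \<oplus>\<^sub>m Y')) * (companion_block (As (Suc k)) \<oplus>\<^sub>m 1\<^sub>m q)"
    by (simp add: mat_assoc_dim dK dsum_assoc[symmetric] dsum_one)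
  also have "(1\<^sub>m n \<oplus>\<^sub>m W) * (1\<^sub>m n \<oplus>\<^sub>m 1\<^sub>m n \<oplus>\<^sub>m Y') = 1\<^sub>m n \<oplus>\<^sub>m N"
    unfolding N by (simp add: dsum_mult mat_ring_simps)
  finally have P: "mprod m2 ?F (\<alpha> @ Suc k # \<beta>) = (1\<^sub>m n \<oplus>\<^sub>m N) * (companion_block (As (Suc k)) \<oplus>\<^sub>m 1\<^sub>m q)" .
  have cN: "N \<in> carrier_mat (n + q) (n + q)" unfolding N using W Y' by (auto intro!: mult_carrier_mat)
  let ?J = "1\<^sub>m (k * n) \<oplus>\<^sub>m 0\<^sub>m r r :: 'a mat"
  have J: "?J \<in> carrier_mat q q" by (auto simp: q_def)
  have N': "mprod m1 (fiedler_mat n r (Suc k) S (horner_merge l (Suc k) As)) (\<alpha> @ \<beta>) = N"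
    unfolding N_def using \<sigma> by (intro mprod_cong) (auto simp: fiedler_mat_def horner_merge_def)
  have X: "pencil n r (Suc (Suc k)) l S As (\<alpha> @ Suc k # \<beta>) =
     l \<cdot>\<^sub>m (As (Suc (Suc k)) \<oplus>\<^sub>m 1\<^sub>m n \<oplus>\<^sub>m ?J) - (1\<^sub>m n \<oplus>\<^sub>m N) * (companion_block (As (Suc k)) \<oplus>\<^sub>m 1\<^sub>m q)"
    unfolding pencil_def m2_def[symmetric] P by (simp add: dsum_one[symmetric] dsum_assoc)
  define a where "a = l \<cdot>\<^sub>m As (Suc (Suc k)) + As (Suc k)"
  have a: "a \<in> carrier_mat n n" using Am by (auto simp: a_def)
  have T: "pencil n r (Suc k) l S (horner_merge l (Suc k) As) (\<alpha> @ \<beta>) = l \<cdot>\<^sub>m (a \<oplus>\<^sub>m ?J) - N"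
    unfolding pencil_def m1_def[symmetric] N' by (simp add: horner_merge_def a_def)
  let ?U = "four_block_mat (1\<^sub>m n) (0\<^sub>m n n) (- l \<cdot>\<^sub>m 1\<^sub>m n) (1\<^sub>m n)" and ?V = "four_block_mat a (- 1\<^sub>m n) (1\<^sub>m n) (0\<^sub>m n n)"
  have "?U \<oplus>\<^sub>m 1\<^sub>m q = (?U \<oplus>\<^sub>m 1\<^sub>m (k * n)) \<oplus>\<^sub>m 1\<^sub>m r" "?V \<oplus>\<^sub>m 1\<^sub>m q = (?V \<oplus>\<^sub>m 1\<^sub>m (k * n)) \<oplus>\<^sub>m 1\<^sub>m r"
    by (simp_all add: q_def dsum_one[symmetric] dsum_assoc)
  moreover have "?U \<oplus>\<^sub>m 1\<^sub>m (k * n) \<in> UNIV_ring.GL (n + n + k * n)"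
    by (intro UNIV_ring.GL_dsum UNIV_ring.GL_lower UNIV_ring.GL_one) (auto simp: entries_in_def)
  moreover have "?V \<oplus>\<^sub>m 1\<^sub>m (k * n) \<in> UNIV_ring.GL (n + n + k * n)"
    by (intro UNIV_ring.GL_dsum UNIV_ring.GL_companion UNIV_ring.GL_one a) (auto simp: entries_in_def)
  moreover have "n + n + k * n = Suc (Suc k) * n" by simp
  ultimately show ?thesis
    unfolding UNIV_ring.gl_equiv_def X T peel_top_factorization[OF Am cN J, of l] a_def[symmetric] by metis
qed

lemma pencil_carrier:
  assumes "S \<in> carrier_mat (n + r) (n + r)" and As: "\<And>i. 0 < i \<Longrightarrow> i \<le> Suc m \<Longrightarrow> As i \<in> carrier_mat n n"
    and "set \<sigma> \<subseteq> {..m}"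
  shows "pencil n r (Suc m) l S As \<sigma> \<in> carrier_mat (Suc m * n + r) (Suc m * n + r)"
  unfolding pencil_def using assms
  by (intro minus_carrier_mat mprod_carrier fiedler_mat_carrier) auto

lemma smult_transpose: "(c \<cdot>\<^sub>m M)\<^sup>T = c \<cdot>\<^sub>m M\<^sup>T"
  by (rule eq_matI) auto

lemma pencil_transpose:
  assumes "S \<in> carrier_mat (n + r) (n + r)" and As: "\<And>i. 0 < i \<Longrightarrow> i \<le> Suc m \<Longrightarrow> As i \<in> carrier_mat n n"
    and "set \<sigma> \<subseteq> {..m}"
  shows "(pencil n r (Suc m) l S As \<sigma>)\<^sup>T = pencil n r (Suc m) l S\<^sup>T (\<lambda>i. (As i)\<^sup>T) (rev \<sigma>)"
proof -
  define N where "N = Suc m * n + r"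
  have c: "\<And>i. i \<in> set \<sigma> \<Longrightarrow> fiedler_mat n r (Suc m) S As i \<in> carrier_mat N N"
    unfolding N_def using assms by (intro fiedler_mat_carrier) auto
  have 1: "(mprod N (fiedler_mat n r (Suc m) S As) \<sigma>)\<^sup>T = mprod N (fiedler_mat n r (Suc m) S\<^sup>T (\<lambda>i. (As i)\<^sup>T)) (rev \<sigma>)"
    by (subst mprod_transpose[OF c], assumption, intro mprod_cong fiedler_mat_transpose) (use assms in auto)
  have A: "As (Suc m) \<in> carrier_mat n n" using As by auto
  have "(pencil n r (Suc m) l S As \<sigma>)\<^sup>T =
     (l \<cdot>\<^sub>m (As (Suc m) \<oplus>\<^sub>m 1\<^sub>m ((Suc m - 1) * n) \<oplus>\<^sub>m 0\<^sub>m r r))\<^sup>T - (mprod N (fiedler_mat n r (Suc m) S As) \<sigma>)\<^sup>T"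
    unfolding pencil_def N_def[symmetric]
    by (rule transpose_minus[of _ N N]) (use A mprod_carrier[OF c, of \<sigma>] in \<open>auto simp: N_def\<close>)
  also have "(l \<cdot>\<^sub>m (As (Suc m) \<oplus>\<^sub>m 1\<^sub>m ((Suc m - 1) * n) \<oplus>\<^sub>m 0\<^sub>m r r))\<^sup>T = l \<cdot>\<^sub>m ((As (Suc m))\<^sup>T \<oplus>\<^sub>m 1\<^sub>m ((Suc m - 1) * n) \<oplus>\<^sub>m 0\<^sub>m r r)"
    by (simp add: smult_transpose dsum_transpose)
  finally show ?thesis unfolding 1 unfolding pencil_def N_def .
qed

lemma set_remove_middle:
  assumes "distinct (\<alpha> @ Suc k # \<beta>)" "set (\<alpha> @ Suc k # \<beta>) = {..Suc k}"
  shows "set (\<alpha> @ \<beta>) = {..k}"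
proof -
  have "set (\<alpha> @ \<beta>) = set (\<alpha> @ Suc k # \<beta>) - {Suc k}" using assms(1) by auto
  also have "\<dots> = {..Suc k} - {Suc k}" by (simp only: assms(2))
  also have "\<dots> = {..k}" by (simp add: atMost_Suc)
  finally show ?thesis .
qed

text \<open>If \<open>k\<close> stands on the right of \<open>k + 1\<close>, transposition reverses the tuple and leads back to the
  case \<open>peel_top_left\<close>.\<close>

lemma peel_top:
  fixes l :: "'a::comm_ring_1"
  assumes S: "S \<in> carrier_mat (n + r) (n + r)" and As: "\<And>i. 0 < i \<Longrightarrow> i \<le> Suc (Suc k) \<Longrightarrow> As i \<in> carrier_mat n n"
    and \<sigma>: "distinct (\<alpha> @ Suc k # \<beta>)" "set (\<alpha> @ Suc k # \<beta>) = {..Suc k}"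
  shows "UNIV_ring.gl_equiv (Suc (Suc k) * n) r (pencil n r (Suc (Suc k)) l S As (\<alpha> @ Suc k # \<beta>))
    (1\<^sub>m n \<oplus>\<^sub>m pencil n r (Suc k) l S (horner_merge l (Suc k) As) (\<alpha> @ \<beta>))"
proof -
  have sub: "set (\<alpha> @ \<beta>) = {..k}" using \<sigma> by (rule set_remove_middle)
  then have sub': "set \<alpha> \<subseteq> {..k}" "set \<beta> \<subseteq> {..k}" by auto
  have hm: "horner_merge l (Suc k) As i \<in> carrier_mat n n" if "0 < i" "i \<le> Suc k" for i
    using that As by (auto simp: horner_merge_def)
  show ?thesis
  proof (cases "k \<in> set \<beta>")
    case False
    then have "set \<beta> \<subseteq> {..<k}" using sub' by (auto simp: less_le)
    with S As sub'(1) show ?thesis by (intro peel_top_left) auto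
  next
    case True
    then have "k \<notin> set \<alpha>" using \<sigma>(1) by auto
    then have "set (rev \<alpha>) \<subseteq> {..<k}" using sub' by (auto simp: less_le)
    then have *: "UNIV_ring.gl_equiv (Suc (Suc k) * n) r (pencil n r (Suc (Suc k)) l S\<^sup>T (\<lambda>i. (As i)\<^sup>T) (rev \<beta> @ Suc k # rev \<alpha>))
      (1\<^sub>m n \<oplus>\<^sub>m pencil n r (Suc k) l S\<^sup>T (horner_merge l (Suc k) (\<lambda>i. (As i)\<^sup>T)) (rev \<beta> @ rev \<alpha>))" (is "UNIV_ring.gl_equiv _ _ ?X (1\<^sub>m n \<oplus>\<^sub>m ?Y)")
      using S As sub' by (intro peel_top_left) auto
    have h: "horner_merge l (Suc k) (\<lambda>i. (As i)\<^sup>T) = (\<lambda>i. (horner_merge l (Suc k) As i)\<^sup>T)"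
      using As[of "Suc k"] As[of "Suc (Suc k)"] by (auto simp: horner_merge_def smult_transpose fun_eq_iff intro!: eq_matI)
    have X: "?X\<^sup>T = pencil n r (Suc (Suc k)) l S As (\<alpha> @ Suc k # \<beta>)"
      by (subst pencil_transpose) (use S As sub' in \<open>auto dest: subsetD\<close>)
    have Y: "?Y\<^sup>T = pencil n r (Suc k) l S (horner_merge l (Suc k) As) (\<alpha> @ \<beta>)"
      unfolding h by (subst pencil_transpose) (use S hm sub' in \<open>auto dest: subsetD\<close>)
    have "?Y \<in> carrier_mat (Suc k * n + r) (Suc k * n + r)"
      unfolding h by (rule pencil_carrier) (use S hm sub' in \<open>auto dest: subsetD\<close>)
    then have "1\<^sub>m n \<oplus>\<^sub>m ?Y \<in> carrier_mat (n + (Suc k * n + r)) (n + (Suc k * n + r))"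
      by (intro dsum_carrier) auto
    then have "1\<^sub>m n \<oplus>\<^sub>m ?Y \<in> carrier_mat (Suc (Suc k) * n + r) (Suc (Suc k) * n + r)"
      by (simp add: algebra_simps)
    from UNIV_ring.gl_equiv_transpose[OF * this] show ?thesis by (simp add: X Y dsum_transpose)
  qed
qed

definition power_sum :: "nat \<Rightarrow> 'a::comm_ring_1 \<Rightarrow> nat \<Rightarrow> (nat \<Rightarrow> 'a mat) \<Rightarrow> 'a mat" where
  "power_sum n l m As = mat n n (\<lambda>(i, j). \<Sum>k=1..m. l ^ k * As k $$ (i, j))"

lemma power_sum_carrier[simp]: "power_sum n l m As \<in> carrier_mat n n"
  by (simp add: power_sum_def)

lemma power_sum_horner:
  assumes "As (Suc k) \<in> carrier_mat n n" "As (Suc (Suc k)) \<in> carrier_mat n n"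
  shows "power_sum n l (Suc k) (horner_merge l (Suc k) As) = power_sum n l (Suc (Suc k)) As"
proof (rule eq_matI)
  fix i j assume "i < dim_row (power_sum n l (Suc (Suc k)) As)" "j < dim_col (power_sum n l (Suc (Suc k)) As)"
  then have ij: "i < n" "j < n" by (auto simp: power_sum_def)
  have "(\<Sum>t=1..k. l ^ t * horner_merge l (Suc k) As t $$ (i, j)) = (\<Sum>t=1..k. l ^ t * As t $$ (i, j))"
    by (intro sum.cong) (auto simp: horner_merge_def)
  then show "power_sum n l (Suc k) (horner_merge l (Suc k) As) $$ (i, j) = power_sum n l (Suc (Suc k)) As $$ (i, j)"
    using ij assms by (simp add: power_sum_def) (simp add: horner_merge_def algebra_simps)
qed (auto simp: power_sum_def)

text \<open>Removing all indices but 0 from the top evaluates the coefficients by Horner's scheme, while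
  \<open>S\<close> is carried along unchanged.\<close>

lemma pencil_equivalent:
  fixes l :: "'a::comm_ring_1"
  assumes "S \<in> carrier_mat (n + r) (n + r)" "\<And>i. 0 < i \<Longrightarrow> i \<le> Suc k \<Longrightarrow> As i \<in> carrier_mat n n"
    and "distinct \<sigma>" "set \<sigma> = {..k}"
  shows "UNIV_ring.gl_equiv (Suc k * n) r (pencil n r (Suc k) l S As \<sigma>)
     (1\<^sub>m (k * n) \<oplus>\<^sub>m ((power_sum n l (Suc k) As \<oplus>\<^sub>m 0\<^sub>m r r) - S))"
  using assms(2-)
proof (induction k arbitrary: As \<sigma>)
  case 0
  have "\<sigma> = [0]" using 0(2,3) by (cases \<sigma>; cases "tl \<sigma>") auto
  have A: "As (Suc 0) \<in> carrier_mat n n" using 0 by auto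
  have "pencil n r (Suc 0) l S As \<sigma> = (power_sum n l (Suc 0) As \<oplus>\<^sub>m 0\<^sub>m r r) - S"
    unfolding \<open>\<sigma> = [0]\<close> pencil_def using A assms(1)
    by (auto intro!: eq_matI simp: fiedler_mat_def power_sum_def dsum_index mat_one_right_dim)
  moreover have "\<dots> \<in> carrier_mat (Suc 0 * n + r) (Suc 0 * n + r)"
    using assms(1) by (auto simp: power_sum_def)
  ultimately show ?case using UNIV_ring.gl_equiv_refl by simp
next
  case (Suc k)
  have "Suc k \<in> set \<sigma>" using Suc.prems by auto
  then obtain \<alpha> \<beta> where \<sigma>: "\<sigma> = \<alpha> @ Suc k # \<beta>" by (meson split_list)
  have sub: "set (\<alpha> @ \<beta>) = {..k}"
    using Suc.prems(2,3) unfolding \<sigma> by (rule set_remove_middle)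
  let ?A = "horner_merge l (Suc k) As"
  have hm: "?A i \<in> carrier_mat n n" if "0 < i" "i \<le> Suc k" for i
    using that Suc.prems by (auto simp: horner_merge_def)
  let ?Z = "(power_sum n l (Suc (Suc k)) As \<oplus>\<^sub>m 0\<^sub>m r r) - S"
  have *: "UNIV_ring.gl_equiv (Suc k * n) r (pencil n r (Suc k) l S ?A (\<alpha> @ \<beta>)) (1\<^sub>m (k * n) \<oplus>\<^sub>m ?Z)"
    using Suc.IH[of ?A "\<alpha> @ \<beta>", OF hm] sub Suc.prems(2) \<sigma> power_sum_horner[of As k n l] Suc.prems(1) by simp
  have Z: "?Z \<in> carrier_mat (n + r) (n + r)" using assms(1) by (auto simp: power_sum_def)
  then have cZ: "1\<^sub>m (k * n) \<oplus>\<^sub>m ?Z \<in> carrier_mat (k * n + (n + r)) (k * n + (n + r))"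
    by (intro dsum_carrier) auto
  then have cZ': "1\<^sub>m (k * n) \<oplus>\<^sub>m ?Z \<in> carrier_mat (Suc k * n + r) (Suc k * n + r)"
    by (simp add: algebra_simps)
  have **: "UNIV_ring.gl_equiv (n + Suc k * n) r (1\<^sub>m n \<oplus>\<^sub>m pencil n r (Suc k) l S ?A (\<alpha> @ \<beta>)) (1\<^sub>m n \<oplus>\<^sub>m 1\<^sub>m (k * n) \<oplus>\<^sub>m ?Z)"
    by (rule UNIV_ring.gl_equiv_dsum_left[OF * cZ'])
  have "UNIV_ring.gl_equiv (Suc (Suc k) * n) r (pencil n r (Suc (Suc k)) l S As \<sigma>) (1\<^sub>m n \<oplus>\<^sub>m pencil n r (Suc k) l S ?A (\<alpha> @ \<beta>))"
    unfolding \<sigma> by (rule peel_top) (use assms(1) Suc.prems \<sigma> in auto)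
  then have "UNIV_ring.gl_equiv (Suc (Suc k) * n) r (pencil n r (Suc (Suc k)) l S As \<sigma>) (1\<^sub>m n \<oplus>\<^sub>m 1\<^sub>m (k * n) \<oplus>\<^sub>m ?Z)"
  proof (rule UNIV_ring.gl_equiv_trans)
    have "1\<^sub>m n \<oplus>\<^sub>m 1\<^sub>m (k * n) \<oplus>\<^sub>m ?Z \<in> carrier_mat (n + (k * n + (n + r))) (n + (k * n + (n + r)))"
      by (rule dsum_carrier[OF one_carrier_mat cZ])
    then show "1\<^sub>m n \<oplus>\<^sub>m 1\<^sub>m (k * n) \<oplus>\<^sub>m ?Z \<in> carrier_mat (Suc (Suc k) * n + r) (Suc (Suc k) * n + r)"
      by (simp add: algebra_simps)
  qed (use ** in simp)
  moreover have "1\<^sub>m n \<oplus>\<^sub>m 1\<^sub>m (k * n) \<oplus>\<^sub>m ?Z = 1\<^sub>m (Suc k * n) \<oplus>\<^sub>m ?Z"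
    by (simp add: dsum_assoc[symmetric] dsum_one)
  ultimately show ?case by simp
qed

section \<open>Removing the index 0\<close>

text \<open>The pencil divided by its indeterminate, whose inverse is \<open>u\<close>.\<close>

definition rev_pencil :: "nat \<Rightarrow> nat \<Rightarrow> 'a::comm_ring_1 \<Rightarrow> 'a mat \<Rightarrow> (nat \<Rightarrow> 'a mat) \<Rightarrow> nat list \<Rightarrow> 'a mat" where
  "rev_pencil n m u S As \<sigma> = (As m \<oplus>\<^sub>m 1\<^sub>m ((m - 1) * n)) - u \<cdot>\<^sub>m mprod (m * n) (fiedler_mat n 0 m S As) \<sigma>"

text \<open>The reversed polynomial \<open>\<Sum> u\<^sup>m\<^sup>-\<^sup>t A\<^sub>t\<close>, with \<open>-S\<close> in the place of \<open>A\<^sub>0\<close>.\<close>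

definition reversal :: "nat \<Rightarrow> 'a::comm_ring_1 \<Rightarrow> nat \<Rightarrow> 'a mat \<Rightarrow> (nat \<Rightarrow> 'a mat) \<Rightarrow> 'a mat" where
  "reversal n u m S As = mat n n (\<lambda>(i, j). (\<Sum>k=1..m. u ^ (m - k) * As k $$ (i, j)) - u ^ m * S $$ (i, j))"

text \<open>What becomes of the tuple when index 0 is removed.\<close>

definition shift_down :: "nat list \<Rightarrow> nat list" where
  "shift_down \<sigma> = map (\<lambda>i. i - 1) (filter (\<lambda>i. i \<noteq> 0) \<sigma>)"

lemma shift_down_simps: "shift_down [] = []" "shift_down (0 # \<sigma>) = shift_down \<sigma>"
   "shift_down (Suc i # \<sigma>) = i # shift_down \<sigma>"
  by (simp_all add: shift_down_def)

lemma shift_down_append: "shift_down (\<sigma> @ \<tau>) = shift_down \<sigma> @ shift_down \<tau>"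
  by (simp add: shift_down_def)

lemma shift_down_distinct: "distinct \<sigma> \<Longrightarrow> distinct (shift_down \<sigma>)"
  by (auto simp: shift_down_def distinct_map inj_on_def)

lemma shift_down_set: "set \<sigma> = {..Suc k} \<Longrightarrow> set (shift_down \<sigma>) = {..k}"
proof -
  assume "set \<sigma> = {..Suc k}"
  then have "set (shift_down \<sigma>) = (\<lambda>i. i - 1) ` ({..Suc k} - {0})" by (auto simp: shift_down_def)
  also have "{..Suc k} - {0} = Suc ` {..k}" unfolding image_Suc_atMost by auto
  finally show ?thesis by (simp add: image_image)
qed

text \<open>Index 1 alone links the last block with the others. Without it the product is a direct sum whose
  last summand records whether index 0 occurs.\<close>

lemma mprod_without_one:
  assumes S: "S \<in> carrier_mat n n" and As: "\<And>i. 0 < i \<Longrightarrow> i \<le> Suc k \<Longrightarrow> As i \<in> carrier_mat n n"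
    and S': "S' \<in> carrier_mat n n"
    and \<sigma>: "distinct \<sigma>" "set \<sigma> \<subseteq> {..Suc k} - {1}"
  shows "mprod (Suc k * n + n) (fiedler_mat n 0 (Suc (Suc k)) S As) \<sigma> =
    mprod (Suc k * n) (fiedler_mat n 0 (Suc k) S' (\<lambda>i. As (Suc i))) (shift_down \<sigma>) \<oplus>\<^sub>m (if 0 \<in> set \<sigma> then S else 1\<^sub>m n)"
    (is "mprod ?K ?F _ = mprod ?k ?F' _ \<oplus>\<^sub>m _")
  using \<sigma>
proof (induction \<sigma>)
  case Nil
  then show ?case by (simp add: shift_down_def dsum_one)
next
  case (Cons i \<sigma>)
  have F': "?F' j \<in> carrier_mat ?k ?k" if "0 < j" "j \<le> k" for j
    using fiedler_mat_carrier[of S' n 0 j "Suc k" "\<lambda>i. As (Suc i)"] S' As that by simp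
  have c: "mprod ?k ?F' (shift_down \<sigma>) \<in> carrier_mat ?k ?k"
    by (rule mprod_carrier, rule F') (use Cons.prems in \<open>auto simp: shift_down_def\<close>)
  note d = c[THEN carrier_matD(1)] c[THEN carrier_matD(2)] S[THEN carrier_matD(1)] S[THEN carrier_matD(2)]
  show ?case
  proof (cases "i = 0")
    case True
    have "?F i = 1\<^sub>m ?k \<oplus>\<^sub>m S" using True by (simp add: fiedler_mat_def)
    then show ?thesis using Cons True
      by (simp add: shift_down_simps dsum_mult d mat_ring_simps del: mult_Suc)
  next
    case False
    then obtain j where j: "i = Suc j" by (cases i) auto
    then have j': "0 < j" "j \<le> k" using Cons.prems by auto
    have F: "?F i = ?F' j \<oplus>\<^sub>m 1\<^sub>m n" unfolding j using j' S' by (intro fiedler_mat_peel_bottom) auto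
    have d': "dim_col (?F' j) = ?k" using F'[OF j'] by auto
    have z: "(0 \<in> set (i # \<sigma>)) = (0 \<in> set \<sigma>)" using j by simp
    have "mprod ?K ?F (i # \<sigma>) = ?F i * mprod ?K ?F \<sigma>" by simp
    also have "\<dots> = ?F' j * mprod ?k ?F' (shift_down \<sigma>) \<oplus>\<^sub>m 1\<^sub>m n * (if 0 \<in> set \<sigma> then S else 1\<^sub>m n)"
      unfolding F using Cons by (subst Cons.IH) (simp_all add: dsum_mult d d' del: mult_Suc)
    finally show ?thesis unfolding z by (simp add: j shift_down_simps mat_ring_simps d del: mult_Suc)
  qed
qed

lemma (in coeff_ring) four_block_schur:
  assumes c: "M \<in> carrier_mat k k" "B \<in> carrier_mat k n" "C \<in> carrier_mat n k"
    and R: "entries_in R B" "entries_in R C"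
  shows "gl_equiv (k + n) 0 (four_block_mat M B C (1\<^sub>m n)) ((M - B * C) \<oplus>\<^sub>m 1\<^sub>m n)"
proof -
  note d = c[THEN carrier_matD(1)] c[THEN carrier_matD(2)]
  have "four_block_mat M B C (1\<^sub>m n) = four_block_mat (1\<^sub>m k) B (0\<^sub>m n k) (1\<^sub>m n) * ((M - B * C) \<oplus>\<^sub>m 1\<^sub>m n)
     * four_block_mat (1\<^sub>m k) (0\<^sub>m k n) C (1\<^sub>m n)"
    unfolding dsum_def by (simp add: four_block_mult_dim mat_ring_simps d)
      (rule four_block_cong, auto simp: d intro!: eq_matI simp del: index_mult_mat(1))
  moreover have "four_block_mat (1\<^sub>m k) B (0\<^sub>m n k) (1\<^sub>m n) \<in> GL (k + n)" using assms by (intro GL_upper) auto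
  moreover have "four_block_mat (1\<^sub>m k) (0\<^sub>m k n) C (1\<^sub>m n) \<in> GL (k + n)" using assms by (intro GL_lower) auto
  ultimately show ?thesis unfolding gl_equiv_def by auto
qed

abbreviation bot_incl :: "nat \<Rightarrow> nat \<Rightarrow> 'a::semiring_1 mat" where
  "bot_incl q n \<equiv> incl (q + n) q n"

text \<open>The factor of index 1, seen with its last block split off: the corner is zero.\<close>

lemma dsum_companion_block:
  fixes A :: "'a::comm_ring_1 mat"
  assumes "A \<in> carrier_mat n n"
  shows "1\<^sub>m q \<oplus>\<^sub>m companion_block A = four_block_mat (1\<^sub>m q \<oplus>\<^sub>m (- A)) (bot_incl q n) (bot_incl q n)\<^sup>T (0\<^sub>m n n)"
    (is "?L = ?R")
proof (rule eq_matI)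
  have d: "dim_row A = n" "dim_col A = n" using assms by auto
  have part: "i < q \<or> (\<exists>i'<n. i = q + i') \<or> (\<exists>i'<n. i = q + n + i')" if "i < q + (n + n)" for i
    using that by presburger
  fix i j assume "i < dim_row ?R" "j < dim_col ?R"
  then have ij: "i < q + (n + n)" "j < q + (n + n)" by (auto simp: d)
  show "?L $$ (i, j) = ?R $$ (i, j)"
    using part[OF ij(1)] part[OF ij(2)]
    by (elim disjE exE conjE) (simp_all add: dsum_index d incl_def companion_block_def)
qed (use assms in \<open>simp_all add: companion_block_def\<close>)

text \<open>Split the tuple at index 1 and write the product as \<open>(W \<oplus> x) M\<^sub>1 (Y \<oplus> y)\<close>. The order of 0 and 1
  only decides which of \<open>x\<close> and \<open>y\<close> is \<open>S\<close> and which is the identity; in both cases \<open>y x = S\<close>. Because \<open>M\<^sub>1\<close> has a zero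
  corner, the last diagonal block of the pencil is an identity, and its Schur complement is the
  smaller pencil, with \<open>- A\<^sub>1 + u S\<close> as the new \<open>S\<close>.\<close>

lemma (in coeff_ring) peel_bottom:
  assumes u: "u \<in> R"
    and S: "S \<in> carrier_mat n n" "entries_in R S"
    and As: "\<And>i. 0 < i \<Longrightarrow> i \<le> Suc (Suc k) \<Longrightarrow> As i \<in> carrier_mat n n \<and> entries_in R (As i)"
    and \<sigma>: "distinct \<sigma>" "set \<sigma> = {..Suc k}"
  shows "gl_equiv (Suc (Suc k) * n) 0 (rev_pencil n (Suc (Suc k)) u S As \<sigma>)
    (rev_pencil n (Suc k) u (u \<cdot>\<^sub>m S - As 1) (\<lambda>i. As (Suc i)) (shift_down \<sigma>) \<oplus>\<^sub>m 1\<^sub>m n)"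
proof -
  define S' where "S' = u \<cdot>\<^sub>m S - As 1"
  have As1: "As 1 \<in> carrier_mat n n" using As[of 1] by simp
  have S': "S' \<in> carrier_mat n n" using As1 S by (auto simp: S'_def)
  define q where "q = k * n"
  define N where "N = q + n"
  have NK: "Suc k * n = N" "Suc (Suc k) * n = N + n" by (auto simp: N_def q_def)
  have "1 \<in> set \<sigma>" unfolding \<sigma>(2) by simp
  then obtain \<alpha> \<beta> where ab: "\<sigma> = \<alpha> @ 1 # \<beta>" by (meson split_list)
  have sub: "set \<alpha> \<subseteq> {..Suc k} - {1}" "set \<beta> \<subseteq> {..Suc k} - {1}" "distinct \<alpha>" "distinct \<beta>"
    using \<sigma> unfolding ab by auto
  let ?F = "fiedler_mat n 0 (Suc (Suc k)) S As" and ?F' = "fiedler_mat n 0 (Suc k) S' (\<lambda>i. As (Suc i))"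
  define W where "W = mprod N ?F' (shift_down \<alpha>)"
  define Y where "Y = mprod N ?F' (shift_down \<beta>)"
  define x where "x = (if 0 \<in> set \<alpha> then S else 1\<^sub>m n)"
  define y where "y = (if 0 \<in> set \<beta> then S else 1\<^sub>m n)"
  have F: "?F i \<in> carrier_mat (N + n) (N + n)" if "i \<le> Suc k" for i
    unfolding NK(2)[symmetric] using fiedler_mat_carrier[of S n 0 i "Suc (Suc k)" As] S As that by (simp del: mult_Suc)
  have F': "?F' i \<in> carrier_mat N N" if "i \<le> k" for i
    unfolding NK[symmetric] using fiedler_mat_carrier[of S' n 0 i "Suc k" "\<lambda>i. As (Suc i)"] S' As that by (simp del: mult_Suc)
  have F'R: "entries_in R (?F' i)" if "0 < i" "i \<le> k" for i
  proof -
    have "?F' i = 1\<^sub>m ((Suc k - i - 1) * n) \<oplus>\<^sub>m companion_block (As (Suc i)) \<oplus>\<^sub>m 1\<^sub>m ((i - 1) * n + 0)"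
      using that by (simp add: fiedler_mat_def)
    moreover have "As (Suc i) \<in> carrier_mat n n" "entries_in R (As (Suc i))" using As[of "Suc i"] that by auto
    ultimately show ?thesis by (auto simp: companion_block_def intro!: entries_simps entries_four_block)
  qed
  have sd: "set (shift_down \<alpha>) \<subseteq> {1..k}" "set (shift_down \<beta>) \<subseteq> {1..k}"
    using sub by (force simp: shift_down_def)+
  have W: "W \<in> carrier_mat N N" "entries_in R W" unfolding W_def
    using sd(1) F' F'R by (force intro!: mprod_carrier entries_mprod)+
  have Y: "Y \<in> carrier_mat N N" "entries_in R Y" unfolding Y_def
    using sd(2) F' F'R by (force intro!: mprod_carrier entries_mprod)+
  have xy: "x \<in> carrier_mat n n" "y \<in> carrier_mat n n" "entries_in R x" "entries_in R y"
    using S by (auto simp: x_def y_def entries_simps)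
  have yx: "y * x = S"
  proof -
    have "0 \<in> set \<sigma>" unfolding \<sigma>(2) by simp
    then show ?thesis using \<sigma>(1) S unfolding ab x_def y_def by auto
  qed
  note d[simp] = carrier_matD[OF W(1)] carrier_matD[OF Y(1)]
    carrier_matD[OF xy(1)] carrier_matD[OF xy(2)]
    As1[THEN carrier_matD(1), unfolded One_nat_def] As1[THEN carrier_matD(2), unfolded One_nat_def] carrier_matD[OF S(1)]
  have pa: "mprod (N + n) ?F \<alpha> = W \<oplus>\<^sub>m x"
    unfolding W_def x_def NK(1)[symmetric] using As sub S S' by (intro mprod_without_one) auto
  have pb: "mprod (N + n) ?F \<beta> = Y \<oplus>\<^sub>m y"
    unfolding Y_def y_def NK(1)[symmetric] using As sub S S' by (intro mprod_without_one) auto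
  let ?e = "bot_incl q n :: 'a mat" and ?f = "(bot_incl q n)\<^sup>T :: 'a mat"
  define G where "G = 1\<^sub>m q \<oplus>\<^sub>m (- As 1)"
  have dG[simp]: "dim_row G = N" "dim_col G = N" by (auto simp: G_def N_def)
  have de[simp]: "dim_row ?e = N" "dim_col ?e = n" by (auto simp: N_def)
  have F1: "?F 1 = four_block_mat G ?e ?f (0\<^sub>m n n)"
    unfolding G_def dsum_companion_block[OF As1, symmetric] by (simp add: fiedler_mat_def q_def)
  have "mprod (N + n) ?F \<sigma> = mprod (N + n) ?F \<alpha> * mprod (N + n) ?F (1 # \<beta>)"
    unfolding ab by (rule mprod_append) (use sub in \<open>auto intro!: F\<close>)
  also have "\<dots> = (W \<oplus>\<^sub>m x) * (four_block_mat G ?e ?f (0\<^sub>m n n) * (Y \<oplus>\<^sub>m y))"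
    by (simp only: mprod_simps pa pb F1)
  also have "\<dots> = four_block_mat (W * (G * Y)) (W * (?e * y)) (x * (?f * Y)) (0\<^sub>m n n)"
    unfolding dsum_def by (simp add: four_block_mult_dim mat_ring_simps del: incl_dim)
  finally have P: "mprod (N + n) ?F \<sigma> = four_block_mat (W * (G * Y)) (W * (?e * y)) (x * (?f * Y)) (0\<^sub>m n n)" .
  define M where "M = As (Suc (Suc k)) \<oplus>\<^sub>m 1\<^sub>m q"
  have M: "M \<in> carrier_mat N N" unfolding M_def N_def using As[of "Suc (Suc k)"] by (auto simp: add.commute)
  note dM[simp] = carrier_matD[OF M]
  let ?B = "- u \<cdot>\<^sub>m (W * (?e * y))" and ?C = "- u \<cdot>\<^sub>m (x * (?f * Y))" and ?M = "M - u \<cdot>\<^sub>m (W * (G * Y))"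
  have Re: "entries_in R ?e" "entries_in R ?f"
    by (auto simp: entries_in_def incl_def zero_in one_in)
  have X: "rev_pencil n (Suc (Suc k)) u S As \<sigma> = four_block_mat ?M ?B ?C (1\<^sub>m n)"
  proof -
    have "As (Suc (Suc k)) \<oplus>\<^sub>m 1\<^sub>m ((Suc (Suc k) - 1) * n) = four_block_mat M (0\<^sub>m N n) (0\<^sub>m n N) (1\<^sub>m n)"
    proof -
      have "four_block_mat M (0\<^sub>m N n) (0\<^sub>m n N) (1\<^sub>m n) = M \<oplus>\<^sub>m 1\<^sub>m n" by (simp add: dsum_def)
      also have "\<dots> = As (Suc (Suc k)) \<oplus>\<^sub>m 1\<^sub>m (q + n)" by (simp add: M_def dsum_assoc dsum_one)
      finally show ?thesis by (simp add: q_def add.commute)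
    qed
    then show ?thesis unfolding rev_pencil_def NK(2) P
      by (auto intro!: eq_matI simp del: index_mult_mat(1) incl_dim)
  qed
  have "gl_equiv (N + n) 0 (rev_pencil n (Suc (Suc k)) u S As \<sigma>) ((?M - ?B * ?C) \<oplus>\<^sub>m 1\<^sub>m n)"
    unfolding X
  proof (rule four_block_schur)
    show "entries_in R ?B" by (intro entries_simps(4) uminus_in u entries_mult W Re xy) (simp_all del: incl_dim)
    show "entries_in R ?C" by (intro entries_simps(4) uminus_in u entries_mult Y Re xy) (simp_all del: incl_dim)
  qed (rule carrier_matI; simp del: incl_dim)+
  moreover have "?M - ?B * ?C = rev_pencil n (Suc k) u S' (\<lambda>i. As (Suc i)) (shift_down \<sigma>)"
  proof -
    have F'0: "?F' 0 = G + u \<cdot>\<^sub>m (?e * (S * ?f))"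
    proof -
      have "?F' 0 = 1\<^sub>m q \<oplus>\<^sub>m S'" by (simp add: fiedler_mat_def q_def)
      also have "\<dots> = G + u \<cdot>\<^sub>m (0\<^sub>m q q \<oplus>\<^sub>m S)"
        unfolding G_def S'_def by (rule eq_matI) (auto simp: dsum_index)
      finally show ?thesis by (simp only: incl_project[OF S(1), of q 0, simplified])
    qed
    have sds: "shift_down \<sigma> = shift_down \<alpha> @ 0 # shift_down \<beta>"
      using shift_down_simps(3)[of 0] by (simp add: ab shift_down_append)
    have "mprod N ?F' (shift_down \<sigma>) = W * mprod N ?F' (0 # shift_down \<beta>)"
      unfolding sds W_def by (rule mprod_append) (use sd in \<open>auto intro!: F'\<close>)
    also have "\<dots> = W * (G * Y) + u \<cdot>\<^sub>m (W * (?e * (S * (?f * Y))))"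
      by (simp add: F'0 Y_def[symmetric] mat_ring_simps del: incl_dim)
    finally have 1: "mprod N ?F' (shift_down \<sigma>) = W * (G * Y) + u \<cdot>\<^sub>m (W * (?e * (S * (?f * Y))))" .
    have 2: "?B * ?C = (u * u) \<cdot>\<^sub>m (W * (?e * (S * (?f * Y))))"
      unfolding yx[symmetric] by (simp add: mat_ring_simps del: incl_dim)
         (auto intro!: eq_matI simp del: index_mult_mat(1) incl_dim)
    show ?thesis unfolding 2 rev_pencil_def NK 1
      by (auto intro!: eq_matI simp: M_def[symmetric] q_def[symmetric] algebra_simps simp del: index_mult_mat(1) incl_dim)
  qed
  ultimately show ?thesis by (simp only: NK S'_def)
qed

lemma reversal_carrier[simp]: "reversal n u m S As \<in> carrier_mat n n"
  by (simp add: reversal_def)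

lemma reversal_peel:
  assumes "S \<in> carrier_mat n n" "As 1 \<in> carrier_mat n n"
  shows "reversal n u (Suc k) (u \<cdot>\<^sub>m S - As 1) (\<lambda>i. As (Suc i)) = reversal n u (Suc (Suc k)) S As"
proof (rule eq_matI)
  fix i j assume "i < dim_row (reversal n u (Suc (Suc k)) S As)" "j < dim_col (reversal n u (Suc (Suc k)) S As)"
  then have ij: "i < n" "j < n" by (auto simp: reversal_def)
  have "(\<Sum>t=1..Suc (Suc k). u ^ (Suc (Suc k) - t) * As t $$ (i, j)) =
    u ^ Suc k * As 1 $$ (i, j) + (\<Sum>t=2..Suc (Suc k). u ^ (Suc (Suc k) - t) * As t $$ (i, j))"
    by (subst sum.atLeast_Suc_atMost) (auto simp: numeral_2_eq_2)
  also have "(\<Sum>t=2..Suc (Suc k). u ^ (Suc (Suc k) - t) * As t $$ (i, j)) =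
     (\<Sum>t=1..Suc k. u ^ (Suc k - t) * As (Suc t) $$ (i, j))"
    unfolding numeral_2_eq_2 One_nat_def by (subst sum.shift_bounds_cl_Suc_ivl) simp
  finally show "reversal n u (Suc k) (u \<cdot>\<^sub>m S - As 1) (\<lambda>i. As (Suc i)) $$ (i, j) = reversal n u (Suc (Suc k)) S As $$ (i, j)"
    using ij assms by (simp add: reversal_def algebra_simps)
qed (auto simp: reversal_def)

lemma (in coeff_ring) rev_pencil_equivalent:
  assumes u: "u \<in> R"
    and "S \<in> carrier_mat n n" "entries_in R S"
    and "\<And>i. 0 < i \<Longrightarrow> i \<le> Suc k \<Longrightarrow> As i \<in> carrier_mat n n \<and> entries_in R (As i)"
    and "distinct \<sigma>" "set \<sigma> = {..k}"
  shows "gl_equiv (Suc k * n) 0 (rev_pencil n (Suc k) u S As \<sigma>) (reversal n u (Suc k) S As \<oplus>\<^sub>m 1\<^sub>m (k * n))"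
  using assms(2-)
proof (induction k arbitrary: S As \<sigma>)
  case 0
  have "\<sigma> = [0]" using 0 by (cases \<sigma>; cases "tl \<sigma>") auto
  have A: "As (Suc 0) \<in> carrier_mat n n" using 0 by auto
  have "rev_pencil n (Suc 0) u S As \<sigma> = reversal n u (Suc 0) S As"
    unfolding \<open>\<sigma> = [0]\<close> rev_pencil_def using A 0(1)
    by (auto intro!: eq_matI simp: fiedler_mat_def reversal_def mat_one_right_dim)
  then show ?case using gl_equiv_refl[of "reversal n u (Suc 0) S As" n 0] by simp
next
  case (Suc k)
  let ?S = "u \<cdot>\<^sub>m S - As 1" and ?A = "\<lambda>i. As (Suc i)"
  have A1: "As 1 \<in> carrier_mat n n" "entries_in R (As 1)" using Suc.prems(3)[of 1] by auto
  note A1d = A1(1)[THEN carrier_matD(1), unfolded One_nat_def] A1(1)[THEN carrier_matD(2), unfolded One_nat_def]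
  have S: "?S \<in> carrier_mat n n" "entries_in R ?S"
  proof -
    show "?S \<in> carrier_mat n n" using A1(1) Suc.prems(1) by (intro minus_carrier_mat)
    have "dim_row S = n" "dim_col S = n" using Suc.prems(1) by auto
    then show "entries_in R ?S"
      by (intro entries_simps(6) entries_simps(4) u Suc.prems(2) A1(2)) (simp_all add: A1d)
  qed
  have IH: "gl_equiv (Suc k * n) 0 (rev_pencil n (Suc k) u ?S ?A (shift_down \<sigma>)) (reversal n u (Suc k) ?S ?A \<oplus>\<^sub>m 1\<^sub>m (k * n))"
    using Suc.prems S by (intro Suc.IH shift_down_distinct shift_down_set) auto
  have "gl_equiv (Suc k * n + n) 0 (rev_pencil n (Suc k) u ?S ?A (shift_down \<sigma>) \<oplus>\<^sub>m 1\<^sub>m n) ((reversal n u (Suc k) ?S ?A \<oplus>\<^sub>m 1\<^sub>m (k * n)) \<oplus>\<^sub>m 1\<^sub>m n)"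
    by (rule gl_equiv_dsum_right[OF IH]) auto
  moreover have "(reversal n u (Suc k) ?S ?A \<oplus>\<^sub>m 1\<^sub>m (k * n)) \<oplus>\<^sub>m 1\<^sub>m n = reversal n u (Suc (Suc k)) S As \<oplus>\<^sub>m 1\<^sub>m (Suc k * n)"
    by (subst reversal_peel) (use A1 Suc.prems in \<open>auto simp: dsum_assoc dsum_one add.commute\<close>)
  ultimately have 1: "gl_equiv (Suc (Suc k) * n) 0 (rev_pencil n (Suc k) u ?S ?A (shift_down \<sigma>) \<oplus>\<^sub>m 1\<^sub>m n) (reversal n u (Suc (Suc k)) S As \<oplus>\<^sub>m 1\<^sub>m (Suc k * n))"
    by (simp add: algebra_simps)
  show ?case
  proof (rule gl_equiv_trans[OF peel_bottom 1])
    show "reversal n u (Suc (Suc k)) S As \<oplus>\<^sub>m 1\<^sub>m (Suc k * n) \<in> carrier_mat (Suc (Suc k) * n + 0) (Suc (Suc k) * n + 0)"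
      using dsum_carrier[OF reversal_carrier[of n u "Suc (Suc k)" S As] one_carrier_mat[of "Suc k * n"]] by simp
  qed (use Suc.prems u in auto)
qed

section \<open>Consecutions and inversions at 0\<close>

text \<open>For \<open>p\<close> counted from 0 this is \<open>e\<^sub>p\<^sub>+\<^sub>1 \<otimes> I\<^sub>n\<close>.\<close>

definition block_col :: "nat \<Rightarrow> nat \<Rightarrow> nat \<Rightarrow> 'a::semiring_1 mat" where
  "block_col n m p = incl (m * n) (p * n) n"

lemma block_col_dim[simp]: "dim_row (block_col n m p) = m * n" "dim_col (block_col n m p) = n"
  by (simp_all add: block_col_def)

lemma block_col_last: "block_col n (Suc k) k = bot_incl (k * n) n"
  by (simp add: block_col_def add.commute)

lemma block_index_bound: "p < m \<Longrightarrow> j < n \<Longrightarrow> p * n + j < m * (n::nat)"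
proof -
  assume "p < m" "j < n"
  then have "p * n + j < Suc p * n" by simp
  also have "\<dots> \<le> m * n" using \<open>p < m\<close> by (intro mult_le_mono) auto
  finally show ?thesis .
qed

lemma mult_block_col_index:
  fixes A :: "'a::semiring_1 mat"
  assumes "dim_col A = m * n" "p < m" "i < dim_row A" "j < n"
  shows "(A * block_col n m p) $$ (i, j) = A $$ (i, p * n + j)"
proof -
  have "p * n + n \<le> m * n" using mult_le_mono1[of "Suc p" m n] assms(2) by simp
  then show ?thesis using assms unfolding block_col_def by (subst mult_incl) auto
qed

text \<open>The identity blocks of the factor with index \<open>s + 1\<close> move block \<open>m - 1 - s\<close> up by one.\<close>

lemma fiedler_mat_block_col_step:
  assumes "Suc s < m" "As (Suc s) \<in> carrier_mat n n"
  shows "fiedler_mat n 0 m S As (Suc s) * block_col n m (m - 1 - s) = (block_col n m (m - 1 - Suc s) :: 'a::ring_1 mat)" (is "?F * _ = _")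
proof -
  define a b where "a = (m - 1 - Suc s) * n" and "b = s * n"
  have "m - 1 - s = Suc (m - 1 - Suc s)" using assms by auto
  then have a': "(m - 1 - s) * n = a + n" by (simp add: a_def)
  have F: "?F = 1\<^sub>m a \<oplus>\<^sub>m companion_block (As (Suc s)) \<oplus>\<^sub>m 1\<^sub>m b" by (simp add: fiedler_mat_def a_def b_def)
  have mn: "m * n = a + 2 * n + b"
    using mult_block_split[of "Suc s" m n] assms by (simp add: a_def b_def)
  have dF: "dim_row ?F = m * n" "dim_col ?F = m * n" using assms unfolding F mn by (auto simp: companion_block_def)
  show ?thesis
  proof (rule eq_matI)
    fix i j assume "i < dim_row (block_col n m (m - 1 - Suc s) :: 'a mat)" "j < dim_col (block_col n m (m - 1 - Suc s) :: 'a mat)"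
    then have ij: "i < m * n" "j < n" by auto
    have "(?F * block_col n m (m - 1 - s)) $$ (i, j) = ?F $$ (i, (m - 1 - s) * n + j)"
      using assms ij dF by (intro mult_block_col_index) auto
    also have "\<dots> = (if i = a + j then 1 else 0)"
      using ij assms unfolding F a' mn by (auto simp: dsum_index companion_block_def)
    finally show "(?F * block_col n m (m - 1 - s)) $$ (i, j) = (block_col n m (m - 1 - Suc s) :: 'a mat) $$ (i, j)"
      using ij by (simp add: block_col_def incl_def a_def)
  qed (use dF in auto)
qed

text \<open>The factor with index \<open>i\<close> differs from the identity in the blocks \<open>m - 1 - i\<close> and \<open>m - i\<close> only.\<close>

lemma fiedler_mat_block_col_fixed:
  assumes "0 < i" "i < m" "s < m" "i \<noteq> s" "i \<noteq> Suc s" "As i \<in> carrier_mat n n"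
  shows "fiedler_mat n 0 m S As i * block_col n m (m - 1 - s) = (block_col n m (m - 1 - s) :: 'a::ring_1 mat)" (is "?F * _ = _")
proof -
  define a b p where "a = (m - i - 1) * n" and "b = (i - 1) * n" and "p = m - 1 - s"
  have F: "?F = 1\<^sub>m a \<oplus>\<^sub>m companion_block (As i) \<oplus>\<^sub>m 1\<^sub>m b" using assms by (simp add: fiedler_mat_def a_def b_def)
  have mn: "m * n = a + 2 * n + b"
    using mult_block_split[of i m n] assms by (simp add: a_def b_def)
  have dF: "dim_row ?F = m * n" "dim_col ?F = m * n" using assms unfolding F mn by (auto simp: companion_block_def)
  have pm: "p < m" using assms by (auto simp: p_def)
  have sep: "p * n + j < a \<or> a + 2 * n \<le> p * n + j" if "j < n" for j
  proof (cases "i < s")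
    case True
    then have "p < m - i - 1" using assms by (auto simp: p_def)
    then show ?thesis using block_index_bound[of p "m - i - 1" j n] that by (simp add: a_def)
  next
    case False
    then have "(m - i - 1) + 2 \<le> p" using assms by (auto simp: p_def)
    then have "((m - i - 1) + 2) * n \<le> p * n" by (rule mult_le_mono1)
    then show ?thesis by (simp add: a_def algebra_simps)
  qed
  show ?thesis unfolding p_def[symmetric]
  proof (rule eq_matI)
    fix t j assume "t < dim_row (block_col n m p :: 'a mat)" "j < dim_col (block_col n m p :: 'a mat)"
    then have ij: "t < m * n" "j < n" by auto
    have "(?F * block_col n m p) $$ (t, j) = ?F $$ (t, p * n + j)"
      using ij dF pm by (intro mult_block_col_index) auto
    also have "\<dots> = (if t = p * n + j then 1 else 0)"
    proof -
      define c where "c = p * n + j"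
      have t: "t < a + (2 * n + b)" and c: "c < a + (2 * n + b)"
        using ij block_index_bound[OF pm ij(2)] by (auto simp: mn c_def)
      have d: "dim_row (companion_block (As i)) = 2 * n" "dim_col (companion_block (As i)) = 2 * n"
        using assms by (auto simp: companion_block_def)
      have "c < a \<or> a + 2 * n \<le> c" using sep[OF ij(2)] by (simp add: c_def)
      then have "?F $$ (t, c) = (if t = c then 1 else 0)"
      proof
        assume "c < a"
        then show ?thesis using t by (auto simp: F d dsum_index)
      next
        assume "a + 2 * n \<le> c"
        then obtain c' where c': "c = a + 2 * n + c'" by (metis le_Suc_ex)
        consider "t < a" | t' where "t = a + t'" "t' < 2 * n" | t' where "t = a + 2 * n + t'"
          using t by (metis add.assoc le_Suc_ex not_less)
        then show ?thesis by cases (use c' t c in \<open>simp_all add: F d dsum_index\<close>)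
      qed
      then show ?thesis by (simp add: c_def)
    qed
    finally show "(?F * block_col n m p) $$ (t, j) = (block_col n m p :: 'a mat) $$ (t, j)"
      using ij by (simp add: block_col_def incl_def)
  qed (use dF in auto)
qed

text \<open>The tuple is read from the right, and the counter advances whenever the next number is met.
  This is how far a block climbs under the factors of \<open>\<alpha>\<close>.\<close>

definition chain :: "nat list \<Rightarrow> nat" where
  "chain \<alpha> = foldr (\<lambda>x s. if x = Suc s then x else s) \<alpha> 0"

lemma chain_simps: "chain [] = 0" "chain (x # \<alpha>) = (if x = Suc (chain \<alpha>) then x else chain \<alpha>)"
  by (simp_all add: chain_def)

lemma chain_in: "chain \<alpha> \<in> insert 0 (set \<alpha>)"
  by (induction \<alpha>) (auto simp: chain_simps)

text \<open>Reading greedily is optimal: the counter reaches \<open>t\<close> if and only if \<open>(t, \<dots>, 1)\<close> is a subtuple.\<close>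

lemma chain_subseq: "subseq (rev [1..<Suc t]) \<alpha> \<longleftrightarrow> t \<le> chain \<alpha>"
proof (induction \<alpha> arbitrary: t)
  case Nil
  then show ?case by (cases t) (auto simp: chain_simps)
next
  case (Cons x \<alpha>)
  show ?case
  proof (cases t)
    case (Suc t')
    have "rev [1..<Suc t] = t # rev [1..<Suc t']" using Suc by simp
    then have "subseq (rev [1..<Suc t]) (x # \<alpha>) \<longleftrightarrow> (if t = x then t' \<le> chain \<alpha> else t \<le> chain \<alpha>)"
      using Cons.IH[of t] Cons.IH[of t'] by simp
    then show ?thesis using Suc by (auto simp: chain_simps)
  qed simp
qed

lemma subseq_last_unique:
  assumes "z \<notin> set \<beta>"
  shows "subseq (xs @ [z]) (\<alpha> @ z # \<beta>) \<longleftrightarrow> subseq xs \<alpha>"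
proof (induction \<alpha> arbitrary: xs)
  case Nil
  have no: "\<not> subseq (ys @ [z]) \<beta>" for ys
  proof
    assume "subseq (ys @ [z]) \<beta>"
    then obtain y where "y \<in> set \<beta>" "z = y" by (rule list_emb_set[where x = z]) simp_all
    then show False using assms by simp
  qed
  show ?case
  proof (cases xs)
    case (Cons y ys)
    then show ?thesis using no[of ys] no[of "y # ys"] by (cases "y = z") simp_all
  qed simp
next
  case (Cons a \<alpha>)
  show ?case
  proof (cases xs)
    case Nil
    then show ?thesis by (simp add: subseq_singleton_left)
  next
    case (Cons y ys)
    then show ?thesis using Cons.IH[of ys] Cons.IH[of xs] by (cases "y = a") simp_all
  qed
qed

lemma i0_chain:
  assumes "0 \<notin> set \<beta>"
  shows "i0 (\<alpha> @ 0 # \<beta>) = chain \<alpha>"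
proof -
  have *: "subseq (rev [0..<Suc t]) (\<alpha> @ 0 # \<beta>) \<longleftrightarrow> t \<le> chain \<alpha>" for t
  proof -
    have "rev [0..<Suc t] = rev [1..<Suc t] @ [0]" by (simp add: upt_conv_Cons)
    then show ?thesis using subseq_last_unique[OF assms] chain_subseq by simp
  qed
  show ?thesis unfolding i0_def using *[of "Suc _"] * by (intro the_equality) (auto simp del: upt_Suc)
qed

text \<open>Reversal of the tuple exchanges the two numbers, which reduces statements on block rows to
  statements on block columns of the transpose.\<close>

lemma c0_i0: "c0 \<sigma> = i0 (rev \<sigma>)"
proof -
  have *: "subseq (rev xs) (rev ys)" if "subseq xs ys" for xs ys :: "nat list"
    using that by (induction rule: list_emb.induct) auto
  have "subseq xs \<sigma> = subseq (rev xs) (rev \<sigma>)" for xs using *[of xs \<sigma>] *[of "rev xs" "rev \<sigma>"] by auto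
  then show ?thesis unfolding c0_def i0_def by presburger
qed

text \<open>A block that has climbed by \<open>s > 0\<close> steps has used up the index \<open>s\<close>; as indices do not repeat, the
  block is moved by index \<open>s + 1\<close> only.\<close>

lemma mprod_block_col:
  fixes As :: "nat \<Rightarrow> 'a::ring_1 mat"
  assumes "distinct \<alpha>" "set \<alpha> \<subseteq> {0<..<m}" "0 < m" "\<And>i. 0 < i \<Longrightarrow> i < m \<Longrightarrow> As i \<in> carrier_mat n n"
    and S: "S \<in> carrier_mat n n"
  shows "mprod (m * n) (fiedler_mat n 0 m S As) \<alpha> * block_col n m (m - 1) = block_col n m (m - 1 - chain \<alpha>)"
  using assms(1,2)
proof (induction \<alpha>)
  case Nil
  then show ?case by (simp add: chain_simps mat_one_left_dim)
next
  case (Cons x \<alpha>)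
  have c: "fiedler_mat n 0 m S As i \<in> carrier_mat (m * n) (m * n)" if "i \<in> set (x # \<alpha>)" for i
    using fiedler_mat_carrier[of S n 0 i m As] that Cons.prems S assms(4) by auto
  have c2: "mprod (m * n) (fiedler_mat n 0 m S As) \<alpha> \<in> carrier_mat (m * n) (m * n)"
    using c by (intro mprod_carrier) auto
  have "mprod (m * n) (fiedler_mat n 0 m S As) (x # \<alpha>) * block_col n m (m - 1) =
      fiedler_mat n 0 m S As x * block_col n m (m - 1 - chain \<alpha>)"
    using c[of x] carrier_matD[OF c2] Cons by (auto simp: mat_assoc_dim)
  also have "\<dots> = block_col n m (m - 1 - chain (x # \<alpha>))"
  proof (cases "x = Suc (chain \<alpha>)")
    case True
    then show ?thesis using Cons.prems assms(4)[of x] fiedler_mat_block_col_step[of "chain \<alpha>" m As n S] by (auto simp: chain_simps)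
  next
    case False
    have "chain \<alpha> < m" "x \<noteq> chain \<alpha>" using chain_in[of \<alpha>] Cons.prems assms(3) by auto
    then show ?thesis using False Cons.prems assms(4)[of x] fiedler_mat_block_col_fixed[of x m "chain \<alpha>" As n S] by (auto simp: chain_simps)
  qed
  finally show ?case .
qed

lemma mprod_block_col_transpose:
  fixes As :: "nat \<Rightarrow> 'a::comm_ring_1 mat"
  assumes "distinct \<beta>" "set \<beta> \<subseteq> {0<..<m}" "0 < m" and As: "\<And>i. 0 < i \<Longrightarrow> i < m \<Longrightarrow> As i \<in> carrier_mat n n"
    and S: "S \<in> carrier_mat n n"
  shows "(block_col n m (m - 1))\<^sup>T * mprod (m * n) (fiedler_mat n 0 m S As) \<beta> = (block_col n m (m - 1 - chain (rev \<beta>)))\<^sup>T"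
proof -
  let ?F = "\<lambda>S As. fiedler_mat n 0 m S As" and ?N = "m * n"
  have c: "fiedler_mat n 0 m S As i \<in> carrier_mat ?N ?N" if "i \<in> set \<beta>" for i
    using fiedler_mat_carrier[of S n 0 i m As] that assms(2) S As by auto
  have "mprod ?N (?F S\<^sup>T (\<lambda>i. (As i)\<^sup>T)) (rev \<beta>) = mprod ?N (\<lambda>i. (?F S As i)\<^sup>T) (rev \<beta>)"
    using assms(2) As by (intro mprod_cong) (auto simp: fiedler_mat_transpose)
  then have T: "(mprod ?N (?F S As) \<beta>)\<^sup>T = mprod ?N (?F S\<^sup>T (\<lambda>i. (As i)\<^sup>T)) (rev \<beta>)"
    using mprod_transpose[OF c] by simp
  have cM: "mprod ?N (?F S As) \<beta> \<in> carrier_mat ?N ?N" using c by (rule mprod_carrier)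
  have "(block_col n m (m - 1))\<^sup>T * mprod ?N (?F S As) \<beta> = ((mprod ?N (?F S As) \<beta>)\<^sup>T * block_col n m (m - 1))\<^sup>T"
    by (subst transpose_mult[of _ ?N ?N _ n]) (use cM in \<open>auto intro: carrier_matI\<close>)
  also have "\<dots> = (block_col n m (m - 1 - chain (rev \<beta>)))\<^sup>T"
    unfolding T by (subst mprod_block_col) (use assms in auto)
  finally show ?thesis .
qed

lemma split_at_zero:
  assumes "distinct \<sigma>" "set \<sigma> = {..k}"
  obtains \<alpha> \<beta> where "\<sigma> = \<alpha> @ 0 # \<beta>" "distinct \<alpha>" "distinct \<beta>" "set \<alpha> \<subseteq> {0<..<Suc k}" "set \<beta> \<subseteq> {0<..<Suc k}"
    "i0 \<sigma> = chain \<alpha>" "c0 \<sigma> = chain (rev \<beta>)"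
proof -
  have "0 \<in> set \<sigma>" using assms(2) by simp
  then obtain \<alpha> \<beta> where ab: "\<sigma> = \<alpha> @ 0 # \<beta>" by (meson split_list)
  have sub: "set \<alpha> \<subseteq> {0<..<Suc k}" "set \<beta> \<subseteq> {0<..<Suc k}" "distinct \<alpha>" "distinct \<beta>"
    using assms unfolding ab by (auto simp: less_Suc_eq_le intro: ccontr)
  have nz: "0 \<notin> set \<alpha>" "0 \<notin> set \<beta>" using sub by auto
  have "i0 \<sigma> = chain \<alpha>" unfolding ab using nz(2) by (rule i0_chain)
  moreover have "c0 \<sigma> = chain (rev \<beta>)" unfolding ab c0_i0 using i0_chain[of "rev \<alpha>" "rev \<beta>"] nz by simp
  ultimately show ?thesis using that[OF ab] sub by blast
qed

lemma mprod_split_at_zero: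
  fixes F :: "nat \<Rightarrow> 'a::ring_1 mat"
  assumes "\<And>i. i \<in> set (\<alpha> @ 0 # \<beta>) \<Longrightarrow> F i \<in> carrier_mat k k"
  shows "mprod k F (\<alpha> @ 0 # \<beta>) = mprod k F \<alpha> * (F 0 * mprod k F \<beta>)"
  using assms by (subst mprod_append) auto

text \<open>The perturbation of the factor with index 0 is \<open>e\<^sub>m X e\<^sub>m\<^sup>T\<close>, up to Kronecker products with \<open>I\<^sub>n\<close>.
  The factors on its left act on \<open>e\<^sub>m\<close>, those on its right on \<open>e\<^sub>m\<^sup>T\<close>.\<close>

lemma fiedler_product_update:
  fixes As :: "nat \<Rightarrow> 'a::comm_ring_1 mat"
  assumes \<sigma>: "distinct \<sigma>" "set \<sigma> = {..k}" and As: "\<And>i. 0 < i \<Longrightarrow> i \<le> k \<Longrightarrow> As i \<in> carrier_mat n n"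
    and S: "S \<in> carrier_mat n n" and X: "X \<in> carrier_mat n n"
  shows "mprod (Suc k * n) (fiedler_mat n 0 (Suc k) (S + X) As) \<sigma> = mprod (Suc k * n) (fiedler_mat n 0 (Suc k) S As) \<sigma>
     + block_col n (Suc k) (k - i0 \<sigma>) * X * (block_col n (Suc k) (k - c0 \<sigma>))\<^sup>T"
proof -
  define N where "N = Suc k * n"
  let ?F = "\<lambda>S. fiedler_mat n 0 (Suc k) S As"
  obtain \<alpha> \<beta> where ab: "\<sigma> = \<alpha> @ 0 # \<beta>"
    and sub: "distinct \<alpha>" "distinct \<beta>" "set \<alpha> \<subseteq> {0<..<Suc k}" "set \<beta> \<subseteq> {0<..<Suc k}"
    and i0: "i0 \<sigma> = chain \<alpha>" and c0: "c0 \<sigma> = chain (rev \<beta>)"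
    using split_at_zero[OF \<sigma>] .
  have F: "?F T i \<in> carrier_mat N N" if "i \<le> k" "T \<in> carrier_mat n n" for T i
    using fiedler_mat_carrier[of T n 0 i "Suc k" As] that As by (simp add: N_def del: mult_Suc)
  have nz: "mprod N (?F T) \<alpha> = mprod N (?F S) \<alpha>" "mprod N (?F T) \<beta> = mprod N (?F S) \<beta>" for T
    using sub by (auto intro!: mprod_cong simp: fiedler_mat_def)
  have cc: "mprod N (?F S) \<alpha> \<in> carrier_mat N N" "mprod N (?F S) \<beta> \<in> carrier_mat N N"
    using sub S by (force intro!: mprod_carrier F)+
  note d[simp] = cc[THEN carrier_matD(1)] cc[THEN carrier_matD(2)] S[THEN carrier_matD(1)] S[THEN carrier_matD(2)] X[THEN carrier_matD(1)] X[THEN carrier_matD(2)]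
  let ?e = "block_col n (Suc k) k :: 'a mat"
  have P: "mprod N (?F T) \<sigma> = mprod N (?F S) \<alpha> * (?F T 0 * mprod N (?F S) \<beta>)" if "T \<in> carrier_mat n n" for T
  proof -
    have "mprod N (?F T) \<sigma> = mprod N (?F T) \<alpha> * (?F T 0 * mprod N (?F T) \<beta>)"
      unfolding ab using \<sigma>(2) that by (intro mprod_split_at_zero F) (auto simp: ab)
    then show ?thesis by (simp only: nz[of T])
  qed
  have F0: "?F (S + X) 0 = ?F S 0 + ?e * (X * ?e\<^sup>T)"
    unfolding block_col_last incl_project[OF X, of "k * n" 0, simplified] using S X by (auto intro!: eq_matI simp: fiedler_mat_def dsum_index)
  have dF: "dim_row (?F S 0) = N" "dim_col (?F S 0) = N" using F[of 0 S] S by auto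
  have de: "dim_row ?e = N" by (simp add: N_def)
  have "mprod N (?F (S + X)) \<sigma> = mprod N (?F S) \<alpha> * ((?F S 0 + ?e * (X * ?e\<^sup>T)) * mprod N (?F S) \<beta>)"
    using S X by (simp add: P F0)
  also have "\<dots> = mprod N (?F S) \<alpha> * (?F S 0 * mprod N (?F S) \<beta>) + (mprod N (?F S) \<alpha> * ?e) * X * (?e\<^sup>T * mprod N (?F S) \<beta>)"
    by (simp add: mat_ring_simps dF de del: block_col_dim(1))
  also have "mprod N (?F S) \<alpha> * ?e = block_col n (Suc k) (k - i0 \<sigma>)"
    unfolding i0 N_def using mprod_block_col[of \<alpha> "Suc k" As n S] sub As S by auto
  also have "?e\<^sup>T * mprod N (?F S) \<beta> = (block_col n (Suc k) (k - c0 \<sigma>))\<^sup>T"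
    unfolding c0 N_def using mprod_block_col_transpose[of \<beta> "Suc k" As n S] sub As S by auto
  finally show ?thesis using P[OF S] by (simp add: N_def)
qed

lemma fiedler_mat_zero_blocks:
  fixes S11 :: "'a::comm_ring_1 mat"
  assumes S: "S11 \<in> carrier_mat n n" "S12 \<in> carrier_mat n r" "S21 \<in> carrier_mat r n" "S22 \<in> carrier_mat r r"
  shows "fiedler_mat n r (Suc k) (four_block_mat S11 S12 S21 S22) As 0 =
    four_block_mat (fiedler_mat n 0 (Suc k) S11 As 0) (block_col n (Suc k) k * S12) (S21 * (block_col n (Suc k) k)\<^sup>T) S22"
proof -
  let ?e = "block_col n (Suc k) k :: 'a mat"
  note d[simp] = S[THEN carrier_matD(1)] S[THEN carrier_matD(2)]
  have eT: "S21 * ?e\<^sup>T = (?e * S21\<^sup>T)\<^sup>T"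
  proof -
    have "?e \<in> carrier_mat (Suc k * n) n" by (rule carrier_matI) simp_all
    moreover have "S21\<^sup>T \<in> carrier_mat n r" using S(3) by simp
    ultimately show ?thesis by (simp add: transpose_mult)
  qed
  have "fiedler_mat n r (Suc k) (four_block_mat S11 S12 S21 S22) As 0 = 1\<^sub>m (k * n) \<oplus>\<^sub>m four_block_mat S11 S12 S21 S22"
    "fiedler_mat n 0 (Suc k) S11 As 0 = 1\<^sub>m (k * n) \<oplus>\<^sub>m S11" by (simp_all add: fiedler_mat_def)
  moreover have "?e * M = mat (k * n + n) r (\<lambda>(i, j). if k * n \<le> i \<and> i < k * n + n then M $$ (i - k * n, j) else 0)"
    if "M \<in> carrier_mat n r" for M
    using that unfolding block_col_last by (subst incl_mult) auto
  from this[OF S(2)] this[of "S21\<^sup>T"] S(3) have "?e * S12 = mat (k * n + n) r (\<lambda>(i, j). if k * n \<le> i \<and> i < k * n + n then S12 $$ (i - k * n, j) else 0)"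
    "?e * S21\<^sup>T = mat (k * n + n) r (\<lambda>(i, j). if k * n \<le> i \<and> i < k * n + n then S21\<^sup>T $$ (i - k * n, j) else 0)"
    by auto
  ultimately show ?thesis
    unfolding eT by (simp only:) (rule eq_matI, auto simp: dsum_index)
qed

text \<open>Only index 0 involves the state coordinates, so the coupling blocks are carried along by the
  remaining factors in the same way.\<close>

lemma fiedler_product_system:
  fixes As :: "nat \<Rightarrow> 'a::comm_ring_1 mat"
  assumes \<sigma>: "distinct \<sigma>" "set \<sigma> = {..k}" and As: "\<And>i. 0 < i \<Longrightarrow> i \<le> k \<Longrightarrow> As i \<in> carrier_mat n n"
    and S: "S11 \<in> carrier_mat n n" "S12 \<in> carrier_mat n r" "S21 \<in> carrier_mat r n" "S22 \<in> carrier_mat r r"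
  shows "mprod (Suc k * n + r) (fiedler_mat n r (Suc k) (four_block_mat S11 S12 S21 S22) As) \<sigma> =
    four_block_mat (mprod (Suc k * n) (fiedler_mat n 0 (Suc k) S11 As) \<sigma>) (block_col n (Suc k) (k - i0 \<sigma>) * S12)
      (S21 * (block_col n (Suc k) (k - c0 \<sigma>))\<^sup>T) S22"
proof -
  define N where "N = Suc k * n"
  define Z where "Z = four_block_mat S11 S12 S21 S22"
  have Z: "Z \<in> carrier_mat (n + r) (n + r)" using S by (auto simp: Z_def)
  let ?F = "fiedler_mat n 0 (Suc k) S11 As" and ?G = "fiedler_mat n r (Suc k) Z As"
  obtain \<alpha> \<beta> where ab: "\<sigma> = \<alpha> @ 0 # \<beta>"
    and sub: "distinct \<alpha>" "distinct \<beta>" "set \<alpha> \<subseteq> {0<..<Suc k}" "set \<beta> \<subseteq> {0<..<Suc k}"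
    and i0: "i0 \<sigma> = chain \<alpha>" and c0: "c0 \<sigma> = chain (rev \<beta>)"
    using split_at_zero[OF \<sigma>] .
  have F: "?F i \<in> carrier_mat N N" if "i \<le> k" for i
    using fiedler_mat_carrier[of S11 n 0 i "Suc k" As] that As S by (simp add: N_def del: mult_Suc)
  have G: "?G i \<in> carrier_mat (N + r) (N + r)" if "i \<le> k" for i
    unfolding N_def using that As Z by (intro fiedler_mat_carrier) auto
  have GF: "mprod (N + r) ?G \<tau> = mprod N ?F \<tau> \<oplus>\<^sub>m 1\<^sub>m r" if "set \<tau> \<subseteq> {0<..<Suc k}" for \<tau>
    using that by (subst mprod_dsum_right[symmetric]) (auto intro!: F mprod_cong fiedler_mat_system dest: subsetD)
  have cc: "mprod N ?F \<alpha> \<in> carrier_mat N N" "mprod N ?F \<beta> \<in> carrier_mat N N"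
    using sub S by (force intro!: mprod_carrier F)+
  note d[simp] = cc[THEN carrier_matD(1)] cc[THEN carrier_matD(2)] S[THEN carrier_matD(1)] S[THEN carrier_matD(2)]
  let ?e = "block_col n (Suc k) k :: 'a mat"
  have de: "dim_row ?e = N" by (simp add: N_def)
  have dF: "dim_row (?F 0) = N" "dim_col (?F 0) = N" using F[of 0] by auto
  have G0: "?G 0 = four_block_mat (?F 0) (?e * S12) (S21 * ?e\<^sup>T) S22"
    unfolding Z_def using S by (rule fiedler_mat_zero_blocks)
  have "mprod (N + r) ?G \<sigma> = mprod (N + r) ?G \<alpha> * (?G 0 * mprod (N + r) ?G \<beta>)"
    unfolding ab using \<sigma>(2) by (intro mprod_split_at_zero G) (auto simp: ab)
  also have "\<dots> = (mprod N ?F \<alpha> \<oplus>\<^sub>m 1\<^sub>m r) * (?G 0 * (mprod N ?F \<beta> \<oplus>\<^sub>m 1\<^sub>m r))"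
    by (simp only: GF[OF sub(3)] GF[OF sub(4)])
  also have "\<dots> = four_block_mat (mprod N ?F \<alpha> * (?F 0 * mprod N ?F \<beta>)) ((mprod N ?F \<alpha> * ?e) * S12)
       (S21 * (?e\<^sup>T * mprod N ?F \<beta>)) S22"
    unfolding G0 dsum_def by (simp add: four_block_mult_dim mat_ring_simps dF de del: block_col_dim(1))
  also have "mprod N ?F \<alpha> * (?F 0 * mprod N ?F \<beta>) = mprod N ?F \<sigma>"
    unfolding ab using \<sigma>(2) by (intro mprod_split_at_zero[symmetric] F) (auto simp: ab)
  also have "mprod N ?F \<alpha> * ?e = block_col n (Suc k) (k - i0 \<sigma>)"
    unfolding i0 N_def using mprod_block_col[of \<alpha> "Suc k" As n S11] sub As S by auto
  also have "?e\<^sup>T * mprod N ?F \<beta> = (block_col n (Suc k) (k - c0 \<sigma>))\<^sup>T"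
    unfolding c0 N_def using mprod_block_col_transpose[of \<beta> "Suc k" As n S11] sub As S by auto
  finally show ?thesis unfolding N_def Z_def .
qed

section \<open>Proper rational functions\<close>

lemma eventually_poly_nonzero:
  fixes q :: "complex poly"
  assumes "q \<noteq> 0"
  shows "eventually (\<lambda>z. poly q z \<noteq> 0) at_infinity"
proof -
  let ?R = "{z. poly q z = 0}"
  have fin: "finite ?R" using assms by (rule poly_roots_finite)
  define b where "b = Max (insert 0 (norm ` ?R)) + 1"
  have "poly q z \<noteq> 0" if "b \<le> norm z" for z
  proof
    assume "poly q z = 0"
    then have "norm z \<le> Max (insert 0 (norm ` ?R))" using fin by (intro Max_ge) auto
    then show False using that by (simp add: b_def)
  qed
  then show ?thesis unfolding eventually_at_infinity by blast
qed

text \<open>Two representations of a fraction agree wherever both denominators are nonzero, in particular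
  near infinity, so the limit can be read off from any of them.\<close>

lemma has_limit_Fract:
  assumes "q \<noteq> 0"
  shows "has_limit_at_infinity (Fract p q) l \<longleftrightarrow> ((\<lambda>z. poly p z / poly q z) \<longlongrightarrow> l) at_infinity"
proof
  assume "has_limit_at_infinity (Fract p q) l"
  then obtain p' q' where *: "q' \<noteq> 0" "Fract p q = Fract p' q'" "((\<lambda>z. poly p' z / poly q' z) \<longlongrightarrow> l) at_infinity"
    by (auto simp: has_limit_at_infinity_def)
  have "p * q' = p' * q" using *(1,2) assms by (simp add: eq_fract)
  then have pe: "poly p z * poly q' z = poly p' z * poly q z" for z
    by (metis poly_mult)
  have "eventually (\<lambda>z. poly p' z / poly q' z = poly p z / poly q z) at_infinity"
    using eventually_poly_nonzero[OF assms] eventually_poly_nonzero[OF *(1)]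
    by eventually_elim (use pe in \<open>simp add: field_simps\<close>)
  from Lim_transform_eventually[OF *(3) this] show "((\<lambda>z. poly p z / poly q z) \<longlongrightarrow> l) at_infinity" .
qed (use assms in \<open>auto simp: has_limit_at_infinity_def\<close>)

lemma has_limit_unique:
  assumes "has_limit_at_infinity f l" "has_limit_at_infinity f k" shows "l = k"
proof -
  obtain p q where "q \<noteq> 0" "f = Fract p q" using assms(1) by (auto simp: has_limit_at_infinity_def)
  moreover have "(at_infinity :: complex filter) \<noteq> bot"
  proof
    assume "(at_infinity :: complex filter) = bot"
    then have "eventually (\<lambda>z :: complex. False) at_infinity" by simp
    then obtain b where "\<forall>z :: complex. b \<le> norm z \<longrightarrow> False" unfolding eventually_at_infinity by blast
    then have "\<not> b \<le> cmod (complex_of_real \<bar>b\<bar>)" by blast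
    then show False by simp
  qed
  ultimately show ?thesis using assms tendsto_unique by (auto simp: has_limit_Fract)
qed

lemma has_limit_add:
  assumes "has_limit_at_infinity f l" "has_limit_at_infinity g k" shows "has_limit_at_infinity (f + g) (l + k)"
proof -
  obtain p q p' q' where q: "q \<noteq> 0" "q' \<noteq> 0" and fg: "f = Fract p q" "g = Fract p' q'"
    and lims: "((\<lambda>z. poly p z / poly q z) \<longlongrightarrow> l) at_infinity" "((\<lambda>z. poly p' z / poly q' z) \<longlongrightarrow> k) at_infinity"
    using assms by (auto simp: has_limit_at_infinity_def)
  have s: "f + g = Fract (p * q' + p' * q) (q * q')" using q by (simp add: fg)
  have "eventually (\<lambda>z. poly p z / poly q z + poly p' z / poly q' z = poly (p * q' + p' * q) z / poly (q * q') z) at_infinity"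
    using eventually_poly_nonzero[OF q(1)] eventually_poly_nonzero[OF q(2)]
    by eventually_elim (simp add: field_simps)
  from Lim_transform_eventually[OF tendsto_add[OF lims] this] show ?thesis
    unfolding s using q by (subst has_limit_Fract) auto
qed

lemma has_limit_mult:
  assumes "has_limit_at_infinity f l" "has_limit_at_infinity g k" shows "has_limit_at_infinity (f * g) (l * k)"
proof -
  obtain p q p' q' where q: "q \<noteq> 0" "q' \<noteq> 0" and fg: "f = Fract p q" "g = Fract p' q'"
    and lims: "((\<lambda>z. poly p z / poly q z) \<longlongrightarrow> l) at_infinity" "((\<lambda>z. poly p' z / poly q' z) \<longlongrightarrow> k) at_infinity"
    using assms by (auto simp: has_limit_at_infinity_def)
  have s: "f * g = Fract (p * p') (q * q')" using q by (simp add: fg)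
  show ?thesis unfolding s using q tendsto_mult[OF lims] by (subst has_limit_Fract) auto
qed

lemma has_limit_const: "has_limit_at_infinity (to_fract [:c:]) c"
  unfolding to_fract_def by (subst has_limit_Fract) auto

lemma has_limit_0: "has_limit_at_infinity 0 0" using has_limit_const[of 0] by simp
lemma has_limit_1: "has_limit_at_infinity 1 1" using has_limit_const[of 1] by (simp add: pCons_one)

lemma has_limit_uminus: "has_limit_at_infinity f l \<Longrightarrow> has_limit_at_infinity (- f) (- l)"
proof -
  assume "has_limit_at_infinity f l"
  moreover have "has_limit_at_infinity (- 1) (- 1)"
  proof -
    have "to_fract [:- 1:] = (- 1 :: complex poly fract)"
      by (metis to_fract_uminus to_fract_1 one_pCons minus_pCons minus_zero)
    then show ?thesis using has_limit_const[of "- 1"] by simp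
  qed
  ultimately show ?thesis using has_limit_mult[of "- 1" "- 1" f l] by simp
qed

lemma has_limit_sum: "(\<And>i. i \<in> I \<Longrightarrow> has_limit_at_infinity (f i) (l i)) \<Longrightarrow> has_limit_at_infinity (sum f I) (sum l I)"
  by (induction I rule: infinite_finite_induct) (auto intro: has_limit_0 has_limit_add)

lemma has_limit_prod: "(\<And>i. i \<in> I \<Longrightarrow> has_limit_at_infinity (f i) (l i)) \<Longrightarrow> has_limit_at_infinity (prod f I) (prod l I)"
  by (induction I rule: infinite_finite_induct) (auto intro: has_limit_1 has_limit_mult)

lemma has_limit_inverse:
  assumes "has_limit_at_infinity f l" "l \<noteq> 0"
  shows "f \<noteq> 0" "has_limit_at_infinity (inverse f) (inverse l)"
proof -
  show f: "f \<noteq> 0" using has_limit_unique[OF assms(1), of 0] has_limit_0 assms(2) by auto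
  obtain p q where q: "q \<noteq> 0" "f = Fract p q" "((\<lambda>z. poly p z / poly q z) \<longlongrightarrow> l) at_infinity"
    using assms by (auto simp: has_limit_at_infinity_def)
  have p: "p \<noteq> 0" using f q by (auto simp: fract_collapse)
  have "((\<lambda>z. poly q z / poly p z) \<longlongrightarrow> inverse l) at_infinity"
    using tendsto_inverse[OF q(3) assms(2)] by (simp add: field_simps)
  then show "has_limit_at_infinity (inverse f) (inverse l)" using q p by (simp add: has_limit_Fract)
qed

lemma has_limit_inverse_lam: "has_limit_at_infinity (inverse (to_fract lam)) 0"
proof -
  have "inverse (to_fract lam) = Fract 1 lam" by (simp add: to_fract_def)
  then show ?thesis using tendsto_inverse_0[where 'a = complex] by (simp add: has_limit_Fract divide_inverse)
qed

lemma has_limit_det: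
  assumes "X \<in> carrier_mat r r" "X0 \<in> carrier_mat r r"
    "\<And>i j. i < r \<Longrightarrow> j < r \<Longrightarrow> has_limit_at_infinity (X $$ (i,j)) (X0 $$ (i,j))"
  shows "has_limit_at_infinity (det X) (det X0)"
proof -
  have s: "has_limit_at_infinity (signof p) (signof p)" for p :: "nat \<Rightarrow> nat"
    using has_limit_1 has_limit_uminus[OF has_limit_1] by (cases p rule: sign_cases) auto
  show ?thesis unfolding det_def'[OF assms(1)] det_def'[OF assms(2)]
    by (intro has_limit_sum has_limit_mult s has_limit_prod assms(3)) (auto simp: permutes_in_image dest: permutes_in_image)
qed

lemma (in coeff_ring) det_in: "X \<in> carrier_mat r r \<Longrightarrow> entries_in R X \<Longrightarrow> det X \<in> R"
proof -
  assume X: "X \<in> carrier_mat r r" "entries_in R X"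
  have s: "signof p \<in> R" for p :: "nat \<Rightarrow> nat"
    using one_in uminus_in[OF one_in] by (cases p rule: sign_cases) auto
  have "X $$ (i, p i) \<in> R" if "p permutes {0..<r}" "i < r" for i p
    using X permutes_in_image[OF that(1), of i] that(2) by (auto simp: entries_in_def)
  then show ?thesis unfolding det_def'[OF X(1)]
    by (intro sum_in mult_in s prod_in) auto
qed

text \<open>The inverse is a multiple of the adjugate, whose entries are signed minors.\<close>

lemma (in coeff_ring) GL_if_unit_det:
  assumes X: "X \<in> carrier_mat r r" "entries_in R X" and d: "d \<in> R" "d * det X = 1"
  shows "X \<in> GL r"
proof (rule GL_I)
  have p: "(- 1) ^ k \<in> R" for k by (induction k) (auto intro: one_in mult_in uminus_in)
  have c: "cofactor X i j \<in> R" if "i < r" "j < r" for i j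
  proof -
    have "mat_delete X i j \<in> carrier_mat (r - 1) (r - 1)" using X by auto
    moreover have "entries_in R (mat_delete X i j)" using X that by (auto simp: entries_in_def mat_delete_def)
    ultimately show ?thesis unfolding cofactor_def by (intro mult_in p det_in)
  qed
  show "entries_in R (d \<cdot>\<^sub>m adj_mat X)"
    using X d(1) c by (auto simp: entries_in_def adj_mat_def intro!: mult_in)
  show "X * (d \<cdot>\<^sub>m adj_mat X) = 1\<^sub>m r"
    using adj_mat[OF X(1)] X d by (simp add: mult_smult_distrib[of X r r _ r]) (auto intro!: eq_matI)
  show "d \<cdot>\<^sub>m adj_mat X * X = 1\<^sub>m r"
    using adj_mat[OF X(1)] X d by (simp add: mult_smult_assoc_mat[of _ r r X r]) (auto intro!: eq_matI)
qed (use X adj_mat[OF X(1)] in auto)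

definition proper_fun :: "complex poly fract set" where
  "proper_fun = {f. \<exists>l. has_limit_at_infinity f l}"

interpretation proper: coeff_ring proper_fun
  by unfold_locales (auto simp: proper_fun_def intro: has_limit_0 has_limit_1 has_limit_add has_limit_mult has_limit_uminus)

text \<open>Limits are compatible with matrix products, hence the limit of the inverse is inverse to the
  limit.\<close>

lemma GL_proper_imp_biproper:
  assumes "F \<in> proper.GL k" shows "biproper k F"
proof -
  obtain F' where F: "F \<in> carrier_mat k k" "F' \<in> carrier_mat k k" "entries_in proper_fun F"
    "entries_in proper_fun F'" "F * F' = 1\<^sub>m k" "F' * F = 1\<^sub>m k" using assms by (auto simp: proper.GL_def)
  define lim where "lim f = (SOME l. has_limit_at_infinity f l)" for f
  have lim: "has_limit_at_infinity f (lim f)" if "f \<in> proper_fun" for f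
    using that unfolding lim_def proper_fun_def by (auto intro: someI_ex)
  define L where "L = (\<lambda>X. mat k k (\<lambda>(i, j). lim (X $$ (i, j))))"
  have L: "has_limit_at_infinity (X $$ (i, j)) (L X $$ (i, j))"
    if "X \<in> carrier_mat k k" "entries_in proper_fun X" "i < k" "j < k" for X i j
    using that lim by (auto simp: L_def entries_in_def)
  have cL: "L X \<in> carrier_mat k k" for X by (simp add: L_def)
  have dL: "dim_row (L X) = k" "dim_col (L X) = k" for X by (simp_all add: L_def)
  have mult: "L X * L Y = 1\<^sub>m k" if X: "X \<in> carrier_mat k k" "entries_in proper_fun X" and
    Y: "Y \<in> carrier_mat k k" "entries_in proper_fun Y" and XY: "X * Y = 1\<^sub>m k" for X Y
  proof (rule eq_matI)
    fix i j assume "i < dim_row (1\<^sub>m k :: complex mat)" "j < dim_col (1\<^sub>m k :: complex mat)"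
    then have ij: "i < k" "j < k" by auto
    have "has_limit_at_infinity (\<Sum>t<k. X $$ (i, t) * Y $$ (t, j)) (\<Sum>t<k. L X $$ (i, t) * L Y $$ (t, j))"
      by (intro has_limit_sum has_limit_mult L X Y) (use ij in auto)
    also have "(\<Sum>t<k. X $$ (i, t) * Y $$ (t, j)) = (X * Y) $$ (i, j)"
      using X Y ij by (auto simp: scalar_prod_def lessThan_atLeast0)
    also have "(\<Sum>t<k. L X $$ (i, t) * L Y $$ (t, j)) = (L X * L Y) $$ (i, j)"
      using ij by (auto simp: scalar_prod_def lessThan_atLeast0 dL)
    finally have "has_limit_at_infinity (1\<^sub>m k $$ (i, j)) ((L X * L Y) $$ (i, j))" using XY by simp
    moreover have "has_limit_at_infinity (1\<^sub>m k $$ (i, j)) (1\<^sub>m k $$ (i, j))"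
      using ij has_limit_0 has_limit_1 by simp
    ultimately show "(L X * L Y) $$ (i, j) = 1\<^sub>m k $$ (i, j)" by (rule has_limit_unique)
  qed (simp_all add: dL)
  have "invertible_mat (L F)"
    unfolding invertible_mat_def inverts_mat_def square_mat.simps
    using mult[OF F(1,3,2,4,5)] mult[OF F(2,4,1,3,6)] dL by metis
  then show ?thesis unfolding biproper_def using F(1) cL L[OF F(1,3)] by blast
qed

lemma mat_inverse_eq:
  fixes M :: "'a::field mat"
  assumes "M \<in> carrier_mat r r" "Z \<in> carrier_mat r r" "M * Z = 1\<^sub>m r"
  shows "mat_inverse M = Some Z"
proof (cases "mat_inverse M")
  case None
  have "Z * M = 1\<^sub>m r" using assms by (rule mat_mult_left_right_inverse)
  then have "M \<in> Units (ring_mat TYPE('a) r ())" using assms by (auto simp: Units_def ring_mat_def)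
  then show ?thesis using mat_inverse(1)[OF assms(1) None, where b = "()"] by simp
next
  case (Some W)
  then have W: "W * M = 1\<^sub>m r" "W \<in> carrier_mat r r" using mat_inverse(2)[OF assms(1)] by auto
  have "(W * M) * Z = W * (M * Z)" using W(2) assms(1,2) by (rule assoc_mult_mat)
  then have "W = Z" using W assms by simp
  then show ?thesis using Some by simp
qed

abbreviation to_const :: "complex \<Rightarrow> complex poly fract" where
  "to_const c \<equiv> to_fract [:c:]"

lemma to_rat_const: "to_rat_mat (const_mat M) = map_mat to_const M"
  by (rule eq_matI) (auto simp: to_rat_mat_def const_mat_def)

lemma to_rat_pencil: "dim_row E = dim_row A \<Longrightarrow> dim_col E = dim_col A \<Longrightarrow>
   to_rat_mat (lam \<cdot>\<^sub>m const_mat E - const_mat A) = to_fract lam \<cdot>\<^sub>m map_mat to_const E - map_mat to_const A"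
proof (rule eq_matI)
  assume d: "dim_row E = dim_row A" "dim_col E = dim_col A"
  fix i j assume "i < dim_row (to_fract lam \<cdot>\<^sub>m map_mat to_const E - map_mat to_const A)"
    "j < dim_col (to_fract lam \<cdot>\<^sub>m map_mat to_const E - map_mat to_const A)"
  then have ij: "i < dim_row A" "j < dim_col A" by auto
  have "to_rat_mat (lam \<cdot>\<^sub>m const_mat E - const_mat A) $$ (i, j) = to_fract (lam * [:E $$ (i, j):] - [:A $$ (i, j):])"
    using ij d by (simp add: to_rat_mat_def const_mat_def)
  then show "to_rat_mat (lam \<cdot>\<^sub>m const_mat E - const_mat A) $$ (i, j) =
      (to_fract lam \<cdot>\<^sub>m map_mat to_const E - map_mat to_const A) $$ (i, j)"
    using ij d by (simp only: to_fract_diff to_fract_mult) simp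
qed (auto simp: to_rat_mat_def const_mat_def)

lemma invertible_matE:
  assumes "invertible_mat E" "E \<in> carrier_mat r r"
  obtains E' where "E' \<in> carrier_mat r r" "E * E' = 1\<^sub>m r" "E' * E = 1\<^sub>m r"
proof -
  obtain E' where *: "E * E' = 1\<^sub>m (dim_row E)" "E' * E = 1\<^sub>m (dim_row E')"
    using assms(1) unfolding invertible_mat_def inverts_mat_def by blast
  have "dim_col E' = r" using arg_cong[OF *(1), of dim_col] assms(2) by simp
  moreover have "dim_row E' = r" using arg_cong[OF *(2), of dim_col] assms(2) by simp
  ultimately show ?thesis using that[of E'] * assms(2) by auto
qed

lemma invertible_matI:
  assumes "E \<in> carrier_mat r r" "E' \<in> carrier_mat r r" "E * E' = 1\<^sub>m r" "E' * E = 1\<^sub>m r"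
  shows "invertible_mat E"
  using assms unfolding invertible_mat_def inverts_mat_def by auto

text \<open>Write \<open>\<lambda> E - A = \<lambda> (E - \<lambda>\<^sup>-\<^sup>1 A)\<close>. The determinant of the second factor has the nonzero limit
  \<open>det E\<close>, so this factor is invertible over the proper functions.\<close>

lemma resolvent_proper:
  assumes E: "E \<in> carrier_mat r r" "invertible_mat E" and A: "A \<in> carrier_mat r r"
  obtains Z where "Z \<in> carrier_mat r r" "entries_in proper_fun Z"
    "to_rat_mat (lam \<cdot>\<^sub>m const_mat E - const_mat A) * Z = 1\<^sub>m r"
    "Z * to_rat_mat (lam \<cdot>\<^sub>m const_mat E - const_mat A) = 1\<^sub>m r"
    "the (mat_inverse (to_rat_mat (lam \<cdot>\<^sub>m const_mat E - const_mat A))) = Z"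
proof -
  let ?l = "to_fract lam" and ?u = "inverse (to_fract lam)"
  have l: "?l \<noteq> 0" by simp
  define X where "X = map_mat to_const E - ?u \<cdot>\<^sub>m map_mat to_const A"
  have X: "X \<in> carrier_mat r r" using E A by (auto simp: X_def)
  have lim: "has_limit_at_infinity (X $$ (i, j)) (E $$ (i, j))" if "i < r" "j < r" for i j
    using has_limit_add[OF has_limit_const[of "E $$ (i, j)"] has_limit_uminus[OF has_limit_mult[OF has_limit_inverse_lam has_limit_const[of "A $$ (i, j)"]]]]
      that E A by (simp add: X_def)
  have "det E \<noteq> 0"
  proof -
    obtain E' where "E' \<in> carrier_mat r r" "E * E' = 1\<^sub>m r" using invertible_matE[OF E(2,1)] .
    then have "det E * det E' = 1" using det_mult[of E r E'] E(1) by simp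
    then show ?thesis by auto
  qed
  then have d: "det X \<noteq> 0" "has_limit_at_infinity (inverse (det X)) (inverse (det E))"
    using has_limit_inverse[OF has_limit_det[OF X E(1) lim]] by auto
  have "X \<in> proper.GL r"
    using X d lim by (intro proper.GL_if_unit_det[of _ _ "inverse (det X)"]) (auto simp: entries_in_def proper_fun_def)
  then obtain Y where Y: "Y \<in> carrier_mat r r" "entries_in proper_fun Y" "X * Y = 1\<^sub>m r" "Y * X = 1\<^sub>m r"
    by (auto simp: proper.GL_def)
  have XM: "to_rat_mat (lam \<cdot>\<^sub>m const_mat E - const_mat A) = ?l \<cdot>\<^sub>m X"
    using E(1) A by (subst to_rat_pencil) (auto simp: X_def right_diff_distrib l simp flip: mult.assoc intro!: eq_matI)
  define Z where "Z = ?u \<cdot>\<^sub>m Y"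
  have Z: "Z \<in> carrier_mat r r" using Y by (simp add: Z_def)
  have "?u \<in> proper_fun" using has_limit_inverse_lam by (auto simp: proper_fun_def)
  then have "entries_in proper_fun Z" unfolding Z_def using Y by (intro proper.entries_simps)
  moreover have 1: "?l \<cdot>\<^sub>m X * Z = 1\<^sub>m r"
    unfolding Z_def using X Y l by (simp add: mat_smult_left_dim mat_smult_right_dim) (auto intro!: eq_matI simp flip: mult.assoc)
  moreover have "Z * (?l \<cdot>\<^sub>m X) = 1\<^sub>m r" by (rule mat_mult_left_right_inverse[OF smult_carrier_mat[OF X] Z 1])
  moreover have "the (mat_inverse (?l \<cdot>\<^sub>m X)) = Z" using mat_inverse_eq[of "?l \<cdot>\<^sub>m X" r Z] X Z 1 by simp
  ultimately show ?thesis using that[of Z] Z XM by simp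
qed

section \<open>Minimal realizations are irreducible\<close>

interpretation to_const_hom: comm_ring_hom to_const
proof unfold_locales
  show "to_const (x + y) = to_const x + to_const y" for x y
    using to_fract_add[of "[:x:]" "[:y:]"] by simp
  show "to_const (x * y) = to_const x * to_const y" for x y
    using to_fract_mult[of "[:x:]" "[:y:]"] by (simp add: mult.commute)
  show "to_const 1 = 1" using to_fract_1[where 'a = "complex poly"] by (simp only: one_pCons)
qed simp_all

lemma resolvent_unique:
  fixes M :: "'a::field mat"
  assumes M: "M \<in> carrier_mat r r" "Z \<in> carrier_mat r r" "Z * M = 1\<^sub>m r"
    and V: "V \<in> carrier_mat r n" "M * V = W"
  shows "V = Z * W"
proof -
  have "(Z * M) * V = Z * (M * V)" using M(2,1) V(1) by (rule assoc_mult_mat)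
  then show ?thesis using M(3) V(2) left_mult_one_mat[OF V(1)] by simp
qed

lemma extend_to_invertible:
  fixes w :: "complex vec"
  assumes w: "w \<in> carrier_vec r" "w \<noteq> 0\<^sub>v r"
  obtains T T' where "T \<in> carrier_mat r r" "T' \<in> carrier_mat r r" "T * T' = 1\<^sub>m r" "T' * T = 1\<^sub>m r"
    "0 < r" "row T 0 = w"
proof -
  interpret vec_space "TYPE(complex)" r .
  define bs where "bs = basis_completion w"
  note bc = basis_completion[OF w, folded bs_def]
  have r: "0 < r" using w by (cases r) auto
  define M where "M = mat_of_cols r bs"
  have M: "M \<in> carrier_mat r r" using bc(6) by (auto simp: M_def)
  have cols: "cols M = bs" unfolding M_def using bc(2) by (intro cols_mat_of_cols)
  have "rank M = r" using lin_indpt_full_rank[OF M] bc cols by simp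
  then have "det M \<noteq> 0" using det_rank_iff[OF M] by simp
  then have d: "det M\<^sup>T \<noteq> 0" using det_transpose[OF M] by simp
  have "M\<^sup>T \<in> UNIV_ring.GL r"
    by (rule UNIV_ring.GL_if_unit_det[of _ _ "inverse (det M\<^sup>T)"]) (use M d in \<open>auto simp: entries_in_def\<close>)
  then obtain T' where T': "T' \<in> carrier_mat r r" "M\<^sup>T * T' = 1\<^sub>m r" "T' * M\<^sup>T = 1\<^sub>m r" by (auto simp: UNIV_ring.GL_def)
  have "row M\<^sup>T 0 = cols M ! 0" using M r by simp
  also have "\<dots> = w" unfolding cols using bc(6,7) r by (metis hd_conv_nth length_greater_0_conv)
  finally show ?thesis using that[of "M\<^sup>T" T'] M T' r by simp
qed

text \<open>Choose a nonsingular \<open>T\<close> with first row \<open>w\<close>, and \<open>S\<close> with \<open>T E S = I\<close>. The hypotheses say that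
  \<open>T A S\<close> has the first row \<open>(z, 0, \<dots>, 0)\<close> and that \<open>T B\<close> has the first row 0. In the new coordinates
  the first state is therefore not reached by the input, and deleting it does not change the transfer
  function.\<close>

lemma left_null_reduces:
  assumes re: "realization n r P C E A B G"
    and w: "w \<in> carrier_vec r" "w \<noteq> 0\<^sub>v r" "B\<^sup>T *\<^sub>v w = 0\<^sub>v n" "A\<^sup>T *\<^sub>v w = z \<cdot>\<^sub>v (E\<^sup>T *\<^sub>v w)"
  shows "\<exists>C' E' A' B'. realization n (r - 1) P C' E' A' B' G \<and> 0 < r"
proof -
  have c: "P \<in> carrier_mat n n" "C \<in> carrier_mat n r" "E \<in> carrier_mat r r" "A \<in> carrier_mat r r" "B \<in> carrier_mat r n"
    and E: "invertible_mat E" and G: "G = transfer P C E A B" using re by (auto simp: realization_def)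
  obtain T T' where T: "T \<in> carrier_mat r r" "T' \<in> carrier_mat r r" "T * T' = 1\<^sub>m r" "T' * T = 1\<^sub>m r"
    and r: "0 < r" and row: "row T 0 = w" using extend_to_invertible[OF w(1,2)] .
  obtain E' where E': "E' \<in> carrier_mat r r" "E * E' = 1\<^sub>m r" "E' * E = 1\<^sub>m r" using invertible_matE[OF E c(3)] .
  define s where "s = r - 1"
  have rs: "r = 1 + s" using r by (simp add: s_def)
  define S where "S = E' * T'"
  have S: "S \<in> carrier_mat r r" using E' T by (auto simp: S_def)
  define A1 where "A1 = T * A * S"
  define B1 where "B1 = T * B"
  define C1 where "C1 = C * S"
  note d[simp] = c[THEN carrier_matD(1)] c[THEN carrier_matD(2)] T(1,2)[THEN carrier_matD(1)] T(1,2)[THEN carrier_matD(2)]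
    carrier_matD[OF E'(1)] S[THEN carrier_matD(1)] S[THEN carrier_matD(2)]
  have dw[simp]: "dim_vec w = r" using w(1) by simp
  have TES: "T * E * S = 1\<^sub>m r"
  proof -
    have "T * E * S = T * ((E * E') * T')" by (simp add: S_def mat_assoc_dim)
    then show ?thesis using E' T by (simp add: mat_one_left_dim)
  qed
  have rowB: "B1 $$ (0, j) = 0" if "j < n" for j
  proof -
    have "B1 $$ (0, j) = w \<bullet> col B j" using that r by (simp add: B1_def row)
    also have "\<dots> = (B\<^sup>T *\<^sub>v w) $ j" using that c w(1) by (simp add: comm_scalar_prod[of w r])
    finally show ?thesis using w(3) that by simp
  qed
  have rowTA: "(T * A) $$ (0, j) = z * (T * E) $$ (0, j)" if "j < r" for j
  proof -
    have "(T * A) $$ (0, j) = w \<bullet> col A j" using that r by (simp add: row)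
    also have "\<dots> = (A\<^sup>T *\<^sub>v w) $ j" using that c w(1) by (simp add: comm_scalar_prod[of w r])
    also have "\<dots> = z * (E\<^sup>T *\<^sub>v w) $ j" using that by (simp add: w(4))
    also have "(E\<^sup>T *\<^sub>v w) $ j = w \<bullet> col E j" using that c w(1) by (simp add: comm_scalar_prod[of w r])
    also have "\<dots> = (T * E) $$ (0, j)" using that r by (simp add: row)
    finally show ?thesis .
  qed
  have rowA: "A1 $$ (0, j) = (if j = 0 then z else 0)" if "j < r" for j
  proof -
    have "A1 $$ (0, j) = (\<Sum>k<r. (T * A) $$ (0, k) * S $$ (k, j))"
      unfolding A1_def using that r by (simp add: scalar_prod_def lessThan_atLeast0 del: index_mult_mat(1))
        (simp add: index_mult_mat(1)[of 0 "T * A"] scalar_prod_def)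
    also have "\<dots> = z * (\<Sum>k<r. (T * E) $$ (0, k) * S $$ (k, j))"
      unfolding sum_distrib_left by (intro sum.cong) (simp_all add: rowTA mult.assoc del: index_mult_mat(1))
    also have "(\<Sum>k<r. (T * E) $$ (0, k) * S $$ (k, j)) = (T * E * S) $$ (0, j)"
      using that r by (simp add: index_mult_mat(1)[of 0 "T * E"] scalar_prod_def lessThan_atLeast0)
    finally show ?thesis using TES that r by simp
  qed
  define A22 where "A22 = mat s s (\<lambda>(i, j). A1 $$ (i + 1, j + 1))"
  define A21 where "A21 = mat s 1 (\<lambda>(i, j). A1 $$ (i + 1, j))"
  define B2 where "B2 = mat s n (\<lambda>(i, j). B1 $$ (i + 1, j))"
  define C2 where "C2 = mat n s (\<lambda>(i, j). C1 $$ (i, j + 1))"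
  have re2: "realization n s P C2 (1\<^sub>m s) A22 B2 (transfer P C2 (1\<^sub>m s) A22 B2)"
    unfolding realization_def using c invertible_matI[of "1\<^sub>m s" s "1\<^sub>m s :: complex mat"] by (auto simp: C2_def A22_def B2_def)
  let ?h = "map_mat to_const" and ?l = "to_fract lam"
  have A22: "A22 \<in> carrier_mat s s" by (simp add: A22_def)
  have one_inv: "invertible_mat (1\<^sub>m s :: complex mat)" by (rule invertible_matI[of _ s "1\<^sub>m s"]) auto
  obtain Z2 where Z2: "Z2 \<in> carrier_mat s s" "to_rat_mat (lam \<cdot>\<^sub>m const_mat (1\<^sub>m s) - const_mat A22) * Z2 = 1\<^sub>m s"
     "the (mat_inverse (to_rat_mat (lam \<cdot>\<^sub>m const_mat (1\<^sub>m s) - const_mat A22))) = Z2"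
    using resolvent_proper[OF one_carrier_mat one_inv A22] .
  obtain Z where Z: "Z \<in> carrier_mat r r" "Z * to_rat_mat (lam \<cdot>\<^sub>m const_mat E - const_mat A) = 1\<^sub>m r"
     "the (mat_inverse (to_rat_mat (lam \<cdot>\<^sub>m const_mat E - const_mat A))) = Z"
    using resolvent_proper[OF c(3) E c(4)] .
  define M2 where "M2 = ?l \<cdot>\<^sub>m 1\<^sub>m s - ?h A22"
  define M where "M = ?l \<cdot>\<^sub>m ?h E - ?h A"
  have M2: "to_rat_mat (lam \<cdot>\<^sub>m const_mat (1\<^sub>m s) - const_mat A22) = M2"
    using A22 by (simp add: to_rat_pencil M2_def to_const_hom.mat_hom_one)
  have M: "to_rat_mat (lam \<cdot>\<^sub>m const_mat E - const_mat A) = M"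
    by (simp add: to_rat_pencil M_def)
  \<comment> \<open>the solution of the resolvent equation in the new coordinates; its first component is zero\<close>
  define V where "V = four_block_mat (0\<^sub>m 1 n) (0\<^sub>m 1 0) (Z2 * ?h B2) (0\<^sub>m s 0)"
  have V: "V \<in> carrier_mat r n" using Z2 by (auto simp: V_def rs B2_def)
  have dM: "dim_row M2 = s" "dim_col M2 = s" "dim_row M = r" "dim_col M = r" using A22 by (auto simp: M2_def M_def)
  have dZ: "dim_row Z2 = s" "dim_col Z2 = s" "dim_row Z = r" "dim_col Z = r" using Z Z2 by auto
  have dB: "dim_row B2 = s" "dim_col B2 = n" "dim_row C2 = n" "dim_col C2 = s" by (auto simp: B2_def C2_def)
  have A1b: "A1 = four_block_mat (z \<cdot>\<^sub>m 1\<^sub>m 1) (0\<^sub>m 1 s) A21 A22"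
  proof (rule eq_matI)
    fix i j assume "i < dim_row (four_block_mat (z \<cdot>\<^sub>m 1\<^sub>m 1) (0\<^sub>m 1 s) A21 A22)" "j < dim_col (four_block_mat (z \<cdot>\<^sub>m 1\<^sub>m 1) (0\<^sub>m 1 s) A21 A22)"
    then show "A1 $$ (i, j) = four_block_mat (z \<cdot>\<^sub>m 1\<^sub>m 1) (0\<^sub>m 1 s) A21 A22 $$ (i, j)"
      using rowA by (cases i; cases j) (auto simp: A21_def A22_def rs)
  qed (auto simp: A1_def A21_def A22_def rs)
  have B1b: "B1 = four_block_mat (0\<^sub>m 1 n) (0\<^sub>m 1 0) B2 (0\<^sub>m s 0)"
  proof (rule eq_matI)
    fix i j assume "i < dim_row (four_block_mat (0\<^sub>m 1 n) (0\<^sub>m 1 0) B2 (0\<^sub>m s 0))" "j < dim_col (four_block_mat (0\<^sub>m 1 n) (0\<^sub>m 1 0) B2 (0\<^sub>m s 0))"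
    then show "B1 $$ (i, j) = four_block_mat (0\<^sub>m 1 n) (0\<^sub>m 1 0) B2 (0\<^sub>m s 0) $$ (i, j)"
      using rowB by (cases i) (auto simp: B2_def)
  qed (auto simp: B1_def rs B2_def)
  have C1V: "?h C1 * V = ?h C2 * (Z2 * ?h B2)"
  proof -
    have "C1 = four_block_mat (mat n 1 (\<lambda>(i, j). C1 $$ (i, 0))) C2 (0\<^sub>m 0 1) (0\<^sub>m 0 s)"
      by (rule eq_matI) (auto simp: C1_def C2_def rs)
    then have "?h C1 = ?h (four_block_mat (mat n 1 (\<lambda>(i, j). C1 $$ (i, 0))) C2 (0\<^sub>m 0 1) (0\<^sub>m 0 s))" by simp
    also have "\<dots> = four_block_mat (?h (mat n 1 (\<lambda>(i, j). C1 $$ (i, 0)))) (?h C2) (0\<^sub>m 0 1) (0\<^sub>m 0 s)"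
      by (rule eq_matI) (auto simp: C2_def)
    finally have "?h C1 * V = four_block_mat (?h C2 * (Z2 * ?h B2)) (0\<^sub>m n 0) (0\<^sub>m 0 n) (0\<^sub>m 0 0)"
      unfolding V_def by (simp add: four_block_mult_dim dZ dB) (rule four_block_cong, auto simp: dB dZ mat_ring_simps)
    also have "\<dots> = ?h C2 * (Z2 * ?h B2)" by (rule eq_matI) (auto simp: dB dZ)
    finally show ?thesis .
  qed
  have MV: "(?l \<cdot>\<^sub>m 1\<^sub>m r - ?h A1) * V = ?h B1"
  proof -
    have "?l \<cdot>\<^sub>m 1\<^sub>m r - ?h A1 = four_block_mat (mat 1 1 (\<lambda>_. ?l - to_const z)) (0\<^sub>m 1 s) (- ?h A21) M2"
      (is "_ = ?F")
    proof (rule eq_matI)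
      have d: "dim_row A21 = s" "dim_col A21 = 1" "dim_row A22 = s" "dim_col A22 = s" by (auto simp: A21_def A22_def)
      fix i j assume "i < dim_row ?F" "j < dim_col ?F"
      then have ij: "i < 1 + s" "j < 1 + s" by (auto simp: d dM)
      show "(?l \<cdot>\<^sub>m 1\<^sub>m r - ?h A1) $$ (i, j) = ?F $$ (i, j)"
        unfolding A1b M2_def using ij by (cases i; cases j) (auto simp: d rs)
    qed (auto simp: A1_def A21_def dM rs)
    moreover have "M2 * (Z2 * ?h B2) = ?h B2"
    proof -
      have "M2 * (Z2 * ?h B2) = (M2 * Z2) * ?h B2" by (simp add: mat_assoc_dim dM dZ dB)
      then show ?thesis using Z2(2) unfolding M2 by (simp add: mat_one_left_dim dB)
    qed
    ultimately have "(?l \<cdot>\<^sub>m 1\<^sub>m r - ?h A1) * V = four_block_mat (0\<^sub>m 1 n) (0\<^sub>m 1 0) (?h B2) (0\<^sub>m s 0)"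
      unfolding V_def by (simp add: four_block_mult_dim dM dZ dB A21_def) (rule four_block_cong, auto simp: dB dZ dM mat_ring_simps A21_def)
    also have "\<dots> = ?h B1" unfolding B1b by (rule eq_matI) (auto simp: dB)
    finally show ?thesis .
  qed
  have hT: "?h T * M * ?h S = ?l \<cdot>\<^sub>m 1\<^sub>m r - ?h A1"
  proof -
    have "?h T * M * ?h S = ?l \<cdot>\<^sub>m (?h T * ?h E * ?h S) - ?h T * ?h A * ?h S"
      unfolding M_def by (simp add: mat_ring_simps)
    also have "?h T * ?h E * ?h S = ?h (T * E * S)" using T S c E'
      by (simp add: to_const_hom.mat_hom_mult[of _ r r _ r])
    also have "?h T * ?h A * ?h S = ?h A1" unfolding A1_def using T S c E'
      by (simp add: to_const_hom.mat_hom_mult[of _ r r _ r])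
    finally show ?thesis unfolding TES by (simp add: to_const_hom.mat_hom_one)
  qed
  have dV: "dim_row V = r" "dim_col V = n" using V by auto
  have "M * (?h S * V) = ?h B"
  proof -
    have "?h T' * (?h T * (M * (?h S * V))) = ?h T' * ((?h T * M * ?h S) * V)"
      by (simp add: mat_assoc_dim dM dV)
    also have "\<dots> = ?h T' * ?h B1" unfolding hT MV ..
    also have "\<dots> = ?h (T' * (T * B))" unfolding B1_def using T c
      by (intro to_const_hom.mat_hom_mult[symmetric, of _ r r _ n]) auto
    also have "T' * (T * B) = B" using T by (simp add: mat_assoc_dim[symmetric] mat_one_left_dim)
    also have "?h T' * (?h T * (M * (?h S * V))) = (?h T' * ?h T) * (M * (?h S * V))"
      by (simp add: mat_assoc_dim dM dV)
    also have "?h T' * ?h T = 1\<^sub>m r" using T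
      by (simp add: to_const_hom.mat_hom_mult[symmetric, of _ r r _ r] to_const_hom.mat_hom_one)
    finally show ?thesis by (simp add: mat_one_left_dim dM)
  qed
  then have "?h S * V = Z * ?h B"
    using Z unfolding M by (intro resolvent_unique[where M = M and n = n]) (auto simp: dM dV intro!: carrier_matI)
  then have "?h C * Z * ?h B = ?h C * (?h S * V)" by (simp add: mat_assoc_dim dZ)
  also have "\<dots> = ?h C1 * V" unfolding C1_def using c S
    by (simp add: to_const_hom.mat_hom_mult[of _ n r _ r] mat_assoc_dim dV)
  also have "\<dots> = ?h C2 * Z2 * ?h B2" unfolding C1V by (simp add: mat_assoc_dim dZ dB)
  finally have "transfer P C2 (1\<^sub>m s) A22 B2 = G"
    unfolding G transfer_def Z(3) Z2(3) to_rat_const by simp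
  then show ?thesis using re2 r unfolding s_def by metis
qed

lemma transfer_transpose:
  assumes c: "P \<in> carrier_mat n n" "C \<in> carrier_mat n r" "E \<in> carrier_mat r r" "A \<in> carrier_mat r r" "B \<in> carrier_mat r n"
    and E: "invertible_mat E"
  shows "transfer P\<^sup>T B\<^sup>T E\<^sup>T A\<^sup>T C\<^sup>T = (transfer P C E A B)\<^sup>T" "invertible_mat E\<^sup>T"
proof -
  let ?h = "map_mat to_const" and ?l = "to_fract lam"
  obtain Z where Z: "Z \<in> carrier_mat r r" "to_rat_mat (lam \<cdot>\<^sub>m const_mat E - const_mat A) * Z = 1\<^sub>m r"
     "Z * to_rat_mat (lam \<cdot>\<^sub>m const_mat E - const_mat A) = 1\<^sub>m r"
     "the (mat_inverse (to_rat_mat (lam \<cdot>\<^sub>m const_mat E - const_mat A))) = Z"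
    using resolvent_proper[OF c(3) E c(4)] .
  obtain E' where E': "E' \<in> carrier_mat r r" "E * E' = 1\<^sub>m r" "E' * E = 1\<^sub>m r" using invertible_matE[OF E c(3)] .
  show "invertible_mat E\<^sup>T"
    by (rule invertible_matI[of _ r "E'\<^sup>T"])
       (use E' c in \<open>simp_all flip: transpose_mult[of E' r r E r] transpose_mult[of E r r E' r]\<close>)
  define M where "M = to_rat_mat (lam \<cdot>\<^sub>m const_mat E - const_mat A)"
  have M: "M \<in> carrier_mat r r" using c by (auto simp: M_def to_rat_pencil)
  have MT: "to_rat_mat (lam \<cdot>\<^sub>m const_mat E\<^sup>T - const_mat A\<^sup>T) = M\<^sup>T"
    unfolding M_def using c by (intro eq_matI) (auto simp: to_rat_mat_def const_mat_def)
  have "M\<^sup>T * Z\<^sup>T = (Z * M)\<^sup>T" using Z(1) M by (rule transpose_mult[symmetric])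
  also have "\<dots> = 1\<^sub>m r" using Z(3) by (simp add: M_def)
  finally have "mat_inverse M\<^sup>T = Some Z\<^sup>T"
    using Z(1) M by (intro mat_inverse_eq[of _ r]) auto
  then have "transfer P\<^sup>T B\<^sup>T E\<^sup>T A\<^sup>T C\<^sup>T = to_rat_mat P\<^sup>T + ?h B\<^sup>T * Z\<^sup>T * ?h C\<^sup>T"
    unfolding transfer_def MT to_rat_const by simp
  also have "?h B\<^sup>T * Z\<^sup>T * ?h C\<^sup>T = (?h C * Z * ?h B)\<^sup>T"
  proof -
    have hc: "?h C \<in> carrier_mat n r" "?h B \<in> carrier_mat r n" using c by auto
    have "(?h C * Z * ?h B)\<^sup>T = (?h B)\<^sup>T * (?h C * Z)\<^sup>T"
      by (rule transpose_mult[OF mult_carrier_mat[OF hc(1) Z(1)] hc(2)])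
    also have "(?h C * Z)\<^sup>T = Z\<^sup>T * (?h C)\<^sup>T" by (rule transpose_mult[OF hc(1) Z(1)])
    also have "(?h B)\<^sup>T * (Z\<^sup>T * (?h C)\<^sup>T) = (?h B)\<^sup>T * Z\<^sup>T * (?h C)\<^sup>T"
      using hc Z(1) by (simp add: mat_assoc_dim)
    finally show ?thesis by (simp add: map_mat_transpose)
  qed
  also have "to_rat_mat P\<^sup>T = (to_rat_mat P)\<^sup>T" by (simp add: to_rat_mat_def map_mat_transpose)
  also have "(to_rat_mat P)\<^sup>T + (?h C * Z * ?h B)\<^sup>T = (to_rat_mat P + ?h C * Z * ?h B)\<^sup>T"
    by (rule transpose_add[symmetric, of _ n n]) (use c Z(1) in \<open>auto simp: to_rat_mat_def intro!: mult_carrier_mat\<close>)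
  also have "\<dots> = (transfer P C E A B)\<^sup>T"
    unfolding transfer_def Z(4) to_rat_const ..
  finally show "transfer P\<^sup>T B\<^sup>T E\<^sup>T A\<^sup>T C\<^sup>T = (transfer P C E A B)\<^sup>T" .
qed

lemma realization_transpose:
  assumes "realization n r P C E A B G"
  shows "realization n r P\<^sup>T B\<^sup>T E\<^sup>T A\<^sup>T C\<^sup>T G\<^sup>T"
  using assms transfer_transpose[of P n C r E A B] unfolding realization_def by auto

lemma minimal_controllable:
  assumes "minimal_realization n r P C E A B G"
    and "w \<in> carrier_vec r" "B\<^sup>T *\<^sub>v w = 0\<^sub>v n" "A\<^sup>T *\<^sub>v w = z \<cdot>\<^sub>v (E\<^sup>T *\<^sub>v w)"
  shows "w = 0\<^sub>v r"
proof (rule ccontr)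
  assume "w \<noteq> 0\<^sub>v r"
  then obtain C' E' A' B' where "realization n (r - 1) P C' E' A' B' G" "0 < r"
    using left_null_reduces[of n r P C E A B G w z] assms unfolding minimal_realization_def by auto
  then have "r \<le> r - 1" "0 < r" using assms(1) unfolding minimal_realization_def by blast+
  then show False by simp
qed

text \<open>This is \<open>left_null_reduces\<close> for the transposed realization, which realizes the transpose of \<open>G\<close>.\<close>

lemma minimal_observable:
  assumes "minimal_realization n r P C E A B G"
    and "v \<in> carrier_vec r" "C *\<^sub>v v = 0\<^sub>v n" "A *\<^sub>v v = z \<cdot>\<^sub>v (E *\<^sub>v v)"
  shows "v = 0\<^sub>v r"
proof (rule ccontr)
  assume "v \<noteq> 0\<^sub>v r"
  moreover have "realization n r P\<^sup>T B\<^sup>T E\<^sup>T A\<^sup>T C\<^sup>T G\<^sup>T"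
    using assms(1) unfolding minimal_realization_def by (intro realization_transpose) blast
  ultimately obtain C' E' A' B' where *: "realization n (r - 1) P\<^sup>T C' E' A' B' G\<^sup>T" "0 < r"
    using left_null_reduces[of n r "P\<^sup>T" "B\<^sup>T" "E\<^sup>T" "A\<^sup>T" "C\<^sup>T" "G\<^sup>T" v z] assms(2-) by auto
  from realization_transpose[OF *(1)] have "r \<le> r - 1" using assms(1) unfolding minimal_realization_def by simp blast
  then show False using *(2) by simp
qed

text \<open>With \<open>H\<close> the conjugate transpose of \<open>M\<close>, the Gram matrix \<open>M H\<close> is nonsingular. So \<open>M\<close> has a right
  inverse, and its columns span the whole space.\<close>

lemma rank_if_trivial_left_kernel:
  fixes M :: "complex mat"
  assumes M: "M \<in> carrier_mat r q" and ker: "\<And>w. w \<in> carrier_vec r \<Longrightarrow> M\<^sup>T *\<^sub>v w = 0\<^sub>v q \<Longrightarrow> w = 0\<^sub>v r"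
  shows "vec_space.rank r M = r"
proof -
  interpret vec_space "TYPE(complex)" r .
  define H where "H = map_mat cnj M\<^sup>T"
  have H: "H \<in> carrier_mat q r" using M by (auto simp: H_def)
  have MH: "M * H \<in> carrier_mat r r" using M H by auto
  have "det (M * H) \<noteq> 0"
  proof
    assume "det (M * H) = 0"
    then have "det (M * H)\<^sup>T = 0" using det_transpose[OF MH] by simp
    then obtain w where w: "w \<in> carrier_vec r" "w \<noteq> 0\<^sub>v r" "(M * H)\<^sup>T *\<^sub>v w = 0\<^sub>v r"
      using det_0_iff_vec_prod_zero[of "(M * H)\<^sup>T" r] MH by auto
    \<comment> \<open>\<open>H\<^sup>T u = 0\<close> implies that the squared norm of \<open>u\<close> vanishes\<close>
    define u where "u = M\<^sup>T *\<^sub>v w"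
    have u: "u \<in> carrier_vec q" using M w by (auto simp: u_def)
    have "(M * H)\<^sup>T = H\<^sup>T * M\<^sup>T" using M H by (rule transpose_mult)
    then have Hu: "H\<^sup>T *\<^sub>v u = 0\<^sub>v r" using w M H by (simp add: u_def assoc_mult_mat_vec[of _ r q])
    have ui: "u $ k = (\<Sum>i<r. M $$ (i, k) * w $ i)" if "k < q" for k
      using that M w by (simp add: u_def scalar_prod_def lessThan_atLeast0)
    have Hi: "(\<Sum>k<q. cnj (M $$ (i, k)) * u $ k) = 0" if "i < r" for i
    proof -
      have "(H\<^sup>T *\<^sub>v u) $ i = (\<Sum>k<q. cnj (M $$ (i, k)) * u $ k)"
        using that M u by (simp add: H_def scalar_prod_def lessThan_atLeast0)
      then show ?thesis using Hu that by simp
    qed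
    have "(\<Sum>k<q. cnj (u $ k) * u $ k) = (\<Sum>k<q. \<Sum>i<r. cnj (w $ i) * (cnj (M $$ (i, k)) * u $ k))"
    proof (intro sum.cong refl)
      fix k assume "k \<in> {..<q}"
      then have "cnj (u $ k) = (\<Sum>i<r. cnj (w $ i) * cnj (M $$ (i, k)))" by (simp add: ui mult.commute)
      then show "cnj (u $ k) * u $ k = (\<Sum>i<r. cnj (w $ i) * (cnj (M $$ (i, k)) * u $ k))"
        by (simp only: sum_distrib_right mult.assoc)
    qed
    also have "\<dots> = (\<Sum>i<r. cnj (w $ i) * (\<Sum>k<q. cnj (M $$ (i, k)) * u $ k))"
      by (subst sum.swap) (simp add: sum_distrib_left)
    also have "\<dots> = 0" using Hi by simp
    finally have "complex_of_real (\<Sum>k<q. (cmod (u $ k))\<^sup>2) = 0"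
      unfolding of_real_sum complex_norm_square by (simp add: mult.commute)
    then have "(\<Sum>k<q. (cmod (u $ k))\<^sup>2) = 0" unfolding of_real_eq_0_iff .
    then have "\<forall>k\<in>{..<q}. (cmod (u $ k))\<^sup>2 = 0" by (subst (asm) sum_nonneg_eq_0_iff) auto
    then have "u = 0\<^sub>v q" using u by (intro eq_vecI) auto
    then have "w = 0\<^sub>v r" using ker[OF w(1)] by (simp add: u_def)
    then show False using w(2) by simp
  qed
  then have "M * H \<in> UNIV_ring.GL r"
    using MH by (intro UNIV_ring.GL_if_unit_det[of _ _ "inverse (det (M * H))"]) (auto simp: entries_in_def)
  then obtain N where N: "N \<in> carrier_mat r r" "(M * H) * N = 1\<^sub>m r" by (auto simp: UNIV_ring.GL_def)
  have HN: "H * N \<in> carrier_mat q r" using H N by auto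
  have one: "M * (H * N) = 1\<^sub>m r" using N(2) assoc_mult_mat[OF M H N(1)] by simp
  have "y \<in> col_space M" if "y \<in> carrier_vec r" for y
  proof -
    have "M *\<^sub>v ((H * N) *\<^sub>v y) = y" using assoc_mult_mat_vec[OF M HN that] one that by simp
    then show ?thesis unfolding col_space_eq[OF M] using that M HN by (auto intro!: bexI[of _ "(H * N) *\<^sub>v y"])
  qed
  then have sp: "span (set (cols M)) = carrier_vec r"
    using M unfolding col_space_def[symmetric] col_space_eq[OF M] by auto
  have V: "vs (carrier_vec r) = V" by (simp add: module_vec_def)
  show ?thesis unfolding rank_def sp V by (rule dim_is_n)
qed

lemma rank_if_trivial_kernel:
  fixes M :: "complex mat"
  assumes M: "M \<in> carrier_mat p r" and ker: "\<And>v. v \<in> carrier_vec r \<Longrightarrow> M *\<^sub>v v = 0\<^sub>v p \<Longrightarrow> v = 0\<^sub>v r"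
  shows "vec_space.rank p M = r"
proof -
  interpret vec_space "TYPE(complex)" p .
  have dist: "distinct (cols M)"
  proof (rule ccontr)
    assume "\<not> distinct (cols M)"
    then obtain i j where ij: "i < r" "j < r" "i \<noteq> j" "col M i = col M j"
      using M by (auto simp: distinct_conv_nth)
    define v :: "complex vec" where "v = unit_vec r i - unit_vec r j"
    have v: "v \<in> carrier_vec r" by (simp add: v_def)
    have "M *\<^sub>v v = M *\<^sub>v unit_vec r i - M *\<^sub>v unit_vec r j"
      unfolding v_def using M by (intro mult_minus_distrib_mat_vec) auto
    also have "M *\<^sub>v unit_vec r i = col M i" using M ij(1) by (intro eq_vecI) auto
    also have "M *\<^sub>v unit_vec r j = col M j" using M ij(2) by (intro eq_vecI) auto
    also have "col M i - col M j = 0\<^sub>v p" using M by (simp only: ij(4)) (rule minus_cancel_vec, auto)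
    finally have "v = 0\<^sub>v r" using ker v by blast
    then have "v $ i = 0" using ij by simp
    then show False using ij by (simp add: v_def)
  qed
  have "lin_indpt (set (cols M))"
    using lin_depE[OF M _ dist] ker by metis
  then show ?thesis using lin_indpt_full_rank[OF M dist] by simp
qed

section \<open>The Fiedler pencil of a realization\<close>

interpretation const_hom: comm_ring_hom "\<lambda>c :: complex. [:c:]"
  by unfold_locales (simp_all add: one_pCons mult.commute)

lemma block_col_mult_index:
  fixes M :: "'a::semiring_1 mat"
  assumes "dim_row M = n" "i < m * n" "j < dim_col M"
  shows "(block_col n m q * M) $$ (i, j) = (if i div n = q then M $$ (i mod n, j) else 0)"
proof -
  have n: "0 < n" using assms(2) by (cases n) auto
  have "q * n \<le> i \<and> i < q * n + n \<longleftrightarrow> i div n = q"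
    using n dividend_less_times_div[of n i] by (auto simp: div_nat_eqI mult.commute add.commute)
  then show ?thesis using assms unfolding block_col_def by (subst incl_mult) (auto simp: minus_div_mult_eq_mod[symmetric])
qed

lemma kronecker_e_col:
  assumes "C \<in> carrier_mat n r" "p \<noteq> 0"
  shows "e_col m p \<otimes>\<^sub>k C = block_col n m (p - 1) * C"
proof (rule eq_matI)
  have d: "dim_row (e_col m p) = m" "dim_col (e_col m p) = 1" by (auto simp: e_col_def)
  fix i j assume "i < dim_row (block_col n m (p - 1) * C)" "j < dim_col (block_col n m (p - 1) * C)"
  then have ij: "i < m * n" "j < r" using assms by auto
  then have i: "i div n < m" by (simp add: less_mult_imp_div_less)
  have "(e_col m p \<otimes>\<^sub>k C) $$ (i, j) = e_col m p $$ (i div n, j div r) * C $$ (i mod n, j mod r)"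
    using ij assms(1) d by (auto simp: kronecker_def)
  also have "\<dots> = (if i div n = p - 1 then C $$ (i mod n, j) else 0)"
    using ij i by (simp add: e_col_def mat_of_cols_def unit_vec_def)
  also have "\<dots> = (block_col n m (p - 1) * C) $$ (i, j)"
    using assms(1) ij by (subst block_col_mult_index) auto
  finally show "(e_col m p \<otimes>\<^sub>k C) $$ (i, j) = (block_col n m (p - 1) * C) $$ (i, j)" .
qed (use assms in \<open>auto simp: kronecker_def e_col_def\<close>)

lemma kronecker_transpose: "(M \<otimes>\<^sub>k N)\<^sup>T = M\<^sup>T \<otimes>\<^sub>k N\<^sup>T"
proof (rule eq_matI)
  fix i j assume ij: "i < dim_row (M\<^sup>T \<otimes>\<^sub>k N\<^sup>T)" "j < dim_col (M\<^sup>T \<otimes>\<^sub>k N\<^sup>T)"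
  then have b: "i < dim_col M * dim_col N" "j < dim_row M * dim_row N" by (auto simp: kronecker_def)
  then have "0 < dim_col N" "0 < dim_row N" by (auto intro: Nat.gr0I)
  with b show "(M \<otimes>\<^sub>k N)\<^sup>T $$ (i, j) = (M\<^sup>T \<otimes>\<^sub>k N\<^sup>T) $$ (i, j)"
    by (simp add: kronecker_def less_mult_imp_div_less)
qed (auto simp: kronecker_def)

lemma kronecker_e_row:
  assumes "B \<in> carrier_mat r n" "p \<noteq> 0"
  shows "(e_col m p)\<^sup>T \<otimes>\<^sub>k B = B * (block_col n m (p - 1))\<^sup>T"
proof -
  have s: "block_col n m (p - 1) \<in> carrier_mat (m * n) n" by (rule carrier_matI) simp_all
  have "(e_col m p)\<^sup>T \<otimes>\<^sub>k B = (e_col m p \<otimes>\<^sub>k B\<^sup>T)\<^sup>T" by (simp add: kronecker_transpose)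
  also have "\<dots> = (block_col n m (p - 1) * B\<^sup>T)\<^sup>T" using assms by (subst kronecker_e_col[of _ n r]) auto
  also have "\<dots> = B * (block_col n m (p - 1))\<^sup>T" using assms transpose_mult[OF s, of "B\<^sup>T" r] by simp
  finally show ?thesis .
qed

lemma fiedler_eq: "(0 < i \<Longrightarrow> As i \<in> carrier_mat n n) \<Longrightarrow> fiedler n m As i = fiedler_mat n 0 m (- As 0) As i"
  by (auto simp: fiedler_def fiedler_mat_def diag_block_mat_dsum companion_block_def simp del: diag_block_mat.simps)

lemma sys_fiedler_eq:
  assumes As: "\<And>i. i \<le> k \<Longrightarrow> As i \<in> carrier_mat n n" and i: "i \<le> k"
    and c: "C \<in> carrier_mat n r" "A \<in> carrier_mat r r" "B \<in> carrier_mat r n"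
  shows "sys_fiedler n (Suc k) r As C A B i = fiedler_mat n r (Suc k) (four_block_mat (- As 0) (- C) (- B) (- A)) As i"
proof (cases "i = 0")
  case False
  then show ?thesis using As i fiedler_eq[of i As n "Suc k"]
    by (simp add: sys_fiedler_def diag_block_mat_dsum fiedler_mat_system[of i n r _ _ _ "- As 0"] del: diag_block_mat.simps)
next
  case True
  have "As 0 \<in> carrier_mat n n" using As by simp
  then have "fiedler_mat n r (Suc k) (four_block_mat (- As 0) (- C) (- B) (- A)) As 0 =
     four_block_mat (fiedler_mat n 0 (Suc k) (- As 0) As 0) (block_col n (Suc k) k * - C) (- B * (block_col n (Suc k) k)\<^sup>T) (- A)"
    using c by (intro fiedler_mat_zero_blocks) auto
  then show ?thesis using True c fiedler_eq[of 0 As n "Suc k"]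
    by (simp add: sys_fiedler_def kronecker_e_col[of C n r] kronecker_e_row[of B r n] mat_uminus_left_dim mat_uminus_right_dim del: diag_block_mat.simps)
qed

lemma mprod_hom_fiedler_mat:
  fixes As :: "nat \<Rightarrow> 'a::comm_ring_1 mat"
  assumes "comm_ring_hom h" and As: "\<And>i. 0 < i \<Longrightarrow> i \<le> k \<Longrightarrow> As i \<in> carrier_mat n n" and S: "S \<in> carrier_mat (n + r) (n + r)"
    and \<sigma>: "set \<sigma> \<subseteq> {..k}"
  shows "map_mat h (mprod (Suc k * n + r) (fiedler_mat n r (Suc k) S As) \<sigma>) =
    mprod (Suc k * n + r) (fiedler_mat n r (Suc k) (map_mat h S) (\<lambda>i. map_mat h (As i))) \<sigma>"
proof -
  interpret comm_ring_hom h by fact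
  show ?thesis
    by (subst mprod_hom) (use As S \<sigma> in \<open>auto intro!: fiedler_mat_carrier mprod_cong fiedler_mat_hom simp del: mult_Suc\<close>)
qed

lemma block_col_orth:
  assumes "q < m" shows "(block_col n m q)\<^sup>T * block_col n m q = (1\<^sub>m n :: 'a::comm_ring_1 mat)"
proof (rule eq_matI)
  fix i j assume "i < dim_row (1\<^sub>m n :: 'a mat)" "j < dim_col (1\<^sub>m n :: 'a mat)"
  then have ij: "i < n" "j < n" by auto
  have "((block_col n m q)\<^sup>T * block_col n m q) $$ (i, j) = (block_col n m q)\<^sup>T $$ (i, q * n + j)"
    using ij assms by (intro mult_block_col_index) auto
  also have "\<dots> = (1\<^sub>m n :: 'a mat) $$ (i, j)"
    using ij block_index_bound[OF assms ij(2)] by (auto simp: block_col_def incl_def)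
  finally show "((block_col n m q)\<^sup>T * block_col n m q) $$ (i, j) = (1\<^sub>m n :: 'a mat) $$ (i, j)" .
qed auto

text \<open>Since \<^const>\<open>block_col\<close> has orthonormal columns, null vectors of the enlarged borders are null vectors of
  \<open>B\<close> and \<open>C\<close>.\<close>

lemma irreducible_if_minimal:
  assumes min: "minimal_realization n r P C E A B G" and q: "q < m" "q' < m"
  shows "irreducible_pencil (m * n) r (block_col n m q * C) (B * (block_col n m q')\<^sup>T) A E"
  unfolding irreducible_pencil_def
proof (intro allI conjI)
  fix z
  have c: "C \<in> carrier_mat n r" "E \<in> carrier_mat r r" "A \<in> carrier_mat r r" "B \<in> carrier_mat r n"
    using min by (auto simp: minimal_realization_def realization_def)
  have sel: "(block_col n m p :: complex mat) \<in> carrier_mat (m * n) n" for p by (rule carrier_matI) simp_all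
  define BB where "BB = B * (block_col n m q')\<^sup>T"
  define CC where "CC = block_col n m q * C"
  define D where "D = A - z \<cdot>\<^sub>m E"
  have BB: "BB \<in> carrier_mat r (m * n)" and CC: "CC \<in> carrier_mat (m * n) r" and D: "D \<in> carrier_mat r r"
    using c sel by (auto simp: BB_def CC_def D_def)
  have shift: "A' *\<^sub>v v = z \<cdot>\<^sub>v (E' *\<^sub>v v)"
    if "A' \<in> carrier_mat r r" "E' \<in> carrier_mat r r" "(A' - z \<cdot>\<^sub>m E') *\<^sub>v v = 0\<^sub>v r" "v \<in> carrier_vec r" for A' E' v
  proof -
    have "(z \<cdot>\<^sub>m E') *\<^sub>v v = z \<cdot>\<^sub>v (E' *\<^sub>v v)"
      using that(2,4) by (intro eq_vecI) (auto simp: scalar_prod_def sum_distrib_left mult.assoc)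
    then have "A' *\<^sub>v v - z \<cdot>\<^sub>v (E' *\<^sub>v v) = 0\<^sub>v r"
      using that minus_mult_distrib_mat_vec[of A' r r "z \<cdot>\<^sub>m E'" v] by simp
    then have "(A' *\<^sub>v v - z \<cdot>\<^sub>v (E' *\<^sub>v v)) $ i = 0" if "i < r" for i using that by simp
    then show ?thesis using that by (intro eq_vecI) auto
  qed
  have DT: "D\<^sup>T = A\<^sup>T - z \<cdot>\<^sub>m E\<^sup>T" unfolding D_def using c by (intro eq_matI) auto
  show "vec_space.rank r (four_block_mat (B * (block_col n m q')\<^sup>T) (A - z \<cdot>\<^sub>m E) (0\<^sub>m 0 (m * n)) (0\<^sub>m 0 r)) = r"
    unfolding BB_def[symmetric] D_def[symmetric]
  proof (rule rank_if_trivial_left_kernel)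
    let ?M = "four_block_mat BB D (0\<^sub>m 0 (m * n)) (0\<^sub>m 0 r)"
    show M: "?M \<in> carrier_mat r (m * n + r)" using BB D by auto
    fix w assume w: "w \<in> carrier_vec r" "?M\<^sup>T *\<^sub>v w = 0\<^sub>v (m * n + r)"
    have dM: "dim_row ?M = r" "dim_col ?M = m * n + r" using M by auto
    have idx: "col ?M j \<bullet> w = 0" if "j < m * n + r" for j
      using arg_cong[OF w(2), of "\<lambda>v. v $ j"] that dM by simp
    have 1: "BB\<^sup>T *\<^sub>v w = 0\<^sub>v (m * n)"
    proof (rule eq_vecI)
      fix j assume "j < dim_vec (0\<^sub>v (m * n) :: complex vec)"
      then have j: "j < m * n" by simp
      have "col ?M j = col BB j" using j BB D by (intro eq_vecI) auto
      then show "(BB\<^sup>T *\<^sub>v w) $ j = 0\<^sub>v (m * n) $ j" using idx[of j] j BB by simp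
    qed (use BB in simp)
    have 2: "D\<^sup>T *\<^sub>v w = 0\<^sub>v r"
    proof (rule eq_vecI)
      fix j assume "j < dim_vec (0\<^sub>v r :: complex vec)"
      then have j: "j < r" by simp
      have "col ?M (m * n + j) = col D j" using j BB D by (intro eq_vecI) auto
      then show "(D\<^sup>T *\<^sub>v w) $ j = 0\<^sub>v r $ j" using idx[of "m * n + j"] j D by simp
    qed (use D in simp)
    have "B\<^sup>T *\<^sub>v w = 0\<^sub>v n"
    proof -
      have "BB * block_col n m q' = B * ((block_col n m q')\<^sup>T * block_col n m q')" unfolding BB_def using c by (simp add: mat_assoc_dim)
      then have "B = BB * block_col n m q'" unfolding block_col_orth[OF q(2)] using right_mult_one_mat[OF c(4)] by simp
      then have "B\<^sup>T = (block_col n m q')\<^sup>T * BB\<^sup>T" using transpose_mult[OF BB sel] by simp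
      then have "B\<^sup>T *\<^sub>v w = (block_col n m q')\<^sup>T *\<^sub>v (BB\<^sup>T *\<^sub>v w)"
        using assoc_mult_mat_vec[of "(block_col n m q')\<^sup>T" n "m * n" "BB\<^sup>T" r w] sel BB w by simp
      then show ?thesis unfolding 1 using sel[of q'] by (auto intro!: eq_vecI)
    qed
    then show "w = 0\<^sub>v r" using minimal_controllable[OF min w(1)] shift[of "A\<^sup>T" "E\<^sup>T" w] 2 w(1) c unfolding DT by simp
  qed
  show "vec_space.rank (m * n + r) (block_col n m q * C @\<^sub>r (A - z \<cdot>\<^sub>m E)) = r"
    unfolding CC_def[symmetric] D_def[symmetric]
  proof (rule rank_if_trivial_kernel)
    let ?M = "CC @\<^sub>r D"
    show M: "?M \<in> carrier_mat (m * n + r) r" using CC D by (rule carrier_append_rows)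
    fix v assume v: "v \<in> carrier_vec r" "?M *\<^sub>v v = 0\<^sub>v (m * n + r)"
    have "?M *\<^sub>v v = (CC *\<^sub>v v) @\<^sub>v (D *\<^sub>v v)" using CC D v(1) by (rule mat_mult_append)
    moreover have "0\<^sub>v (m * n + r) = 0\<^sub>v (m * n) @\<^sub>v (0\<^sub>v r :: complex vec)" by (rule eq_vecI) auto
    ultimately have "(CC *\<^sub>v v) @\<^sub>v (D *\<^sub>v v) = 0\<^sub>v (m * n) @\<^sub>v 0\<^sub>v r" using v(2) by simp
    then have 1: "CC *\<^sub>v v = 0\<^sub>v (m * n)" and 2: "D *\<^sub>v v = 0\<^sub>v r"
      using append_vec_eq[of "CC *\<^sub>v v" "m * n" "0\<^sub>v (m * n)"] CC v(1) by auto
    have "C *\<^sub>v v = 0\<^sub>v n"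
    proof -
      have "(block_col n m q)\<^sup>T * CC = ((block_col n m q)\<^sup>T * block_col n m q) * C" unfolding CC_def using c by (simp add: mat_assoc_dim)
      then have "C = (block_col n m q)\<^sup>T * CC" unfolding block_col_orth[OF q(1)] using left_mult_one_mat[OF c(1)] by simp
      then have "C *\<^sub>v v = (block_col n m q)\<^sup>T *\<^sub>v (CC *\<^sub>v v)"
        using assoc_mult_mat_vec[of "(block_col n m q)\<^sup>T" n "m * n" CC r v] sel CC v by simp
      then show ?thesis unfolding 1 using sel[of q] by (auto intro!: eq_vecI)
    qed
    then show "v = 0\<^sub>v r" using minimal_observable[OF min v(1)] shift[of A E v] 2 v(1) c unfolding D_def by simp
  qed
qed

lemma GL_imp_unimodular:
  fixes U :: "complex poly mat"
  assumes "U \<in> UNIV_ring.GL k" shows "unimodular k U"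
proof -
  obtain U' where U: "U \<in> carrier_mat k k" "U' \<in> carrier_mat k k" "U * U' = 1\<^sub>m k" using assms by (auto simp: UNIV_ring.GL_def)
  then have "det U * det U' = 1" using det_mult[OF U(1,2)] by simp
  then have "det U dvd 1" by (metis dvd_triv_left)
  then obtain c where "det U = [:c:]" "c dvd 1" unfolding is_unit_poly_iff by auto
  then show ?thesis using U(1) unfolding unimodular_def by auto
qed

lemma i0_c0_le: assumes "distinct \<sigma>" "set \<sigma> = {..k}" shows "i0 \<sigma> \<le> k" "c0 \<sigma> \<le> k"
proof -
  obtain \<alpha> \<beta> where "set \<alpha> \<subseteq> {0<..<Suc k}" "set \<beta> \<subseteq> {0<..<Suc k}" and ch: "i0 \<sigma> = chain \<alpha>" "c0 \<sigma> = chain (rev \<beta>)"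
    using split_at_zero[OF assms] .
  then show "i0 \<sigma> \<le> k" "c0 \<sigma> \<le> k" unfolding ch using chain_in[of \<alpha>] chain_in[of "rev \<beta>"] by auto
qed

lemma (in semiring_hom) block_col_hom: "map_mat hom (block_col n m p) = block_col n m p"
  by (rule eq_matI) (auto simp: block_col_def incl_def)

lemma (in ring_hom) map_mat_uminus: "map_mat hom (- M) = - map_mat hom M"
  by (rule eq_matI) (auto simp: hom_uminus)

lemma to_fract_power: "to_fract (x ^ t) = to_fract x ^ t"
  by (induction t) auto

lemma to_fract_sum: "to_fract (sum f I) = (\<Sum>i\<in>I. to_fract (f i))"
  by (induction I rule: infinite_finite_induct) auto

lemma to_fract_monom: "to_fract (monom a t) = to_fract lam ^ t * to_const a"
proof -
  have "monom a t = lam ^ t * [:a:]" by (simp add: monom_altdef mult.commute)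
  then show ?thesis by (simp only: to_fract_mult to_fract_power)
qed

lemma sum_atMost_split_first: "(\<Sum>t\<le>m. f t) = f 0 + (\<Sum>t=1..m. f t)" for f :: "nat \<Rightarrow> 'a::comm_monoid_add"
  by (simp add: atMost_atLeast0 sum.atLeast_Suc_atMost)

text \<open>The number of blocks is \<open>m = k + 1\<close>. The constants below are the blocks
  \<open>e \<otimes> C\<close> and \<open>e\<^sup>T \<otimes> B\<close> of the system pencil and the leading matrix and the product in
  the Fiedler pencil of the polynomial.\<close>

locale fiedler_setup =
  fixes n k r :: nat and As :: "nat \<Rightarrow> complex mat" and C E A B :: "complex mat"
    and G :: "complex poly fract mat" and \<sigma> :: "nat list"
  assumes As: "\<And>i. i \<le> Suc k \<Longrightarrow> As i \<in> carrier_mat n n"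
    and minimal: "minimal_realization n r (matrix_polynomial n (Suc k) As) C E A B G"
    and \<sigma>: "distinct \<sigma>" "set \<sigma> = {..k}"
begin

definition "N = Suc k * n"
definition "eC = block_col n (Suc k) (k - i0 \<sigma>) * C"
definition "eB = B * (block_col n (Suc k) (k - c0 \<sigma>))\<^sup>T"
definition "Fneg = As (Suc k) \<oplus>\<^sub>m 1\<^sub>m (k * n)"
definition "F\<sigma> = mprod N (fiedler_mat n 0 (Suc k) (- As 0) As) \<sigma>"

lemma C: "C \<in> carrier_mat n r" and E: "E \<in> carrier_mat r r" and A: "A \<in> carrier_mat r r" and B: "B \<in> carrier_mat r n"
  and invE: "invertible_mat E" and G: "G = transfer (matrix_polynomial n (Suc k) As) C E A B"
  using minimal by (auto simp: minimal_realization_def realization_def)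

lemma As0: "As 0 \<in> carrier_mat n n"
  using As by simp

lemma block_col_carrier: "(block_col n (Suc k) p :: complex mat) \<in> carrier_mat (Suc k * n) n"
  by (rule carrier_matI) simp_all

lemma block_colT_carrier: "(block_col n (Suc k) p :: complex mat)\<^sup>T \<in> carrier_mat n (Suc k * n)"
  by (rule carrier_matI) simp_all

lemma carriers: "eC \<in> carrier_mat N r" "eB \<in> carrier_mat r N" "Fneg \<in> carrier_mat N N" "F\<sigma> \<in> carrier_mat N N"
proof -
  note sel = block_col_carrier[folded N_def]
  show "eC \<in> carrier_mat N r" unfolding eC_def using sel C by (rule mult_carrier_mat)
  show "eB \<in> carrier_mat r N" unfolding eB_def using B sel by (intro mult_carrier_mat[of _ r n]) auto
  show "Fneg \<in> carrier_mat N N" unfolding Fneg_def N_def using dsum_carrier[OF As[of "Suc k"] one_carrier_mat[of "k * n"]] by simp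
  show "F\<sigma> \<in> carrier_mat N N" unfolding F\<sigma>_def
  proof (rule mprod_carrier)
    fix i assume "i \<in> set \<sigma>"
    then show "fiedler_mat n 0 (Suc k) (- As 0) As i \<in> carrier_mat N N"
      using fiedler_mat_carrier[of "- As 0" n 0 i "Suc k" As] As \<sigma>(2) by (simp add: N_def del: mult_Suc)
  qed
qed

lemmas dims [simp] = carriers[THEN carrier_matD(1)] carriers[THEN carrier_matD(2)] carrier_matD[OF C]
  carrier_matD[OF E] carrier_matD[OF A] carrier_matD[OF B]

lemma kronecker_eC: "e_col (Suc k) (Suc k - i0 \<sigma>) \<otimes>\<^sub>k C = eC"
  using i0_c0_le[OF \<sigma>] C by (subst kronecker_e_col[of C n r]) (auto simp: eC_def)

lemma kronecker_eB: "(e_col (Suc k) (Suc k - c0 \<sigma>))\<^sup>T \<otimes>\<^sub>k B = eB"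
  using i0_c0_le[OF \<sigma>] B by (subst kronecker_e_row[of B r n]) (auto simp: eB_def)

lemma fiedler_neg_eq: "fiedler_neg n (Suc k) As = Fneg"
  by (simp add: fiedler_neg_def diag_block_mat_dsum Fneg_def del: diag_block_mat.simps)

lemma fiedler_prod_eq: "mat_list_prod (Suc k * n) (fiedler n (Suc k) As) \<sigma> = F\<sigma>"
  unfolding mat_list_prod_mprod F\<sigma>_def N_def
  by (rule mprod_cong, rule fiedler_eq) (use As \<sigma> in auto)

lemma sys_prod_eq: "mat_list_prod (Suc k * n + r) (sys_fiedler n (Suc k) r As C A B) \<sigma> = four_block_mat F\<sigma> (- eC) (- eB) (- A)"
proof -
  have "mat_list_prod (Suc k * n + r) (sys_fiedler n (Suc k) r As C A B) \<sigma> =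
     mprod (Suc k * n + r) (fiedler_mat n r (Suc k) (four_block_mat (- As 0) (- C) (- B) (- A)) As) \<sigma>"
    unfolding mat_list_prod_mprod by (rule mprod_cong, rule sys_fiedler_eq) (use As \<sigma> C A B in auto)
  also have "\<dots> = four_block_mat F\<sigma> (block_col n (Suc k) (k - i0 \<sigma>) * - C) (- B * (block_col n (Suc k) (k - c0 \<sigma>))\<^sup>T) (- A)"
    unfolding F\<sigma>_def N_def by (rule fiedler_product_system[OF \<sigma>]) (use As As0 C A B in auto)
  finally show ?thesis by (simp add: eC_def eB_def mat_uminus_left_dim mat_uminus_right_dim)
qed

abbreviation "L\<sigma> \<equiv> sys_fiedler_pencil n (Suc k) r As C E A B \<sigma>"

text \<open>The double signs give the shape \<open>X - \<lambda> Y\<close> that a Rosenbrock pencil has in its leading block.\<close>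

lemma fiedler_pencil_eq: "fiedler_pencil n (Suc k) As \<sigma> = const_mat (- F\<sigma>) - lam \<cdot>\<^sub>m const_mat (- Fneg)"
  unfolding fiedler_pencil_def fiedler_neg_eq fiedler_prod_eq
  by (rule eq_matI) (auto simp: const_mat_def)

lemma sys_pencil_eq: "L\<sigma> = four_block_mat (fiedler_pencil n (Suc k) As \<sigma>) (const_mat eC) (const_mat eB) (const_mat A - lam \<cdot>\<^sub>m const_mat E)"
proof -
  have "sys_fiedler_neg n (Suc k) As E = Fneg \<oplus>\<^sub>m - E"
    by (simp add: sys_fiedler_neg_def diag_block_mat_dsum fiedler_neg_eq del: diag_block_mat.simps)
  then show ?thesis unfolding sys_fiedler_pencil_def sys_prod_eq fiedler_pencil_eq
    by (intro eq_matI) (auto simp: const_mat_def dsum_index)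
qed

lemma pencil_transfer_eq: "pencil_transfer N L\<sigma> = transfer (fiedler_pencil n (Suc k) As \<sigma>) eC E A eB"
proof -
  have P: "fiedler_pencil n (Suc k) As \<sigma> \<in> carrier_mat N N"
    unfolding fiedler_pencil_eq by (rule carrier_matI) (simp_all add: const_mat_def)
  have "split_block L\<sigma> N N = (fiedler_pencil n (Suc k) As \<sigma>, const_mat eC, const_mat eB, const_mat A - lam \<cdot>\<^sub>m const_mat E)"
    unfolding sys_pencil_eq split_block_def Let_def using P
    by (auto simp: const_mat_def intro!: eq_matI)
  moreover have "- (const_mat A - lam \<cdot>\<^sub>m const_mat E) = lam \<cdot>\<^sub>m const_mat E - const_mat A"
    by (rule eq_matI) (auto simp: const_mat_def)
  ultimately show ?thesis unfolding pencil_transfer_def transfer_def by simp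
qed

lemma irreducible_blocks:
  "\<exists>X Y CC BB H K.
        X \<in> carrier_mat N N \<and> Y \<in> carrier_mat N N \<and>
        CC \<in> carrier_mat N r \<and> BB \<in> carrier_mat r N \<and>
        H \<in> carrier_mat r r \<and> K \<in> carrier_mat r r \<and>
        L\<sigma> = four_block_mat (const_mat X - lam \<cdot>\<^sub>m const_mat Y) (const_mat CC)
              (const_mat BB) (const_mat H - lam \<cdot>\<^sub>m const_mat K) \<and>
        invertible_mat K \<and> irreducible_pencil N r CC BB H K"
proof (intro exI conjI)
  show "irreducible_pencil N r eC eB A E" unfolding eC_def eB_def N_def
    by (rule irreducible_if_minimal[OF minimal]) auto
qed (use sys_pencil_eq[unfolded fiedler_pencil_eq] carriers A E invE in auto)

text \<open>Moving \<open>\<lambda> E\<close> from the leading matrix into \<open>S\<close> turns the system pencil into a pencil to which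
  \<open>pencil_equivalent\<close> applies.\<close>

lemma unimodular_equivalence:
  "\<exists>U V. unimodular N U \<and> unimodular N V \<and>
     (U \<oplus>\<^sub>m 1\<^sub>m r) * L\<sigma> * (V \<oplus>\<^sub>m 1\<^sub>m r) = 1\<^sub>m (k * n) \<oplus>\<^sub>m system_matrix (matrix_polynomial n (Suc k) As) C E A B"
proof -
  let ?c = "map_mat (\<lambda>c :: complex. [:c:])"
  define Ap where "Ap = (\<lambda>i. ?c (As i))"
  define S where "S = four_block_mat (- Ap 0) (- ?c C) (- ?c B) (lam \<cdot>\<^sub>m ?c E - ?c A)"
  have S: "S \<in> carrier_mat (n + r) (n + r)" using As0 by (auto simp: S_def Ap_def)
  have Ap: "Ap i \<in> carrier_mat n n" if "i \<le> Suc k" for i using As[OF that] by (simp add: Ap_def)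
  have "mprod (Suc k * n + r) (fiedler_mat n r (Suc k) S Ap) \<sigma> =
    four_block_mat (mprod (Suc k * n) (fiedler_mat n 0 (Suc k) (- Ap 0) Ap) \<sigma>) (block_col n (Suc k) (k - i0 \<sigma>) * (- ?c C))
      ((- ?c B) * (block_col n (Suc k) (k - c0 \<sigma>))\<^sup>T) (lam \<cdot>\<^sub>m ?c E - ?c A)"
    unfolding S_def
  proof (rule fiedler_product_system[OF \<sigma>])
    show "Ap i \<in> carrier_mat n n" if "0 < i" "i \<le> k" for i using Ap[of i] that by simp
    show "- Ap 0 \<in> carrier_mat n n" using Ap[of 0] by simp
  qed (rule carrier_matI; simp)+
  also have "mprod (Suc k * n) (fiedler_mat n 0 (Suc k) (- Ap 0) Ap) \<sigma> = ?c F\<sigma>"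
    unfolding F\<sigma>_def N_def using mprod_hom_fiedler_mat[OF const_hom.comm_ring_hom_axioms, of k As n "- As 0" 0 \<sigma>] As As0 \<sigma>
    by (simp add: Ap_def const_hom.map_mat_uminus)
  also have "block_col n (Suc k) (k - i0 \<sigma>) * (- ?c C) = - ?c eC"
    unfolding eC_def using C const_hom.mat_hom_mult[OF block_col_carrier C] const_hom.block_col_hom by (simp add: mat_uminus_right_dim)
  also have "(- ?c B) * (block_col n (Suc k) (k - c0 \<sigma>))\<^sup>T = - ?c eB"
    unfolding eB_def using B const_hom.mat_hom_mult[OF B block_colT_carrier] const_hom.block_col_hom
    by (simp add: mat_uminus_left_dim map_mat_transpose[symmetric])
  finally have P: "mprod (Suc k * n + r) (fiedler_mat n r (Suc k) S Ap) \<sigma> = four_block_mat (?c F\<sigma>) (- ?c eC) (- ?c eB) (lam \<cdot>\<^sub>m ?c E - ?c A)" .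
  have L: "L\<sigma> = pencil n r (Suc k) lam S Ap \<sigma>"
    unfolding pencil_def P sys_pencil_eq fiedler_pencil_eq
    using Ap[of "Suc k"]
    by (intro eq_matI) (auto simp: const_mat_def dsum_index Ap_def Fneg_def N_def)
  have "(power_sum n lam (Suc k) Ap \<oplus>\<^sub>m 0\<^sub>m r r) - S = system_matrix (matrix_polynomial n (Suc k) As) C E A B"
  proof -
    have "power_sum n lam (Suc k) Ap + Ap 0 = matrix_polynomial n (Suc k) As"
    proof (rule eq_matI)
      fix i j assume "i < dim_row (matrix_polynomial n (Suc k) As)" "j < dim_col (matrix_polynomial n (Suc k) As)"
      then have ij: "i < n" "j < n" by (auto simp: matrix_polynomial_def)
      have "lam ^ t * Ap t $$ (i, j) = monom (As t $$ (i, j)) t" if "t \<le> Suc k" for t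
        using As[OF that] ij by (simp add: Ap_def monom_altdef mult.commute)
      then have "(\<Sum>t=1..Suc k. lam ^ t * Ap t $$ (i, j)) = (\<Sum>t=1..Suc k. monom (As t $$ (i, j)) t)"
        by (intro sum.cong) auto
      then show "(power_sum n lam (Suc k) Ap + Ap 0) $$ (i, j) = matrix_polynomial n (Suc k) As $$ (i, j)"
        using ij As0 by (simp add: power_sum_def matrix_polynomial_def sum_atMost_split_first Ap_def monom_0 add.commute del: sum.cl_ivl_Suc)
    qed (use Ap[of 0] in \<open>auto simp: matrix_polynomial_def\<close>)
    moreover have "(M \<oplus>\<^sub>m 0\<^sub>m r r) - S = four_block_mat (M + Ap 0) (?c C) (?c B) (?c A - lam \<cdot>\<^sub>m ?c E)"
      if "M \<in> carrier_mat n n" for M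
      using that Ap[of 0] unfolding S_def by (intro eq_matI) (auto simp: dsum_index)
    ultimately show ?thesis using power_sum_carrier[of n lam "Suc k" Ap]
      unfolding system_matrix_def const_mat_def by simp
  qed
  moreover have "UNIV_ring.gl_equiv (Suc k * n) r (pencil n r (Suc k) lam S Ap \<sigma>) (1\<^sub>m (k * n) \<oplus>\<^sub>m ((power_sum n lam (Suc k) Ap \<oplus>\<^sub>m 0\<^sub>m r r) - S))"
    by (rule pencil_equivalent[OF S _ \<sigma>]) (use Ap in blast)
  ultimately have "UNIV_ring.gl_equiv N r L\<sigma> (1\<^sub>m (k * n) \<oplus>\<^sub>m system_matrix (matrix_polynomial n (Suc k) As) C E A B)"
    unfolding L N_def by (simp only:)
  moreover have "L\<sigma> \<in> carrier_mat (N + r) (N + r)"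
    unfolding sys_pencil_eq fiedler_pencil_eq by (intro carrier_matI) (simp_all add: const_mat_def)
  moreover have "1\<^sub>m (k * n) \<oplus>\<^sub>m system_matrix (matrix_polynomial n (Suc k) As) C E A B \<in> carrier_mat (N + r) (N + r)"
    by (intro carrier_matI) (simp_all add: system_matrix_def const_mat_def matrix_polynomial_def N_def)
  ultimately have "UNIV_ring.gl_equiv N r (1\<^sub>m (k * n) \<oplus>\<^sub>m system_matrix (matrix_polynomial n (Suc k) As) C E A B) L\<sigma>"
    using UNIV_ring.gl_equiv_sym by blast
  then show ?thesis unfolding UNIV_ring.gl_equiv_def using GL_imp_unimodular by metis
qed

text \<open>By \<open>fiedler_product_update\<close>, the term \<open>eC (\<lambda> E - A)\<^sup>-\<^sup>1 eB\<close> of the transfer function has the same effect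
  as adding \<open>-R\<close> to \<open>S = -A\<^sub>0\<close>. So the transfer function is a Fiedler pencil of \<open>G\<close>, formally a polynomial
  whose constant coefficient is the proper matrix \<open>A\<^sub>0 + R\<close>.\<close>

lemma biproper_equivalence:
  "\<exists>Ol Or. biproper N Ol \<and> biproper N Or \<and>
     Ol * (inverse (to_fract lam) \<cdot>\<^sub>m transfer (fiedler_pencil n (Suc k) As \<sigma>) eC E A eB) * Or
       = 1\<^sub>m (k * n) \<oplus>\<^sub>m (inverse (to_fract lam ^ Suc k) \<cdot>\<^sub>m G)"
proof -
  let ?h = "map_mat to_const" and ?l = "to_fract lam" and ?u = "inverse (to_fract lam)"
  let ?e = "block_col n (Suc k) (k - i0 \<sigma>)" and ?f = "(block_col n (Suc k) (k - c0 \<sigma>))\<^sup>T"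
  obtain Z where Z: "Z \<in> carrier_mat r r" "entries_in proper_fun Z"
     "the (mat_inverse (to_rat_mat (lam \<cdot>\<^sub>m const_mat E - const_mat A))) = Z"
    using resolvent_proper[OF E invE A] .
  define R where "R = ?h C * Z * ?h B"
  define Ah where "Ah = (\<lambda>i. ?h (As i))"
  have Ah: "Ah i \<in> carrier_mat n n" if "i \<le> Suc k" for i using As[OF that] by (simp add: Ah_def)
  have dZ[simp]: "dim_row Z = r" "dim_col Z = r" using Z by auto
  have R: "R \<in> carrier_mat n n" unfolding R_def by (intro carrier_matI) simp_all
  have const: "to_const c \<in> proper_fun" for c using has_limit_const by (auto simp: proper_fun_def)
  have hR: "entries_in proper_fun (?h M)" for M using const by (auto simp: entries_in_def)
  have RR: "entries_in proper_fun R" unfolding R_def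
    by (intro proper.entries_mult hR Z) simp_all
  have u: "?u \<in> proper_fun" using has_limit_inverse_lam by (auto simp: proper_fun_def)
  have l: "?l \<noteq> 0" by simp
  have ul: "?u * ?l = 1" using l by simp
  define S where "S = - Ah 0 + - R"
  have S: "S \<in> carrier_mat n n" using Ah[of 0] R by (auto simp: S_def)
  have SR: "entries_in proper_fun S" unfolding S_def using Ah[of 0] R RR hR
    by (intro proper.entries_simps) (auto simp: Ah_def)
  have prod: "mprod N (fiedler_mat n 0 (Suc k) S Ah) \<sigma> = ?h F\<sigma> + ?e * (- R) * ?f"
  proof -
    have "mprod N (fiedler_mat n 0 (Suc k) S Ah) \<sigma> = mprod N (fiedler_mat n 0 (Suc k) (- Ah 0) Ah) \<sigma> + ?e * (- R) * ?f"
      unfolding S_def N_def by (rule fiedler_product_update[OF \<sigma>]) (use Ah R in auto)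
    also have "mprod N (fiedler_mat n 0 (Suc k) (- Ah 0) Ah) \<sigma> = ?h F\<sigma>"
      unfolding F\<sigma>_def N_def using mprod_hom_fiedler_mat[OF to_const_hom.comm_ring_hom_axioms, of k As n "- As 0" 0 \<sigma>] As As0 \<sigma>
      by (simp add: Ah_def to_const_hom.map_mat_uminus)
    finally show ?thesis .
  qed
  have eCh: "?h eC = ?e * ?h C"
    unfolding eC_def using to_const_hom.mat_hom_mult[OF block_col_carrier C] to_const_hom.block_col_hom by simp
  have eBh: "?h eB = ?h B * ?f"
    unfolding eB_def using to_const_hom.mat_hom_mult[OF B block_colT_carrier] to_const_hom.block_col_hom
    by (simp add: map_mat_transpose[symmetric])
  have GG: "transfer (fiedler_pencil n (Suc k) As \<sigma>) eC E A eB = ?l \<cdot>\<^sub>m ?h Fneg - mprod N (fiedler_mat n 0 (Suc k) S Ah) \<sigma>"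
  proof -
    have "to_rat_mat (fiedler_pencil n (Suc k) As \<sigma>) = ?l \<cdot>\<^sub>m ?h Fneg - ?h F\<sigma>"
      unfolding fiedler_pencil_def fiedler_neg_eq fiedler_prod_eq by (rule to_rat_pencil) simp_all
    moreover have "?e * ?h C * Z * (?h B * ?f) = ?e * R * ?f"
      unfolding R_def by (simp add: mat_assoc_dim)
    ultimately show ?thesis
      unfolding transfer_def Z(3) to_rat_const eCh eBh prod using R
      by (auto simp: mat_uminus_left_dim mat_uminus_right_dim N_def intro!: eq_matI simp del: index_mult_mat(1))
  qed
  have X: "?u \<cdot>\<^sub>m transfer (fiedler_pencil n (Suc k) As \<sigma>) eC E A eB = rev_pencil n (Suc k) ?u S Ah \<sigma>"
  proof -
    have F: "?h Fneg = Ah (Suc k) \<oplus>\<^sub>m 1\<^sub>m ((Suc k - 1) * n)"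
      by (simp add: Fneg_def Ah_def dsum_map to_const_hom.mat_hom_one)
    have d: "dim_row (mprod N (fiedler_mat n 0 (Suc k) S Ah) \<sigma>) = N" "dim_col (mprod N (fiedler_mat n 0 (Suc k) S Ah) \<sigma>) = N"
      unfolding prod by (simp_all add: N_def)
    have "?u \<cdot>\<^sub>m (?l \<cdot>\<^sub>m ?h Fneg - M) = ?h Fneg - ?u \<cdot>\<^sub>m M" if "dim_row M = N" "dim_col M = N" for M
      using that by (intro eq_matI) (auto simp: right_diff_distrib ul mult.assoc[symmetric])
    then show ?thesis unfolding GG rev_pencil_def F[symmetric] N_def[symmetric] using d by blast
  qed
  have "proper.gl_equiv N 0 (rev_pencil n (Suc k) ?u S Ah \<sigma>) (reversal n ?u (Suc k) S Ah \<oplus>\<^sub>m 1\<^sub>m (k * n))"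
    unfolding N_def by (rule proper.rev_pencil_equivalent[OF u S SR _ \<sigma>]) (use Ah hR in \<open>auto simp: Ah_def\<close>)
  moreover have "proper.gl_equiv N 0 (reversal n ?u (Suc k) S Ah \<oplus>\<^sub>m 1\<^sub>m (k * n)) (1\<^sub>m (k * n) \<oplus>\<^sub>m reversal n ?u (Suc k) S Ah)"
    using proper.gl_equiv_swap[OF reversal_carrier] by (simp add: N_def)
  moreover have c: "1\<^sub>m (k * n) \<oplus>\<^sub>m reversal n ?u (Suc k) S Ah \<in> carrier_mat (N + 0) (N + 0)"
    by (intro carrier_matI) (simp_all add: N_def reversal_def)
  ultimately have "proper.gl_equiv N 0 (rev_pencil n (Suc k) ?u S Ah \<sigma>) (1\<^sub>m (k * n) \<oplus>\<^sub>m reversal n ?u (Suc k) S Ah)"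
    using proper.gl_equiv_trans by blast
  then have "proper.gl_equiv N 0 (1\<^sub>m (k * n) \<oplus>\<^sub>m reversal n ?u (Suc k) S Ah) (rev_pencil n (Suc k) ?u S Ah \<sigma>)"
    by (rule proper.gl_equiv_sym[OF _ c])
  moreover have "reversal n ?u (Suc k) S Ah = inverse (?l ^ Suc k) \<cdot>\<^sub>m G"
  proof (rule eq_matI)
    have G': "G = to_rat_mat (matrix_polynomial n (Suc k) As) + R"
      unfolding G transfer_def Z(3) to_rat_const R_def ..
    have dG: "dim_row G = n" "dim_col G = n" unfolding G' using R by auto
    fix i j assume "i < dim_row (inverse (?l ^ Suc k) \<cdot>\<^sub>m G)" "j < dim_col (inverse (?l ^ Suc k) \<cdot>\<^sub>m G)"
    then have ij: "i < n" "j < n" by (auto simp: dG)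
    let ?m = "Suc k"
    \<comment> \<open>clearing the powers of \<open>\<lambda>\<close> by the common factor \<open>\<lambda>\<^sup>-\<^sup>m\<close>\<close>
    have pow: "?u ^ (?m - t) = ?u ^ ?m * ?l ^ t" if "t \<le> ?m" for t
    proof -
      have "?u ^ ?m = ?u ^ (?m - t) * ?u ^ t" using that by (simp only: power_add[symmetric] le_add_diff_inverse2)
      then show ?thesis using l by (simp add: mult.assoc power_mult_distrib[symmetric] ul del: power_Suc)
    qed
    have 1: "(\<Sum>t=1..?m. ?u ^ (?m - t) * Ah t $$ (i, j)) = ?u ^ ?m * (\<Sum>t=1..?m. ?l ^ t * to_const (As t $$ (i, j)))"
      unfolding sum_distrib_left
    proof (rule sum.cong)
      fix t assume t: "t \<in> {1..?m}"
      then have "Ah t $$ (i, j) = to_const (As t $$ (i, j))" using As[of t] ij by (simp add: Ah_def)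
      then show "?u ^ (?m - t) * Ah t $$ (i, j) = ?u ^ ?m * (?l ^ t * to_const (As t $$ (i, j)))"
        using pow[of t] t by (simp only: mult.assoc atLeastAtMost_iff)
    qed simp
    have 2: "S $$ (i, j) = - (to_const (As 0 $$ (i, j)) + R $$ (i, j))"
      using ij As0 R by (simp add: S_def Ah_def)
    have 3: "to_rat_mat (matrix_polynomial n ?m As) $$ (i, j) =
        to_const (As 0 $$ (i, j)) + (\<Sum>t=1..?m. ?l ^ t * to_const (As t $$ (i, j)))"
    proof -
      have "to_rat_mat (matrix_polynomial n ?m As) $$ (i, j) = to_fract (\<Sum>t\<le>?m. monom (As t $$ (i, j)) t)"
        using ij by (simp add: to_rat_mat_def matrix_polynomial_def)
      also have "\<dots> = (\<Sum>t\<le>?m. to_fract (monom (As t $$ (i, j)) t))"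
        by (rule to_fract_sum)
      finally show ?thesis by (simp only: to_fract_monom sum_atMost_split_first) simp
    qed
    have dist: "c * x - c * (- (a + b)) = c * ((a + x) + b)" for a b c x :: "complex poly fract"
      by (simp add: algebra_simps)
    have "reversal n ?u ?m S Ah $$ (i, j) = (\<Sum>t=1..?m. ?u ^ (?m - t) * Ah t $$ (i, j)) - ?u ^ ?m * S $$ (i, j)"
      using ij by (simp add: reversal_def del: sum.cl_ivl_Suc power_Suc)
    also have "\<dots> = ?u ^ ?m * (to_rat_mat (matrix_polynomial n ?m As) $$ (i, j) + R $$ (i, j))"
      unfolding 1 2 3 by (rule dist)
    also have "\<dots> = (inverse (?l ^ ?m) \<cdot>\<^sub>m G) $$ (i, j)"
      using ij dG R unfolding G' power_inverse by (simp del: power_Suc)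
    finally show "reversal n ?u ?m S Ah $$ (i, j) = (inverse (?l ^ ?m) \<cdot>\<^sub>m G) $$ (i, j)" .
  next
    show "dim_row (reversal n ?u (Suc k) S Ah) = dim_row (inverse (?l ^ Suc k) \<cdot>\<^sub>m G)"
      unfolding G transfer_def by (simp add: reversal_def const_mat_def to_rat_mat_def)
    show "dim_col (reversal n ?u (Suc k) S Ah) = dim_col (inverse (?l ^ Suc k) \<cdot>\<^sub>m G)"
      unfolding G transfer_def by (simp add: reversal_def const_mat_def to_rat_mat_def)
  qed
  ultimately show ?thesis unfolding proper.gl_equiv_def X[symmetric] using GL_proper_imp_biproper by auto metis
qed

end

theorem theorem3p19:
  fixes n m r :: nat
    and As :: "nat \<Rightarrow> complex mat"
    and C E A B :: "complex mat"
    and G :: "complex poly fract mat"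
    and \<sigma> :: "nat list"
  assumes "m \<ge> 1"
    and "\<And>i. i \<le> m \<Longrightarrow> As i \<in> carrier_mat n n"
    and "As m \<noteq> 0\<^sub>m n n"
    and "minimal_realization n r (matrix_polynomial n m As) C E A B G"
    and "distinct \<sigma>" and "set \<sigma> = {0..<m}"
  shows
    "let L\<sigma> = sys_fiedler_pencil n m r As C E A B \<sigma>;
         GG = transfer (fiedler_pencil n m As \<sigma>) (e_col m (m - i0 \<sigma>) \<otimes>\<^sub>k C) E A
                (transpose_mat (e_col m (m - c0 \<sigma>)) \<otimes>\<^sub>k B)
     in rosenbrock_strong_linearization n m r As C E A B L\<sigma> \<and>
        (\<exists>U V U\<^sub>0 V\<^sub>0.
           unimodular (m * n) U \<and> unimodular (m * n) V \<and>
           U\<^sub>0 \<in> carrier_mat r r \<and> invertible_mat U\<^sub>0 \<and>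
           V\<^sub>0 \<in> carrier_mat r r \<and> invertible_mat V\<^sub>0 \<and>
           (\<forall>z. poly_mat_at (diag_block_mat [U, const_mat U\<^sub>0] * L\<sigma> * diag_block_mat [V, const_mat V\<^sub>0]) z
              = poly_mat_at (diag_block_mat [1\<^sub>m ((m - 1) * n),
                   system_matrix (matrix_polynomial n m As) C E A B]) z)) \<and>
        pencil_transfer (m * n) L\<sigma> = GG \<and>
        (\<exists>Ol Or.
           biproper (m * n) Ol \<and> biproper (m * n) Or \<and>
           Ol * (inverse (to_fract lam) \<cdot>\<^sub>m GG) * Or
             = diag_block_mat [1\<^sub>m ((m - 1) * n), inverse (to_fract lam ^ m) \<cdot>\<^sub>m G])"
proof -
  let ?L = "sys_fiedler_pencil n m r As C E A B \<sigma>"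
  let ?Y = "diag_block_mat [1\<^sub>m ((m - 1) * n), system_matrix (matrix_polynomial n m As) C E A B]"
  obtain k where m: "m = Suc k" using assms(1) by (cases m) auto
  have "set \<sigma> = {..k}" unfolding assms(6) m by (simp only: atLeast0LessThan lessThan_Suc_atMost)
  with assms(2,4,5) interpret fiedler_setup n k r As C E A B G \<sigma>
    unfolding m by unfold_locales
  define GG where "GG = transfer (fiedler_pencil n m As \<sigma>) (e_col m (m - i0 \<sigma>) \<otimes>\<^sub>k C) E A (transpose_mat (e_col m (m - c0 \<sigma>)) \<otimes>\<^sub>k B)"
  have GG: "GG = transfer (fiedler_pencil n (Suc k) As \<sigma>) eC E A eB"
    unfolding GG_def m kronecker_eC kronecker_eB ..
  have N: "m * n = N" "(m - 1) * n = k * n" by (simp_all add: m N_def)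
  obtain U V where UV: "unimodular N U" "unimodular N V"
     "(U \<oplus>\<^sub>m 1\<^sub>m r) * L\<sigma> * (V \<oplus>\<^sub>m 1\<^sub>m r) = 1\<^sub>m (k * n) \<oplus>\<^sub>m system_matrix (matrix_polynomial n (Suc k) As) C E A B"
    using unimodular_equivalence by blast
  have one: "invertible_mat (1\<^sub>m r :: complex mat)" by (rule invertible_matI[of _ r "1\<^sub>m r"]) auto
  have d: "diag_block_mat [W, const_mat (1\<^sub>m r)] = W \<oplus>\<^sub>m 1\<^sub>m r" for W
    by (simp add: diag_block_mat_dsum const_mat_def const_hom.mat_hom_one del: diag_block_mat.simps)
  have d2: "diag_block_mat [1\<^sub>m ((m - 1) * n), W] = 1\<^sub>m (k * n) \<oplus>\<^sub>m W" for W :: "'z::{zero,one} mat"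
    by (simp only: diag_block_mat_dsum N)
  have a: "diag_block_mat [U, const_mat (1\<^sub>m r)] * ?L * diag_block_mat [V, const_mat (1\<^sub>m r)] = ?Y"
    unfolding d d2 using UV(3) by (simp only: m)
  have a_ex: "\<exists>U V U\<^sub>0 V\<^sub>0.
        unimodular (m * n) U \<and> unimodular (m * n) V \<and>
        U\<^sub>0 \<in> carrier_mat r r \<and> invertible_mat U\<^sub>0 \<and>
        V\<^sub>0 \<in> carrier_mat r r \<and> invertible_mat V\<^sub>0 \<and>
        diag_block_mat [U, const_mat U\<^sub>0] * ?L * diag_block_mat [V, const_mat V\<^sub>0] = ?Y"
    using UV(1,2) one a unfolding N by (intro exI[of _ U] exI[of _ V] exI[of _ "1\<^sub>m r"] conjI) auto
  have b: "pencil_transfer (m * n) ?L = GG"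
    unfolding GG N(1) using pencil_transfer_eq by (simp only: m)
  have b_ex: "\<exists>Ol Or.
           biproper (m * n) Ol \<and> biproper (m * n) Or \<and>
           Ol * (inverse (to_fract lam) \<cdot>\<^sub>m GG) * Or
             = diag_block_mat [1\<^sub>m ((m - 1) * n), inverse (to_fract lam ^ m) \<cdot>\<^sub>m G]"
    unfolding d2 GG N(1) using biproper_equivalence by (simp only: m)
  have G': "transfer (matrix_polynomial n m As) C E A B = G" using G by (simp only: m)
  have "rosenbrock_strong_linearization n m r As C E A B ?L"
    unfolding rosenbrock_strong_linearization_def b G'
    by (rule conjI[OF irreducible_blocks[folded m, folded N(1)] conjI[OF a_ex b_ex]])
  moreover from a_ex have "\<exists>U V U\<^sub>0 V\<^sub>0. unimodular (m * n) U \<and> unimodular (m * n) V \<and>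
      U\<^sub>0 \<in> carrier_mat r r \<and> invertible_mat U\<^sub>0 \<and> V\<^sub>0 \<in> carrier_mat r r \<and> invertible_mat V\<^sub>0 \<and>
      (\<forall>z. poly_mat_at (diag_block_mat [U, const_mat U\<^sub>0] * ?L * diag_block_mat [V, const_mat V\<^sub>0]) z
        = poly_mat_at (?Y) z)"
    by metis
  ultimately show ?thesis unfolding Let_def GG_def[symmetric] using b b_ex by blast
qed

end
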